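(* Let $F$ be a free group, $N\triangleleft F$ a normal subgroup and $G=F/N$. If $G$ is right orderable and the relation module $N_{\mathrm{ab}}=N/[N,N]$ is generated as a $\mathbb{Z}G$-module by a single element $r\in N_{\mathrm{ab}}$, then there is an element $w\in N$ such that $$w[N,N]=r\quad\text{and}\quad\langle\!\langle w\rangle\!\rangle=N.$$ In particular, $G$ is a one-relator group.
   Context: The relation module $N_{\mathrm{ab}}=N/[N,N]$ is a left $\mathbb{Z}G$-module via the action induced by conjugation by $F$. $\langle\!\langle w\rangle\!\rangle$ denotes the normal closure of $w$ in $F$. A group $G$ is right orderable if it has a total order such that $a<b$ implies $ag<bg$ for all $a,b,g\in G$. *)

theory Defs
  imports "HOL-Algebra.Generated_Groups" "HOL-Algebra.FiniteProduct" "HOL-Algebra.Module"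
begin

section \<open>Free groups\<close>

text \<open>
  A letter \<open>(x, True)\<close> stands for the generator \<open>x\<close> and \<open>(x, False)\<close> for its formal
  inverse. The free group on \<open>X\<close> consists of the reduced words in these letters; the product
  of \<open>u\<close> and \<open>v\<close> is obtained by prepending the letters of \<open>u\<close> to \<open>v\<close> one after the other,
  starting with the last one, and cancelling whenever possible.
\<close>

definition letter_inv :: "'a \<times> bool \<Rightarrow> 'a \<times> bool" where
  "letter_inv l = (fst l, \<not> snd l)"

definition reduced :: "('a \<times> bool) list \<Rightarrow> bool" where
  "reduced w \<longleftrightarrow> successively (\<lambda>l k. k \<noteq> letter_inv l) w"

fun prepend :: "'a \<times> bool \<Rightarrow> ('a \<times> bool) list \<Rightarrow> ('a \<times> bool) list" where
  "prepend l [] = [l]"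
| "prepend l (k # w) = (if k = letter_inv l then w else l # k # w)"

definition free_group :: "'a set \<Rightarrow> ('a \<times> bool) list monoid" where
  "free_group X =
     \<lparr>carrier = {w. set w \<subseteq> X \<times> UNIV \<and> reduced w},
      mult = (\<lambda>u v. foldr prepend u v),
      one = []\<rparr>"

lemma letter_inv_letter_inv [simp]: "letter_inv (letter_inv l) = l"
  by (simp add: letter_inv_def)

lemma letter_inv_mem [simp]: "letter_inv l \<in> X \<times> UNIV \<longleftrightarrow> l \<in> X \<times> UNIV"
  by (cases l) (simp add: letter_inv_def)

lemma letter_inv_eq_iff: "letter_inv l = k \<longleftrightarrow> l = letter_inv k"
  by auto

lemma reduced_Cons: "reduced (l # w) \<longleftrightarrow> reduced w \<and> (w = [] \<or> hd w \<noteq> letter_inv l)"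
  by (auto simp: reduced_def successively_Cons)

lemma reduced_prepend: "reduced w \<Longrightarrow> reduced (prepend l w)"
  by (cases w) (auto simp: reduced_def successively_Cons)

lemma prepend_cancel:
  assumes "reduced w"
  shows "prepend (letter_inv l) (prepend l w) = w"
proof (cases w)
  case (Cons k w')
  with assms show ?thesis by (cases w') (auto simp: reduced_def)
qed simp

lemma prepend_cancel': "reduced w \<Longrightarrow> prepend l (prepend (letter_inv l) w) = w"
  using prepend_cancel[of w "letter_inv l"] by simp

lemma reduced_foldr_prepend: "reduced v \<Longrightarrow> reduced (foldr prepend u v)"
  by (induction u) (auto intro: reduced_prepend)

lemma set_prepend: "set (prepend l w) \<subseteq> insert l (set w)"
  by (cases w) auto

lemma set_foldr_prepend: "set (foldr prepend u v) \<subseteq> set u \<union> set v"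
  by (induction u) (use set_prepend in fastforce)+

lemma foldr_prepend_prepend:
  assumes "reduced v"
  shows "foldr prepend (prepend l u) v = prepend l (foldr prepend u v)"
  using assms by (cases u) (auto simp: prepend_cancel' reduced_foldr_prepend)

lemma foldr_prepend_assoc:
  assumes "reduced w"
  shows "foldr prepend (foldr prepend u v) w = foldr prepend u (foldr prepend v w)"
  by (induction u) (simp_all add: foldr_prepend_prepend assms)

lemma foldr_prepend_inv: "foldr prepend (rev (map letter_inv w)) w = []"
  by (induction w) auto

lemma reduced_rev_inv: "reduced w \<Longrightarrow> reduced (rev (map letter_inv w))"
  unfolding reduced_def successively_rev successively_map
  by (erule successively_mono) (auto simp: letter_inv_eq_iff)

lemma group_free_group: "group (free_group X)"
proof (rule groupI)
  fix u v assume "u \<in> carrier (free_group X)" "v \<in> carrier (free_group X)"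
  then show "u \<otimes>\<^bsub>free_group X\<^esub> v \<in> carrier (free_group X)"
    using set_foldr_prepend[of u v] by (auto simp: free_group_def reduced_foldr_prepend)
next
  fix w assume w: "w \<in> carrier (free_group X)"
  then have "rev (map letter_inv w) \<in> carrier (free_group X)"
    by (auto simp: free_group_def reduced_rev_inv letter_inv_def)
  moreover have "rev (map letter_inv w) \<otimes>\<^bsub>free_group X\<^esub> w = \<one>\<^bsub>free_group X\<^esub>"
    by (simp add: free_group_def foldr_prepend_inv)
  ultimately show "\<exists>v\<in>carrier (free_group X). v \<otimes>\<^bsub>free_group X\<^esub> w = \<one>\<^bsub>free_group X\<^esub>"
    by blast
qed (auto simp: free_group_def foldr_prepend_assoc reduced_def)

text \<open>
  There is no loss of generality in taking the abstract generating set in the element type of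
  the group: a basis of \<open>F\<close> is a subset of the carrier.
\<close>

definition is_free_group :: "('a, 'm) monoid_scheme \<Rightarrow> bool" where
  "is_free_group F \<longleftrightarrow> (\<exists>X :: 'a set. F \<cong> free_group X)"


section \<open>Normal closures and one-relator groups\<close>

definition normal_closure :: "('a, 'm) monoid_scheme \<Rightarrow> 'a set \<Rightarrow> 'a set" where
  "normal_closure G S = \<Inter>{H. H \<lhd> G \<and> S \<subseteq> H}"

text \<open>
  \<open>G\<close> has a presentation with one relator \<open>w\<close>. The generating set \<open>X\<close> may be infinite. The
  type argument names the type the generators are taken from, since HOL cannot quantify
  existentially over types.
\<close>

definition one_relator_group :: "'x itself \<Rightarrow> ('g, 'm) monoid_scheme \<Rightarrow> bool" where
  "one_relator_group TYPE('x) G \<longleftrightarrow>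
     (\<exists>X :: 'x set. \<exists>w \<in> carrier (free_group X).
        G \<cong> free_group X Mod normal_closure (free_group X) {w})"


section \<open>Right orderable groups\<close>

definition right_orderable :: "('g, 'm) monoid_scheme \<Rightarrow> bool" where
  "right_orderable G \<longleftrightarrow>
     (\<exists>r. linear_order_on (carrier G) r \<and>
        (\<forall>a\<in>carrier G. \<forall>b\<in>carrier G. \<forall>g\<in>carrier G.
           (a, b) \<in> r - Id \<longrightarrow> (a \<otimes>\<^bsub>G\<^esub> g, b \<otimes>\<^bsub>G\<^esub> g) \<in> r - Id))"


section \<open>Integral group rings and relation modules\<close>

text \<open>
  Elements of \<open>\<int>G\<close> are the finitely supported functions from the carrier of \<open>G\<close> to the
  integers, extended by \<open>0\<close> outside the carrier, with convolution as multiplication.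
\<close>

definition group_ring :: "('g, 'm) monoid_scheme \<Rightarrow> ('g \<Rightarrow> int) ring" where
  "group_ring G =
     \<lparr>carrier = {a. finite {g. a g \<noteq> 0} \<and> {g. a g \<noteq> 0} \<subseteq> carrier G},
      mult = (\<lambda>a b g. if g \<in> carrier G
                       then \<Sum>h | h \<in> carrier G \<and> a h \<noteq> 0. a h * b (inv\<^bsub>G\<^esub> h \<otimes>\<^bsub>G\<^esub> g)
                       else 0),
      one = (\<lambda>g. if g = \<one>\<^bsub>G\<^esub> then 1 else 0),
      zero = (\<lambda>g. 0),
      add = (\<lambda>a b g. a g + b g)\<rparr>"

definition abelianized_subgroup ::
    "('a, 'm) monoid_scheme \<Rightarrow> 'a set \<Rightarrow> 'a set monoid" where
  "abelianized_subgroup F N = F\<lparr>carrier := N\<rparr> Mod derived F N"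

text \<open>
  For \<open>g = N #> f\<close> and \<open>c = [N,N] #> n\<close> the set below is the coset of \<open>f n f\<inverse>\<close>
  (lemma \<open>conj_action_coset\<close>).
\<close>

definition conj_action ::
    "('a, 'm) monoid_scheme \<Rightarrow> 'a set \<Rightarrow> 'a set \<Rightarrow> 'a set" where
  "conj_action F g c = {f \<otimes>\<^bsub>F\<^esub> n \<otimes>\<^bsub>F\<^esub> inv\<^bsub>F\<^esub> f | f n. f \<in> g \<and> n \<in> c}"

lemma conj_action_coset:
  assumes "N \<lhd> F" and f: "f \<in> carrier F" and n: "n \<in> N"
  shows "conj_action F (N #>\<^bsub>F\<^esub> f) (derived F N #>\<^bsub>F\<^esub> n) =
         derived F N #>\<^bsub>F\<^esub> (f \<otimes>\<^bsub>F\<^esub> n \<otimes>\<^bsub>F\<^esub> inv\<^bsub>F\<^esub> f)"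
proof -
  interpret N: normal N F by fact
  interpret D: normal "derived F N" F
    using N.derived_is_normal[OF assms(1)] .
  note [simp] = N.m_assoc N.inv_mult_group N.inv_solve_left'
  have nF: "n \<in> carrier F" using n by simp
  have comm: "m \<otimes>\<^bsub>F\<^esub> k \<otimes>\<^bsub>F\<^esub> inv\<^bsub>F\<^esub> m \<otimes>\<^bsub>F\<^esub> inv\<^bsub>F\<^esub> k \<in> derived F N" if "m \<in> N" "k \<in> N" for m k
    unfolding derived_def by (rule generate.incl) (use that in blast)
  show ?thesis
  proof (intro equalityI subsetI)
    fix x assume "x \<in> conj_action F (N #>\<^bsub>F\<^esub> f) (derived F N #>\<^bsub>F\<^esub> n)"
    then obtain m d where m: "m \<in> N" and d: "d \<in> derived F N"
      and x: "x = (m \<otimes>\<^bsub>F\<^esub> f) \<otimes>\<^bsub>F\<^esub> (d \<otimes>\<^bsub>F\<^esub> n) \<otimes>\<^bsub>F\<^esub> inv\<^bsub>F\<^esub> (m \<otimes>\<^bsub>F\<^esub> f)"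
      by (auto simp: conj_action_def r_coset_def)
    define k where "k = f \<otimes>\<^bsub>F\<^esub> n \<otimes>\<^bsub>F\<^esub> inv\<^bsub>F\<^esub> f"
    have k: "k \<in> N" unfolding k_def using N.inv_op_closed2 f n by blast
    define e where "e = (m \<otimes>\<^bsub>F\<^esub> f) \<otimes>\<^bsub>F\<^esub> d \<otimes>\<^bsub>F\<^esub> inv\<^bsub>F\<^esub> (m \<otimes>\<^bsub>F\<^esub> f)"
    have mF: "m \<in> carrier F" and kF: "k \<in> carrier F" and dF: "d \<in> carrier F"
      using m k d by auto
    have e: "e \<in> derived F N" unfolding e_def using D.inv_op_closed2 d f mF by blast
    have l: "inv\<^bsub>F\<^esub> y \<otimes>\<^bsub>F\<^esub> (y \<otimes>\<^bsub>F\<^esub> z) = z" "y \<otimes>\<^bsub>F\<^esub> (inv\<^bsub>F\<^esub> y \<otimes>\<^bsub>F\<^esub> z) = z"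
      if "y \<in> carrier F" "z \<in> carrier F" for y z
      using that by (simp_all flip: N.m_assoc)
    have "x = e \<otimes>\<^bsub>F\<^esub> (m \<otimes>\<^bsub>F\<^esub> k \<otimes>\<^bsub>F\<^esub> inv\<^bsub>F\<^esub> m \<otimes>\<^bsub>F\<^esub> inv\<^bsub>F\<^esub> k) \<otimes>\<^bsub>F\<^esub> k"
      unfolding x e_def k_def using f nF mF dF by (simp add: l)
    moreover have "e \<otimes>\<^bsub>F\<^esub> (m \<otimes>\<^bsub>F\<^esub> k \<otimes>\<^bsub>F\<^esub> inv\<^bsub>F\<^esub> m \<otimes>\<^bsub>F\<^esub> inv\<^bsub>F\<^esub> k) \<in> derived F N"
      using D.m_closed e comm[OF m k] by blast
    ultimately show "x \<in> derived F N #>\<^bsub>F\<^esub> (f \<otimes>\<^bsub>F\<^esub> n \<otimes>\<^bsub>F\<^esub> inv\<^bsub>F\<^esub> f)"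
      unfolding k_def r_coset_def by blast
  next
    fix x assume "x \<in> derived F N #>\<^bsub>F\<^esub> (f \<otimes>\<^bsub>F\<^esub> n \<otimes>\<^bsub>F\<^esub> inv\<^bsub>F\<^esub> f)"
    then obtain d where d: "d \<in> derived F N" and x: "x = d \<otimes>\<^bsub>F\<^esub> (f \<otimes>\<^bsub>F\<^esub> n \<otimes>\<^bsub>F\<^esub> inv\<^bsub>F\<^esub> f)"
      by (auto simp: r_coset_def)
    have dF: "d \<in> carrier F" using d by auto
    define e where "e = inv\<^bsub>F\<^esub> f \<otimes>\<^bsub>F\<^esub> d \<otimes>\<^bsub>F\<^esub> f"
    have e: "e \<in> derived F N" unfolding e_def using D.inv_op_closed1 d f by blast
    have l: "inv\<^bsub>F\<^esub> y \<otimes>\<^bsub>F\<^esub> (y \<otimes>\<^bsub>F\<^esub> z) = z" "y \<otimes>\<^bsub>F\<^esub> (inv\<^bsub>F\<^esub> y \<otimes>\<^bsub>F\<^esub> z) = z"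
      if "y \<in> carrier F" "z \<in> carrier F" for y z
      using that by (simp_all flip: N.m_assoc)
    have "x = f \<otimes>\<^bsub>F\<^esub> (e \<otimes>\<^bsub>F\<^esub> n) \<otimes>\<^bsub>F\<^esub> inv\<^bsub>F\<^esub> f"
      unfolding x e_def using f nF dF by (simp add: l)
    moreover have "f \<in> N #>\<^bsub>F\<^esub> f" using N.rcos_self f N.subgroup_axioms by blast
    moreover have "e \<otimes>\<^bsub>F\<^esub> n \<in> derived F N #>\<^bsub>F\<^esub> n" using e by (auto simp: r_coset_def)
    ultimately show "x \<in> conj_action F (N #>\<^bsub>F\<^esub> f) (derived F N #>\<^bsub>F\<^esub> n)"
      unfolding conj_action_def by blast
  qed
qed

text \<open>
  \<open>N/[N,N]\<close> as a left module over \<open>group_ring (F Mod N)\<close>, written additively: \<open>add\<close> is the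
  product of cosets and \<open>a = \<Sum>\<^sub>g a\<^sub>g g\<close> acts by \<open>a m = \<Sum>\<^sub>g a\<^sub>g (g m)\<close>. Records of type
  \<open>module\<close> extend \<open>ring\<close>; as for every module that is not an algebra, the ring
  multiplication \<open>mult\<close> and its unit \<open>one\<close> carry no meaning. The locale \<open>module\<close> itself is
  restricted to commutative scalars and hence not applicable.
\<close>

definition relation_module ::
    "('a, 'm) monoid_scheme \<Rightarrow> 'a set \<Rightarrow> ('a set \<Rightarrow> int, 'a set) module" where
  "relation_module F N =
     \<lparr>carrier = carrier (abelianized_subgroup F N),
      mult = undefined,
      one = undefined,
      zero = \<one>\<^bsub>abelianized_subgroup F N\<^esub>,
      add = mult (abelianized_subgroup F N),
      smult = (\<lambda>a m. finprod (abelianized_subgroup F N)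
                 (\<lambda>g. conj_action F g m [^]\<^bsub>abelianized_subgroup F N\<^esub> a g)
                 {g \<in> carrier (F Mod N). a g \<noteq> 0})\<rparr>"

lemma comm_group_abelianized_subgroup:
  assumes "N \<lhd> F"
  shows "comm_group (abelianized_subgroup F N)"
proof -
  interpret N: normal N F by fact
  show ?thesis
    unfolding abelianized_subgroup_def
    by (rule N.derived_quot_of_subgroup_is_comm_group[OF N.subgroup_axioms])
qed

lemma carrier_abelianized_subgroup:
  "carrier (abelianized_subgroup F N) = {derived F N #>\<^bsub>F\<^esub> n | n. n \<in> N}"
  by (auto simp: abelianized_subgroup_def FactGroup_def RCOSETS_def r_coset_def)

lemma conj_action_closed:
  assumes "N \<lhd> F" "g \<in> carrier (F Mod N)" "c \<in> carrier (abelianized_subgroup F N)"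
  shows "conj_action F g c \<in> carrier (abelianized_subgroup F N)"
proof -
  interpret N: normal N F by fact
  obtain f where f: "f \<in> carrier F" "g = N #>\<^bsub>F\<^esub> f"
    using assms(2) by (auto simp: FactGroup_def RCOSETS_def)
  obtain n where n: "n \<in> N" "c = derived F N #>\<^bsub>F\<^esub> n"
    using assms(3) by (auto simp: carrier_abelianized_subgroup)
  have "f \<otimes>\<^bsub>F\<^esub> n \<otimes>\<^bsub>F\<^esub> inv\<^bsub>F\<^esub> f \<in> N" using N.inv_op_closed2 f n by blast
  then show ?thesis
    using conj_action_coset[OF assms(1) f(1) n(1)] f n
    by (auto simp: carrier_abelianized_subgroup)
qed

lemma submodule_carrier_relation_module:
  assumes "N \<lhd> F"
  shows "submodule (carrier (relation_module F N)) (group_ring (F Mod N)) (relation_module F N)"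
proof -
  interpret Q: comm_group "abelianized_subgroup F N"
    by (rule comm_group_abelianized_subgroup[OF assms])
  have m_inv: "inv\<^bsub>add_monoid (relation_module F N)\<^esub> x = inv\<^bsub>abelianized_subgroup F N\<^esub> x" for x
    by (simp add: relation_module_def m_inv_def)
  have "subgroup (carrier (relation_module F N)) (add_monoid (relation_module F N))"
  proof
    fix x assume "x \<in> carrier (relation_module F N)"
    then show "inv\<^bsub>add_monoid (relation_module F N)\<^esub> x \<in> carrier (relation_module F N)"
      unfolding m_inv by (simp add: relation_module_def)
  qed (simp_all add: relation_module_def)
  moreover have "a \<odot>\<^bsub>relation_module F N\<^esub> x \<in> carrier (relation_module F N)"
    if "x \<in> carrier (relation_module F N)" for a x
    using that unfolding relation_module_def
    by (auto intro!: Q.finprod_closed Q.int_pow_closed conj_action_closed[OF assms])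
  ultimately show ?thesis
    unfolding submodule_def submodule_axioms_def by simp
qed

definition submodule_generated ::
    "('r, 'k) ring_scheme \<Rightarrow> ('r, 'b, 'l) module_scheme \<Rightarrow> 'b set \<Rightarrow> 'b set" where
  "submodule_generated R M S = \<Inter>{H. submodule H R M \<and> S \<subseteq> H}"

end

theory Submission
  imports Defs
begin

text \<open>
  Identify \<open>N\<close> with the fundamental group of the Cayley graph of \<open>G = F/N\<close>, and \<open>N/[N,N]\<close> with its
  first homology. The right order shows that the cycle \<open>r\<close> is simple: among the translates \<open>g r\<close> in
  a combination, the one with extremal \<open>g\<inverse>\<close> exposes an extremal edge of \<open>r\<close>, so every cycle within
  the support of \<open>r\<close> is a multiple of \<open>r\<close>. Let \<open>w\<close> be this simple closed path.

  That the translates of \<open>w\<close> kill the fundamental group, and not only the homology, is proved by a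
  geometric form of the Magnus hierarchy, by induction on the number of pairs of vertices of \<open>w\<close> in
  the same orbit. If \<open>w\<close> has distinct vertices modulo the group, the claim is easy. Otherwise some
  integral height function is invariant up to constants and not constant on the orbits of vertices
  of \<open>w\<close>. The slabs that have the height of \<open>w\<close> are acted on by the kernel of the height, and satisfy
  the hypotheses again by unique products, so the induction applies to them. Overlapping slabs are
  glued by a Mayer--Vietoris argument.
\<close>

section \<open>Paths and cochains in Cayley graphs\<close>

text \<open>Write M for the normal closure of \<open>w\<close> and \<open>lam\<close> for the label
  of words in F/M. Then N lies in M exactly if closed paths have label 0, and \<open>flat\<close>
  states this for a subgraph, so 2-complexes and their fundamental groups never appear. The obstacle
  is that the module hypothesis controls closed paths only up to commutators. Two facts bridge this
  gap. If the vertices of \<open>w\<close> are inequivalent, every translate of \<open>w\<close>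
  owns an edge, which can be traded for the rest of that translate. And gluing two flat subgraphs
  costs only a homological condition: a zigzag can be shortened when it returns to a component of
  the intersection, and cochains detect such a return. The number of equivalent pairs of vertices
  drops because the kernel of the height separates two vertices that were equivalent before. The
  right order itself is used only to make \<open>r\<close> simple; the induction carries unique
  products instead, which restrict to subgroups and exclude torsion.\<close>

definition lval :: "('x \<Rightarrow> 'g::group_add) \<Rightarrow> 'x \<times> bool \<Rightarrow> 'g" where
  "lval f l = (if snd l then f (fst l) else - f (fst l))"

text \<open>The class \<open>group_add\<close> is a possibly non-commutative group in additive
  notation. One evaluation serves twice: for \<open>\<eta>\<close> it gives the displacement of a
  path, for \<open>lam\<close> its label in a quotient of \<open>F\<close>.\<close>

definition wval :: "('x \<Rightarrow> 'g::group_add) \<Rightarrow> ('x \<times> bool) list \<Rightarrow> 'g" where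
  "wval f w = sum_list (map (lval f) w)"

definition winv :: "('x \<times> bool) list \<Rightarrow> ('x \<times> bool) list" where
  "winv w = rev (map letter_inv w)"

definition lsgn :: "'x \<times> bool \<Rightarrow> int" where
  "lsgn l = (if snd l then 1 else -1)"

definition shift :: "'g::group_add \<Rightarrow> 'g \<times> 'x \<Rightarrow> 'g \<times> 'x" where
  "shift h e = (h + fst e, snd e)"

lemma wval_Nil [simp]: "wval f [] = 0"
  and wval_Cons [simp]: "wval f (l # w) = lval f l + wval f w"
  and wval_append [simp]: "wval f (u @ v) = wval f u + wval f v"
  by (simp_all add: wval_def)

lemma lval_inv [simp]: "lval f (letter_inv l) = - lval f l"
  by (simp add: lval_def letter_inv_def)

lemma winv_Nil [simp]: "winv [] = []"
  and winv_Cons [simp]: "winv (l # w) = winv w @ [letter_inv l]"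
  by (simp_all add: winv_def)

lemma wval_winv [simp]: "wval f (winv w) = - wval f w"
  by (induction w) (simp_all add: minus_add)

lemma lsgn_inv [simp]: "lsgn (letter_inv l) = - lsgn l"
  by (simp add: lsgn_def letter_inv_def)

lemma abs_lsgn [simp]: "\<bar>lsgn l\<bar> = 1" and lsgn_neq_0 [simp]: "lsgn l \<noteq> 0"
  by (simp_all add: lsgn_def)

lemma shift_simps [simp]:
  "fst (shift h e) = h + fst e" "snd (shift h e) = snd e"
  "shift 0 e = e" "shift h (shift k e) = shift (h + k) e"
  by (simp_all add: shift_def add.assoc)

lemma shift_eq_iff: "shift h e = e' \<longleftrightarrow> e = shift (- h) e'"
  by (metis add.left_inverse add.right_inverse shift_simps(3,4))

lemma shift_inj [simp]: "shift h e = shift h e' \<longleftrightarrow> e = e'"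
  by (simp add: shift_eq_iff)

lemma shift_left_inj [simp]: "shift h e = shift k e \<longleftrightarrow> h = k"
  by (simp add: shift_def)

lemma add_add_diff_cancel: "a + (b + c) - c = a + (b :: 'g::group_add)"
  by (simp flip: add.assoc)

lemma add_uminus_add: "a + (- b + c) = a - b + (c :: 'g::group_add)"
  by (simp flip: add.assoc)

lemma take_Suc_sum:
  "i < length w \<Longrightarrow> wval f (take (Suc i) w) = wval f (take i w) + lval f (w ! i)"
  by (simp add: take_Suc_conv_app_nth)

text \<open>The pair \<open>(g, x)\<close> is the edge from \<open>g\<close> to
  \<open>g + \<eta> x\<close>. Generators act on the right, so the left translations
  \<open>shift\<close> are graph automorphisms. The whole type serves as vertex set; the relevant
  part is cut out later by sets of edges.\<close>

locale cayley_graph =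
  fixes \<eta> :: "'x \<Rightarrow> 'g::group_add"
begin

definition tgt :: "'g \<times> 'x \<Rightarrow> 'g" where
  "tgt e = fst e + \<eta> (snd e)"

text \<open>An inverse letter read at \<open>g\<close> traverses backwards an edge that ends at
  \<open>g\<close>, hence the subtraction: a letter and its inverse, read at opposite ends, name the
  same edge (\<open>edge_inv\<close>).\<close>

definition edge :: "'g \<Rightarrow> 'x \<times> bool \<Rightarrow> 'g \<times> 'x" where
  "edge g l = (if snd l then g else g - \<eta> (fst l), fst l)"

text \<open>Integral of the 1-cochain \<open>c\<close> along the path that starts at
  \<open>g\<close> and spells \<open>w\<close>.\<close>

fun wsum :: "('g \<times> 'x \<Rightarrow> int) \<Rightarrow> 'g \<Rightarrow> ('x \<times> bool) list \<Rightarrow> int" where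
  "wsum c g [] = 0"
| "wsum c g (l # w) = lsgn l * c (edge g l) + wsum c (g + lval \<eta> l) w"

fun edges :: "'g \<Rightarrow> ('x \<times> bool) list \<Rightarrow> ('g \<times> 'x) set" where
  "edges g [] = {}"
| "edges g (l # w) = insert (edge g l) (edges (g + lval \<eta> l) w)"

text \<open>The cellular 1-chain of the path: pairing with the indicator cochain of an edge counts
  its traversals with sign.\<close>

definition chain :: "'g \<Rightarrow> ('x \<times> bool) list \<Rightarrow> 'g \<times> 'x \<Rightarrow> int" where
  "chain g w e = wsum (\<lambda>e'. of_bool (e' = e)) g w"

lemma tgt_shift [simp]: "tgt (shift h e) = h + tgt e"
  by (simp add: tgt_def add.assoc)

lemma edge_shift: "edge (h + g) l = shift h (edge g l)"
  by (simp add: edge_def shift_def add_diff_eq)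

lemma edge_inv: "edge (g + lval \<eta> l) (letter_inv l) = edge g l"
  by (auto simp: edge_def lval_def letter_inv_def)

lemma edge_ends:
  "fst (edge g l) = (if snd l then g else g + lval \<eta> l)"
  "tgt (edge g l) = (if snd l then g + lval \<eta> l else g)"
  by (auto simp: edge_def lval_def tgt_def)

lemma snd_edge [simp]: "snd (edge g l) = fst l"
  by (simp add: edge_def)

lemma wsum_append: "wsum c g (u @ v) = wsum c g u + wsum c (g + wval \<eta> u) v"
  by (induction u arbitrary: g) (simp_all add: add.assoc)

lemma edges_append: "edges g (u @ v) = edges g u \<union> edges (g + wval \<eta> u) v"
  by (induction u arbitrary: g) (simp_all add: add.assoc)

lemma wsum_winv: "wsum c (g + wval \<eta> w) (winv w) = - wsum c g w"
proof (induction w arbitrary: g)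
  case (Cons l w)
  have "wsum c (g + wval \<eta> (l # w)) (winv (l # w)) =
    wsum c (g + lval \<eta> l + wval \<eta> w) (winv w) + lsgn (letter_inv l) * c (edge (g + lval \<eta> l) (letter_inv l))"
    by (simp add: wsum_append flip: add.assoc)
  then show ?case by (simp add: Cons.IH edge_inv)
qed simp

lemma edges_winv: "edges (g + wval \<eta> w) (winv w) = edges g w"
proof (induction w arbitrary: g)
  case (Cons l w)
  have "edges (g + wval \<eta> (l # w)) (winv (l # w)) =
    edges (g + lval \<eta> l + wval \<eta> w) (winv w) \<union> {edge (g + lval \<eta> l) (letter_inv l)}"
    by (simp add: edges_append flip: add.assoc)
  then show ?case by (simp add: Cons.IH edge_inv)
qed simp

lemma wsum_shift: "wsum c (h + g) w = wsum (\<lambda>e. c (shift h e)) g w"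
  by (induction w arbitrary: g) (simp_all add: add.assoc edge_shift)

lemma edges_shift: "edges (h + g) w = shift h ` edges g w"
  by (induction w arbitrary: g) (simp_all add: add.assoc edge_shift)

lemma finite_edges [simp]: "finite (edges g w)"
  by (induction w arbitrary: g) auto

lemma wsum_cong: "(\<And>e. e \<in> edges g w \<Longrightarrow> c e = c' e) \<Longrightarrow> wsum c g w = wsum c' g w"
  by (induction w arbitrary: g) auto

lemma wsum_add: "wsum (\<lambda>e. c e + c' e) g w = wsum c g w + wsum c' g w"
  and wsum_uminus: "wsum (\<lambda>e. - c e) g w = - wsum c g w"
  and wsum_mult: "wsum (\<lambda>e. k * c e) g w = k * wsum c g w"
  and wsum_zero: "wsum (\<lambda>e. 0) g w = 0"
  by (induction w arbitrary: g) (simp_all add: algebra_simps)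

lemma wsum_diff: "wsum (\<lambda>e. c e - c' e) g w = wsum c g w - wsum c' g w"
  using wsum_add[of c "\<lambda>e. - c' e"] by (simp add: wsum_uminus)

lemma chain_shift: "chain (h + g) w e = chain g w (shift (- h) e)"
  by (simp add: chain_def wsum_shift shift_eq_iff)

lemma chain_nonzero_edges: "chain g w e \<noteq> 0 \<Longrightarrow> e \<in> edges g w"
  unfolding chain_def using wsum_cong[of g w "\<lambda>e'. of_bool (e' = e)" "\<lambda>e. 0"]
  by (auto simp: wsum_zero)

lemma chain_Nil [simp]: "chain g [] e = 0"
  by (simp add: chain_def)

lemma chain_append: "chain g (u @ v) e = chain g u e + chain (g + wval \<eta> u) v e"
  by (simp add: chain_def wsum_append)

lemma chain_winv: "chain (g + wval \<eta> w) (winv w) e = - chain g w e"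
  by (simp add: chain_def wsum_winv)

lemma finite_chain: "finite {e. chain g w e \<noteq> 0}"
  by (rule finite_subset[OF _ finite_edges[of g w]]) (use chain_nonzero_edges in blast)

text \<open>Cochains see a path only through its chain. The set \<open>B\<close> may exceed the
  support, so that several paths can be compared over one finite set, as in
  \<open>wsum_combination\<close>.\<close>

lemma wsum_eq_sum_chain:
  assumes "finite B" "edges g w \<subseteq> B"
  shows "wsum c g w = (\<Sum>e\<in>B. chain g w e * c e)"
  using assms(2)
proof (induction w arbitrary: g)
  case (Cons l w)
  have "chain g (l # w) e = lsgn l * of_bool (edge g l = e) + chain (g + lval \<eta> l) w e" for e
    by (simp add: chain_def)
  then have "(\<Sum>e\<in>B. chain g (l # w) e * c e) =
    (\<Sum>e\<in>B. lsgn l * (of_bool (edge g l = e) * c e)) + (\<Sum>e\<in>B. chain (g + lval \<eta> l) w e * c e)"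
    by (simp add: algebra_simps sum.distrib)
  also have "(\<Sum>e\<in>B. lsgn l * (of_bool (edge g l = e) * c e)) = lsgn l * c (edge g l)"
  proof -
    have "of_bool (edge g l = e) * c e = (if e = edge g l then c e else 0)" for e
      by auto
    then show ?thesis
      using Cons.prems assms(1) by (simp add: sum.delta flip: sum_distrib_left)
  qed
  finally show ?case using Cons by simp
qed (simp add: chain_def)

text \<open>Telescoping. The relation is asked only on the edges traversed, so the lemma applies to
  a cochain that is a coboundary on a subgraph only, as in \<open>flat_Un\<close>.\<close>

lemma wsum_coboundary:
  assumes "\<And>e. e \<in> edges g w \<Longrightarrow> c e = k (tgt e) - k (fst e)"
  shows "wsum c g w = k (g + wval \<eta> w) - k g"
  using assms
proof (induction w arbitrary: g)
  case (Cons l w)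
  have "lsgn l * c (edge g l) = k (g + lval \<eta> l) - k g"
    using Cons.prems[of "edge g l"] by (auto simp: edge_ends lsgn_def)
  with Cons show ?case by (simp add: add.assoc)
qed simp

lemma edges_start:
  assumes "w \<noteq> []"
  obtains e where "e \<in> edges g w" "g = fst e \<or> g = tgt e"
proof (cases w)
  case (Cons l v)
  then show thesis using that[of "edge g l"] by (auto simp: edge_ends)
qed (use assms in simp)

lemma edges_nth: "edges g w = (\<lambda>i. edge (g + wval \<eta> (take i w)) (w ! i)) ` {..<length w}"
proof (induction w arbitrary: g)
  case (Cons l w)
  show ?case
    by (simp add: Cons.IH lessThan_Suc_eq_insert_0 image_image add.assoc)
qed simp

lemma wsum_nth: "wsum c g w = (\<Sum>i<length w. lsgn (w ! i) * c (edge (g + wval \<eta> (take i w)) (w ! i)))"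
proof (induction w arbitrary: g)
  case (Cons l w)
  show ?case
    by (simp add: Cons.IH sum.lessThan_Suc_shift add.assoc del: sum.lessThan_Suc)
qed simp

definition scycle :: "'g \<Rightarrow> ('x \<times> bool) list \<Rightarrow> bool" where
  "scycle g w \<longleftrightarrow> w \<noteq> [] \<and> wval \<eta> w = 0 \<and>
     (\<forall>i j. i < j \<longrightarrow> j < length w \<longrightarrow> wval \<eta> (take i w) \<noteq> wval \<eta> (take j w)) \<and>
     (\<forall>l. w \<noteq> [l, letter_inv l])"

text \<open>A shortest closed path on which \<open>lam\<close> does not vanish has no repeated vertices.\<close>

lemma obtain_scycle:
  fixes lam :: "'x \<Rightarrow> 'b::group_add"
  assumes "wval \<eta> w = 0" "edges g w \<subseteq> E" "wval lam w \<noteq> 0"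
  obtains g' w' where "scycle g' w'" "edges g' w' \<subseteq> E" "wval lam w' \<noteq> 0"
proof -
  define P where "P n \<longleftrightarrow> (\<exists>g w. length w = n \<and> wval \<eta> w = 0 \<and> edges g w \<subseteq> E \<and> wval lam w \<noteq> 0)" for n
  define n where "n = (LEAST n. P n)"
  have "P (length w)" using assms P_def by blast
  then have "P n" unfolding n_def by (rule LeastI)
  then obtain g' v where v: "length v = n" "wval \<eta> v = 0" "edges g' v \<subseteq> E" "wval lam v \<noteq> 0"
    unfolding P_def by blast
  have least: "wval lam u = 0" if "length u < n" "wval \<eta> u = 0" "edges k u \<subseteq> E" for k u
    using not_less_Least[of "length u" P, folded n_def] that P_def by blast
  have "wval \<eta> (take i v) \<noteq> wval \<eta> (take j v)" if ij: "i < j" "j < length v" for i j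
  proof
    assume eq: "wval \<eta> (take i v) = wval \<eta> (take j v)"
    define a b c where "a = take i v" and "b = drop i (take j v)" and "c = drop j v"
    have ab: "take j v = a @ b"
      unfolding a_def b_def using ij by (metis append_take_drop_id less_imp_le_nat min.absorb1 take_take)
    have abc: "v = a @ b @ c"
      unfolding c_def append_assoc[symmetric] ab[symmetric] by simp
    have len: "length b < n" "length (a @ c) < n"
      using v(1) ij unfolding a_def b_def c_def by auto
    have b0: "wval \<eta> b = 0" using eq ab a_def by (metis add.right_neutral add_left_cancel wval_append)
    have "wval lam b = 0"
      using least[OF len(1) b0, of "g' + wval \<eta> a"] v(3) unfolding abc by (simp add: edges_append)
    moreover have "wval lam (a @ c) = 0"
      using least[OF len(2), of g'] v(2,3) b0 unfolding abc by (simp add: edges_append)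
    ultimately show False using v(4) unfolding abc by simp
  qed
  moreover have "v \<noteq> [l, letter_inv l]" for l
    using v(4) by auto
  ultimately have "scycle g' v" using v unfolding scycle_def by auto
  with v that show thesis by blast
qed

text \<open>Positions are read modulo the length, so that an arc may pass the base point and even
  wind around several times; such arcs occur in \<open>exists_invariant_cochain\<close>.\<close>

definition vtx :: "'g \<Rightarrow> ('x \<times> bool) list \<Rightarrow> nat \<Rightarrow> 'g" where
  "vtx g w k = g + wval \<eta> (take (k mod length w) w)"

definition ltr :: "('x \<times> bool) list \<Rightarrow> nat \<Rightarrow> 'x \<times> bool" where
  "ltr w k = w ! (k mod length w)"

definition cedge :: "'g \<Rightarrow> ('x \<times> bool) list \<Rightarrow> nat \<Rightarrow> 'g \<times> 'x" where
  "cedge g w k = edge (vtx g w k) (ltr w k)"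

lemma vtx_Suc:
  assumes "w \<noteq> []" "wval \<eta> w = 0"
  shows "vtx g w (Suc k) = vtx g w k + lval \<eta> (ltr w k)"
proof -
  have *: "k mod length w < length w" using assms by simp
  show ?thesis
  proof (cases "Suc (k mod length w) = length w")
    case True
    then have "wval \<eta> (take (k mod length w) w) + lval \<eta> (w ! (k mod length w)) = 0"
      using take_Suc_sum[OF *, of \<eta>] assms by simp
    then show ?thesis using True by (simp add: vtx_def ltr_def mod_Suc add.assoc)
  next
    case False
    then show ?thesis using take_Suc_sum[OF *, of \<eta>] by (simp add: vtx_def ltr_def mod_Suc add.assoc)
  qed
qed

lemma vtx_mod [simp]: "vtx g w (k mod length w) = vtx g w k"
  and ltr_mod [simp]: "ltr w (k mod length w) = ltr w k"
  and cedge_mod [simp]: "cedge g w (k mod length w) = cedge g w k"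
  by (simp_all add: vtx_def ltr_def cedge_def)

lemma vtx_shift: "vtx (h + g) w k = h + vtx g w k"
  by (simp add: vtx_def add.assoc)

lemma edges_cedge: "edges g w = cedge g w ` {..<length w}"
  unfolding edges_nth by (rule image_cong) (simp_all add: cedge_def vtx_def ltr_def)

lemma cedge_mem: "w \<noteq> [] \<Longrightarrow> cedge g w k \<in> edges g w"
  unfolding edges_cedge by (metis cedge_mod imageI lessThan_iff length_greater_0_conv mod_less_divisor)

lemma wsum_cedge: "wsum c g w = (\<Sum>i<length w. lsgn (ltr w i) * c (cedge g w i))"
  unfolding wsum_nth by (rule sum.cong) (simp_all add: cedge_def vtx_def ltr_def)

lemma scycle_vtx:
  assumes "scycle g w" "i < length w" "j < length w" "vtx g w i = vtx g w j"
  shows "i = j"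
  using assms unfolding scycle_def vtx_def
  by (metis add_left_cancel mod_less nat_neq_iff)

lemma cedge_ends:
  assumes "w \<noteq> []" "wval \<eta> w = 0"
  shows "fst (cedge g w k) = (if snd (ltr w k) then vtx g w k else vtx g w (Suc k))"
    and "tgt (cedge g w k) = (if snd (ltr w k) then vtx g w (Suc k) else vtx g w k)"
  using assms by (simp_all add: cedge_def edge_ends vtx_Suc)

text \<open>Two traversals in the same direction start at the same vertex. In opposite directions
  each position follows the other cyclically, so the length is two and the path is a backtrack,
  which \<open>scycle\<close> rules out.\<close>

lemma scycle_cedge:
  assumes s: "scycle g w" and i: "i < length w" and j: "j < length w" and eq: "cedge g w i = cedge g w j"
  shows "i = j"
proof -
  have w: "w \<noteq> []" "wval \<eta> w = 0" using s unfolding scycle_def by auto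
  have *: False if ij: "i < j" "j < length w" and eq: "cedge g w i = cedge g w j" for i j
  proof (cases "snd (ltr w i) = snd (ltr w j)")
    case True
    then have "ltr w i = ltr w j"
      using arg_cong[OF eq, of snd] by (simp add: cedge_def prod_eq_iff)
    then have "vtx g w i = vtx g w j"
      using arg_cong[OF eq, of fst] arg_cong[OF eq, of tgt] by (auto simp: cedge_ends[OF w] split: if_splits)
    then show False using scycle_vtx[OF s, of i j] ij by auto
  next
    case False
    have e: "vtx g w i = vtx g w (Suc j)" "vtx g w (Suc i) = vtx g w j"
      using False arg_cong[OF eq, of fst] arg_cong[OF eq, of tgt]
      by (auto simp: cedge_ends[OF w] split: if_splits)
    have 1: "Suc i = j" using scycle_vtx[OF s, of "Suc i" j] e ij by auto
    have "Suc j mod length w = i"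
      using scycle_vtx[OF s, of "Suc j mod length w" i] e ij w by auto
    then have 2: "i = 0" "length w = 2" using 1 ij by (auto simp: mod_Suc split: if_splits)
    have "fst (ltr w i) = fst (ltr w j)" using arg_cong[OF eq, of snd] by (simp add: cedge_def)
    then have "ltr w j = letter_inv (ltr w i)"
      using False by (auto simp: letter_inv_def prod_eq_iff)
    moreover have "w = [ltr w 0, ltr w 1]" using 2 by (auto simp: ltr_def length_Suc_conv numeral_2_eq_2)
    ultimately show False using s 1 2 unfolding scycle_def by (metis One_nat_def)
  qed
  from *[of i j] *[of j i] i j eq show ?thesis by (metis nat_neq_iff)
qed

lemma chain_scycle:
  assumes s: "scycle g w" and i: "i < length w"
  shows "chain g w (cedge g w i) = lsgn (ltr w i)"
proof -
  have "chain g w (cedge g w i) = (\<Sum>j<length w. if j = i then lsgn (ltr w i) else 0)"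
    unfolding chain_def wsum_cedge by (rule sum.cong) (use scycle_cedge[OF s _ i] in auto)
  then show ?thesis using i by simp
qed

lemma chain_scycle_nonzero_iff:
  assumes "scycle g w"
  shows "chain g w e \<noteq> 0 \<longleftrightarrow> e \<in> edges g w"
  using chain_nonzero_edges[of g w e] chain_scycle[OF assms]
  by (auto simp: edges_cedge)

lemma chain_scycle_abs:
  assumes "scycle g w" "e \<in> edges g w"
  shows "\<bar>chain g w e\<bar> = 1"
  using assms chain_scycle[OF assms(1)] by (auto simp: edges_cedge)

lemma scycle_shift: "scycle (h + g) w = scycle g w"
  by (simp add: scycle_def)

end

section \<open>Unique products and invariant cochains\<close>

definition add_subgroup :: "'g::group_add set \<Rightarrow> bool" where
  "add_subgroup H \<longleftrightarrow> 0 \<in> H \<and> (\<forall>x\<in>H. \<forall>y\<in>H. x + y \<in> H) \<and> (\<forall>x\<in>H. - x \<in> H)"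

text \<open>Concluding \<open>s' = s\<close> is enough, as \<open>t' = t\<close> follows by
  cancellation. The predicate is relative to a subset because the induction descends to subgroups,
  to which it restricts (\<open>unique_products_mono\<close>).\<close>

definition unique_products :: "'g::group_add set \<Rightarrow> bool" where
  "unique_products H \<longleftrightarrow>
     (\<forall>S T. finite S \<longrightarrow> finite T \<longrightarrow> S \<noteq> {} \<longrightarrow> T \<noteq> {} \<longrightarrow> S \<subseteq> H \<longrightarrow> T \<subseteq> H \<longrightarrow>
       (\<exists>s\<in>S. \<exists>t\<in>T. \<forall>s'\<in>S. \<forall>t'\<in>T. s' + t' = s + t \<longrightarrow> s' = s))"

lemma add_subgroupD:
  assumes "add_subgroup H"
  shows "0 \<in> H" "x \<in> H \<Longrightarrow> y \<in> H \<Longrightarrow> x + y \<in> H" "x \<in> H \<Longrightarrow> - x \<in> H"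
    "x \<in> H \<Longrightarrow> y \<in> H \<Longrightarrow> x - y \<in> H"
proof -
  show m: "x + y \<in> H" if "x \<in> H" "y \<in> H" for x y
    using assms that by (simp add: add_subgroup_def)
  show i: "- x \<in> H" if "x \<in> H" for x
    using assms that by (simp add: add_subgroup_def)
  show "x - y \<in> H" if "x \<in> H" "y \<in> H"
    using m[OF that(1) i[OF that(2)]] by simp
qed (use assms in \<open>simp add: add_subgroup_def\<close>)

lemma unique_products_mono: "unique_products H \<Longrightarrow> K \<subseteq> H \<Longrightarrow> unique_products K"
  unfolding unique_products_def
proof (intro allI impI)
  fix S T
  assume H: "\<forall>S T. finite S \<longrightarrow> finite T \<longrightarrow> S \<noteq> {} \<longrightarrow> T \<noteq> {} \<longrightarrow> S \<subseteq> H \<longrightarrow> T \<subseteq> H \<longrightarrow>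
       (\<exists>s\<in>S. \<exists>t\<in>T. \<forall>s'\<in>S. \<forall>t'\<in>T. s' + t' = s + t \<longrightarrow> s' = s)"
    and "K \<subseteq> H" and ST: "finite S" "finite T" "S \<noteq> {}" "T \<noteq> {}" "S \<subseteq> K" "T \<subseteq> K"
  then have "S \<subseteq> H" "T \<subseteq> H" by auto
  with H ST show "\<exists>s\<in>S. \<exists>t\<in>T. \<forall>s'\<in>S. \<forall>t'\<in>T. s' + t' = s + t \<longrightarrow> s' = s" by simp
qed

text \<open>Torsion-freeness in geometric form. A uniquely represented sum \<open>s + t\<close>,
  with \<open>s\<close> from the negatives of \<open>T\<close> and \<open>t\<close> from
  \<open>T\<close>, is also \<open>(s + g) + (- g + t)\<close>, so \<open>s + g = s\<close>.\<close>

lemma unique_products_stabilizer: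
  assumes H: "add_subgroup H" "unique_products H"
    and T: "finite T" "T \<noteq> {}" "T \<subseteq> H" and g: "g \<in> H" "\<And>t. t \<in> T \<Longrightarrow> g + t \<in> T"
  shows "g = 0"
proof -
  have "(\<lambda>t. g + t) ` T = T"
    by (rule card_subset_eq) (use T g in \<open>auto simp: card_image inj_on_def\<close>)
  then have inv: "- g + t \<in> T" if "t \<in> T" for t
    using that by (metis (no_types, lifting) image_iff minus_add_cancel)
  have "uminus ` T \<subseteq> H" using T add_subgroupD(3)[OF H(1)] by auto
  then have "\<exists>s\<in>uminus ` T. \<exists>t\<in>T. \<forall>s'\<in>uminus ` T. \<forall>t'\<in>T. s' + t' = s + t \<longrightarrow> s' = s"
    using H(2)[unfolded unique_products_def, rule_format, of "uminus ` T" T] T by blast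
  then obtain s t where st: "s \<in> uminus ` T" "t \<in> T"
    and uniq: "\<And>s' t'. s' \<in> uminus ` T \<Longrightarrow> t' \<in> T \<Longrightarrow> s' + t' = s + t \<Longrightarrow> s' = s"
    by blast
  have "s + g \<in> uminus ` T"
  proof -
    obtain u where "u \<in> T" "s = - u" using st by auto
    then show ?thesis using inv[of u] by (auto intro!: image_eqI[of _ _ "- g + u"] simp: minus_add)
  qed
  then have "s + g = s" using uniq[of "s + g" "- g + t"] inv[OF st(2)] by (simp add: add.assoc flip: add.assoc[of g])
  then show ?thesis using add_left_cancel[of s g 0] by simp
qed

context cayley_graph
begin

section \<open>Orbits of edges and spans of translates\<close>

definition orbit :: "'g set \<Rightarrow> ('g \<times> 'x) set \<Rightarrow> ('g \<times> 'x) set" where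
  "orbit H R = {shift h e | h e. h \<in> H \<and> e \<in> R}"

lemma orbitI: "h \<in> H \<Longrightarrow> e \<in> R \<Longrightarrow> shift h e \<in> orbit H R"
  unfolding orbit_def by blast

text \<open>For a subgroup \<open>H\<close>, membership in the submodule over its integral group
  ring that \<open>z\<close> generates. The coefficients on \<open>S\<close> are nonzero, so that an
  extremal element of \<open>S\<close> really contributes.\<close>

definition in_span :: "'g set \<Rightarrow> ('g \<times> 'x \<Rightarrow> int) \<Rightarrow> ('g \<times> 'x \<Rightarrow> int) \<Rightarrow> bool" where
  "in_span H z z' \<longleftrightarrow> (\<exists>S a. finite S \<and> S \<subseteq> H \<and> (\<forall>h\<in>S. a h \<noteq> 0) \<and>
     z' = (\<lambda>e. \<Sum>h\<in>S. a h * z (shift (- h) e)))"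

text \<open>Transfers vanishing of a cochain from translates of one path to any path whose chain
  they span. Both the invariant cochain and the gluing hypothesis of \<open>flat_Un\<close> are
  handled this way.\<close>

lemma wsum_combination:
  assumes "finite S" and z: "\<And>e. chain g w e = (\<Sum>h\<in>S. a h * chain d v (shift (- h) e))"
  shows "wsum c g w = (\<Sum>h\<in>S. a h * wsum c (h + d) v)"
proof -
  define B where "B = edges g w \<union> (\<Union>h\<in>S. edges (h + d) v)"
  have B: "finite B" using assms by (simp add: B_def)
  have "wsum c g w = (\<Sum>e\<in>B. \<Sum>h\<in>S. a h * (chain (h + d) v e * c e))"
    by (subst wsum_eq_sum_chain[OF B]) (auto simp: B_def z chain_shift sum_distrib_right mult.assoc)
  also have "\<dots> = (\<Sum>h\<in>S. a h * (\<Sum>e\<in>B. chain (h + d) v e * c e))"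
    by (subst sum.swap) (simp add: sum_distrib_left)
  also have "\<dots> = (\<Sum>h\<in>S. a h * wsum c (h + d) v)"
    by (rule sum.cong[OF refl], subst wsum_eq_sum_chain[OF B]) (auto simp: B_def)
  finally show ?thesis .
qed

lemma vtx_diff_arc:
  assumes "w \<noteq> []" "wval \<eta> w = 0" and "\<And>k. p (vtx d w (Suc k)) = p (vtx d w k) + (f k :: int)"
  shows "p (vtx d w (i + k)) - p (vtx d w i) = (\<Sum>m\<in>{i..<i + k}. f m)"
  by (induction k) (simp_all add: assms)

text \<open>
  If no invariant cochain as below exists, then all closed arcs are proportional in the homology of
  the quotient graph. A shortest closed arc is embedded there, and the path can never leave it, as
  its next embedded closed arc would have different homology. So the path is periodic in the
  quotient, which contradicts torsion-freeness.
\<close>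

lemma exists_invariant_cochain:
  assumes H: "add_subgroup H" "unique_products H" and s: "scycle d w"
    and pq: "p < q" "q < length w" "vtx d w q - vtx d w p \<in> H"
  obtains c i j where "\<And>h e. h \<in> H \<Longrightarrow> c (shift h e) = c e" "wsum c d w = 0"
    "i < j" "vtx d w j - vtx d w i \<in> H"
    "(\<Sum>k\<in>{i..<j}. lsgn (ltr w k) * c (cedge d w k)) \<noteq> 0"
proof (rule ccontr)
  assume neg: "\<not> thesis"
  note goal = that
  note Hs = add_subgroupD[OF H(1)]
  define n where "n = length w"
  define U L D where "U = vtx d w" and "L = ltr w" and "D = cedge d w"
  have w: "w \<noteq> []" "wval \<eta> w = 0" using s by (auto simp: scycle_def)
  have n: "n \<ge> 2" using pq by (simp add: n_def)
  have U_mod: "U (k mod n) = U k" for k by (simp add: U_def n_def)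
  \<comment> \<open>\<open>sim\<close> and \<open>es\<close> are equality of vertices and of edges
    in the quotient graph by \<open>H\<close>; \<open>cnt\<close> and \<open>W\<close> count signed
    traversals over an arc and over the whole of \<open>w\<close>.\<close>
  define sim where "sim i j \<longleftrightarrow> U j - U i \<in> H" for i j
  define es where "es e e' \<longleftrightarrow> (\<exists>h\<in>H. e' = shift h e)" for e e' :: "'g \<times> 'x"
  define cnt where "cnt f i j = (\<Sum>k\<in>{i..<j}. lsgn (L k) * of_bool (es f (D k)))" for f i j
  define W where "W f = wsum (\<lambda>e. of_bool (es f e)) d w" for f
  have sim_sym: "sim j i" if "sim i j" for i j
    using Hs(3)[OF that[unfolded sim_def]] by (simp add: sim_def)
  have sim_trans: "sim i k" if "sim i j" "sim j k" for i j k
    using Hs(2)[OF that(2,1)[unfolded sim_def]] by (simp add: sim_def algebra_simps)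
  have es_inv: "es f (shift h e) \<longleftrightarrow> es f e" if h: "h \<in> H" for f h e
  proof
    assume "es f (shift h e)"
    then obtain k where "k \<in> H" "shift h e = shift k f" unfolding es_def by auto
    then have "e = shift (- h + k) f" by (metis add.left_inverse shift_simps(3,4))
    then show "es f e" unfolding es_def using Hs(2,3) h \<open>k \<in> H\<close> by blast
  next
    assume "es f e"
    then show "es f (shift h e)" unfolding es_def using Hs(2) h by auto
  qed
  have es_refl: "es e e" for e unfolding es_def using Hs(1) by (metis shift_simps(3))
  have es_sym: "es e' e" if "es e e'" for e e'
    using that es_inv es_refl unfolding es_def by metis
  have neg': "(\<Sum>k\<in>{i..<j}. lsgn (L k) * c (D k)) = 0"
    if "\<And>h e. h \<in> H \<Longrightarrow> c (shift h e) = c e" "wsum c d w = 0" "i < j" "sim i j" for c i j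
    using neg goal[of c i j] that unfolding sim_def U_def L_def D_def by blast
  have propn: "cnt f i j * W e = cnt e i j * W f" if "i < j" "sim i j" for e f i j
  proof -
    \<comment> \<open>This combination of two orbit indicators vanishes on \<open>w\<close>, so the
      failure of the lemma makes it vanish on the arc too.\<close>
    define c where "c e' = W e * of_bool (es f e') - W f * of_bool (es e e')" for e'
    have 1: "c (shift h e') = c e'" if "h \<in> H" for h e' by (simp add: c_def es_inv[OF that])
    have 2: "wsum c d w = 0" unfolding c_def wsum_diff wsum_mult W_def by simp
    have "(\<Sum>k\<in>{i..<j}. lsgn (L k) * c (D k)) = W e * cnt f i j - W f * cnt e i j"
      unfolding c_def cnt_def by (simp only: sum_distrib_left flip: sum_subtractf) (intro sum.cong refl, simp add: algebra_simps)
    then show ?thesis using neg'[OF 1 2 that] by (simp add: algebra_simps)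
  qed
  have propn0: "cnt f i j = 0" if "i < j" "sim i j" "W f = 0" for f i j
    using neg'[of "\<lambda>e. of_bool (es f e)"] that es_inv unfolding cnt_def W_def by simp
  have D_ends: "fst (D k) = (if snd (L k) then U k else U (Suc k))"
      "tgt (D k) = (if snd (L k) then U (Suc k) else U k)" for k
    unfolding D_def L_def U_def by (rule cedge_ends[OF w])+
  have snd_D: "snd (D k) = fst (L k)" for k by (simp add: D_def L_def cedge_def)
  have D_neq: "D k \<noteq> D (Suc k)" for k
  proof
    assume "D k = D (Suc k)"
    then have "k mod n = Suc k mod n"
      using scycle_cedge[OF s, of "k mod n" "Suc k mod n"] w by (simp add: D_def n_def)
    then show False using n by (simp add: mod_Suc split: if_splits)
  qed
  have es_same: "L a = L b \<and> sim a b" if e: "es (D a) (D b)" and "snd (L a) = snd (L b)" for a b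
  proof -
    obtain h where h: "h \<in> H" "D b = shift h (D a)" using e unfolding es_def by auto
    have "fst (L a) = fst (L b)" using h snd_D by (metis shift_simps(2))
    moreover have "U b = h + U a"
      using arg_cong[OF h(2), of fst] arg_cong[OF h(2), of tgt] that(2)
      by (auto simp: D_ends split: if_splits)
    ultimately show ?thesis using h(1) that(2) unfolding sim_def by (simp add: prod_eq_iff)
  qed
  have es_opp: "(\<exists>h\<in>H. D b = shift h (D a) \<and> U (Suc b) = h + U a \<and> U b = h + U (Suc a))"
    if e: "es (D a) (D b)" and "snd (L a) \<noteq> snd (L b)" for a b
  proof -
    obtain h where h: "h \<in> H" "D b = shift h (D a)" using e unfolding es_def by auto
    have "U (Suc b) = h + U a \<and> U b = h + U (Suc a)"
      using arg_cong[OF h(2), of fst] arg_cong[OF h(2), of tgt] that(2)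
      by (auto simp: D_ends split: if_splits)
    with h show ?thesis by blast
  qed
  have es_opp_sim: "sim a (Suc b) \<and> sim (Suc a) b" if "es (D a) (D b)" "snd (L a) \<noteq> snd (L b)" for a b
    using es_opp[OF that] unfolding sim_def by auto
  \<comment> \<open>A backtrack in the quotient would give an \<open>h\<close> fixing the vertex
    \<open>U (Suc k)\<close>, so \<open>h = 0\<close> and \<open>w\<close> itself would
    backtrack.\<close>
  have no_backtrack: "\<not> (es (D k) (D (Suc k)) \<and> snd (L k) \<noteq> snd (L (Suc k)))" for k
  proof
    assume *: "es (D k) (D (Suc k)) \<and> snd (L k) \<noteq> snd (L (Suc k))"
    then obtain h where h: "D (Suc k) = shift h (D k)" "U (Suc k) = h + U (Suc k)"
      using es_opp[of k "Suc k"] by blast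
    then have "h = 0" using add_right_cancel[of 0 "U (Suc k)" h] by simp
    then show False using h(1) D_neq[of k] by simp
  qed
  define embedded where "embedded s t \<longleftrightarrow> s < t \<and> sim s t \<and> (\<forall>a b. s \<le> a \<longrightarrow> a < b \<longrightarrow> b < t \<longrightarrow> \<not> sim a b)" for s t
  \<comment> \<open>The same direction would identify two vertices of the embedded arc. Opposite
    directions make \<open>Suc a\<close> and \<open>b\<close> equivalent, hence equal, and the arc
    backtracks.\<close>
  have embedded_inj: "\<not> es (D a) (D b)" if emb: "embedded s t" and ab: "s \<le> a" "a < b" "b < t" for s t a b
  proof
    assume e: "es (D a) (D b)"
    have ns: "\<not> sim a b" using emb ab unfolding embedded_def by blast
    then have opp: "snd (L a) \<noteq> snd (L b)" using es_same[OF e] by blast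
    have sm: "sim a (Suc b)" "sim (Suc a) b" using es_opp_sim[OF e opp] by auto
    have "Suc a = b" using sm(2) emb ab unfolding embedded_def
      by (metis Suc_lessI le_SucI)
    then show False using no_backtrack[of a] e opp by simp
  qed
  have embedded_cnt: "cnt (D k) s t = lsgn (L k)" if emb: "embedded s t" and k: "s \<le> k" "k < t" for s t k
  proof -
    have "of_bool (es (D k) (D m)) = (if m = k then 1 else 0 :: int)" if "m \<in> {s..<t}" for m
      using embedded_inj[OF emb, of k m] embedded_inj[OF emb, of m k] k that
        es_sym[of "D k" "D m"] es_sym[of "D m" "D k"] es_refl[of "D k"]
      by (cases m k rule: linorder_cases) auto
    then have "cnt (D k) s t = (\<Sum>m\<in>{s..<t}. if m = k then lsgn (L k) else 0)"
      unfolding cnt_def by (intro sum.cong) auto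
    then show ?thesis using k by simp
  qed

  define Q where "Q m \<longleftrightarrow> m > 0 \<and> (\<exists>i. sim i (i + m))" for m
  define m where "m = (LEAST m. Q m)"
  have "Q (q - p)" unfolding Q_def using pq unfolding sim_def U_def by (intro conjI exI[of _ p]) auto
  then have Qm: "Q m" and m_le: "m \<le> q - p" unfolding m_def by (rule LeastI, rule Least_le)
  have least: "\<not> sim a b" if "a < b" "b < a + m" for a b
  proof -
    have "\<not> Q (b - a)" using not_less_Least[of "b - a" Q, folded m_def] that by auto
    then have "\<not> sim a (a + (b - a))" using that unfolding Q_def by (metis zero_less_diff)
    then show ?thesis using that by simp
  qed
  have m: "0 < m" "m < n" using Qm m_le pq unfolding Q_def n_def by auto
  have emb: "embedded i (i + m)" if "sim i (i + m)" for i
    unfolding embedded_def using that m least by auto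

  \<comment> \<open>After a shortest closed arc, from \<open>i\<close> to \<open>j\<close>, the path
    must repeat the first letter of that arc. Otherwise its next edge is new, and the next embedded
    closed arc either contains this new edge, or starts after \<open>j\<close> at a vertex that was
    already met, which closes an arc too early.\<close>
  have step: "L (i + m) = L i \<and> snd (L (i + m)) = snd (L i)" if sm: "sim i (i + m)" for i
  proof (rule ccontr)
    assume no: "\<not> ?thesis"
    define j where "j = i + m"
    have ij: "i < j" "sim i j" "embedded i j" using sm m emb by (auto simp: j_def)
    \<comment> \<open>An edge missing from the arc has count 0 there, hence total count 0 by
      proportionality, hence count 0 on every closed arc; but on an embedded arc through it the
      count is 1 or -1.\<close>
    have in_C: "\<exists>b. i \<le> b \<and> b < j \<and> es (D b) (D k)"
      if E: "embedded s t" "s \<le> k" "k < t" for s t k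
    proof (rule ccontr)
      assume nC: "\<not> ?thesis"
      have "\<not> es (D k) (D b)" if "b \<in> {i..<j}" for b
        using nC es_sym that by (metis atLeastLessThan_iff)
      then have "cnt (D k) i j = 0" unfolding cnt_def by simp
      then have "W (D k) = 0"
        using propn[OF ij(1,2), of "D k" "D i"] embedded_cnt[OF ij(3), of i] ij by simp
      then show False using propn0[of s t "D k"] embedded_cnt[OF E] E unfolding embedded_def by auto
    qed
    have D_j: "\<not> es (D b) (D j)" if b: "i \<le> b" "b < j" for b
    proof
      assume e: "es (D b) (D j)"
      show False
      proof (cases "snd (L b) = snd (L j)")
        case True
        then have "L b = L j" "sim b j" using es_same[OF e] by auto
        then have "sim i b" using ij sim_trans sim_sym by blast
        then have "b = i" using ij(3) b unfolding embedded_def by (metis le_neq_implies_less order_refl)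
        then show False using no True \<open>L b = L j\<close> by (simp add: j_def)
      next
        case False
        have "sim (Suc b) j" using es_opp_sim[OF e False] by auto
        then have "sim i (Suc b)" using ij sim_trans sim_sym by blast
        then have "Suc b = j" using ij(3) b unfolding embedded_def
          by (metis Suc_lessI le_imp_less_Suc order_refl)
        then show False using no_backtrack[of b] e False by simp
      qed
    qed
    \<comment> \<open>The start must lie strictly after \<open>i\<close>: an arc from
      \<open>i\<close> past \<open>j\<close> meets the equivalent vertex \<open>j\<close> and is not
      embedded.\<close>
    define P where "P t \<longleftrightarrow> t > j \<and> (\<exists>s. i < s \<and> s < t \<and> sim s t)" for t
    define t where "t = (LEAST t. P t)"
    have "P (j + n)" unfolding P_def
    proof (intro conjI exI[of _ j])
      show "sim j (j + n)" unfolding sim_def using Hs(1) by (metis U_mod diff_self mod_add_self2)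
    qed (use n ij in auto)
    then have "P t" unfolding t_def by (rule LeastI)
    then obtain s where t: "t > j" and s: "i < s" "s < t" "sim s t" unfolding P_def by auto
    have noneq: "\<not> sim a b" if "i < a" "a < b" "b < t" for a b
    proof (cases "b > j")
      case True
      then show ?thesis using not_less_Least[of b P, folded t_def] that unfolding P_def by auto
    next
      case False
      then show ?thesis using least[of a b] that by (auto simp: j_def)
    qed
    have E: "embedded s t" unfolding embedded_def using s noneq by auto
    show False
    proof (cases "s \<le> j")
      case True
      then show False using in_C[OF E, of j] D_j t by auto
    next
      case False
      obtain b where b: "i \<le> b" "b < j" "es (D b) (D s)" using in_C[OF E, of s] s by auto
      have "sim b s \<or> sim (Suc b) s"
        using es_same[OF b(3)] es_opp_sim[OF b(3)] by blast
      then obtain b' where b': "i \<le> b'" "b' \<le> j" "sim b' s"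
        using b by (metis Suc_leI le_SucI less_imp_le_nat)
      show False
      proof (cases "b' = i")
        case True
        then have "sim j s" using ij b' sim_trans sim_sym by blast
        then show False using noneq[of j s] ij s False by auto
      next
        case neq: False
        then show False using noneq[of b' s] b' s False by auto
      qed
    qed
  qed

  obtain i where i: "sim i (i + m)" using Qm unfolding Q_def by auto
  define g where "g = U (i + m) - U i"
  have g: "g \<in> H" using i unfolding sim_def g_def .
  have U_Suc: "U (Suc k) = U k + lval \<eta> (L k)" for k
    unfolding U_def L_def by (rule vtx_Suc[OF w])
  have period: "U (i + k + m) = g + U (i + k)" for k
  proof (induction k)
    case (Suc k)
    have "sim (i + k) (i + k + m)" using Suc g unfolding sim_def by simp
    then have "L (i + k + m) = L (i + k)" using step by blast
    then show ?case using U_Suc[of "i + k + m"] U_Suc[of "i + k"] Suc by (simp add: add.assoc)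
  qed (simp add: g_def)
  \<comment> \<open>The translates of \<open>U i\<close> that lie on \<open>w\<close>. Periodicity
    makes this finite set stable under \<open>g\<close>, so \<open>g = 0\<close>, and
    \<open>w\<close> would close up after \<open>m < n\<close> steps.\<close>
  define T where "T = {h \<in> H. h + U i \<in> U ` {i..<i + n}}"
  have "h \<in> (\<lambda>v. v - U i) ` U ` {i..<i + n}" if "h \<in> T" for h
    using that unfolding T_def by (auto intro!: rev_image_eqI simp: eq_diff_eq)
  then have "T \<subseteq> (\<lambda>v. v - U i) ` U ` {i..<i + n}" by blast
  then have "finite T" by (rule finite_subset) simp
  moreover have "0 \<in> T" using Hs(1) n by (auto simp: T_def)
  moreover have "g + h \<in> T" if h: "h \<in> T" for h
  proof -
    obtain j where "h + U i = U j" "i \<le> j" "j < i + n"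
      using h unfolding T_def by auto
    then obtain k where k: "h + U i = U (i + k)" "k < n"
      by (auto simp: le_iff_add)
    have "g + h + U i = U (i + k + m)" using period k by (simp add: add.assoc)
    also have "\<dots> = U (i + (k + m) mod n)" by (metis U_mod add.assoc mod_add_right_eq)
    finally show ?thesis using that g Hs(2) n unfolding T_def by auto
  qed
  ultimately have "g = 0"
    using unique_products_stabilizer[OF H, of T g] g T_def by blast
  then have "U (i mod n) = U ((i + m) mod n)" by (simp add: g_def U_mod)
  then have "i mod n = (i + m) mod n"
    using scycle_vtx[OF s, of "i mod n" "(i + m) mod n"] w by (simp add: U_def n_def)
  then have "n dvd m" using mod_eq_dvd_iff_nat[of i "i + m" n] by simp
  then show False using m by (auto dest: dvd_imp_le)
qed


section \<open>Vanishing of non-abelian labels on closed paths\<close>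

text \<open>For labels in a commutative group this would be a condition on homology alone. Here
  \<open>lam\<close> takes values in any group, and that is the difficulty in
  \<open>flat_Un\<close>.\<close>

definition flat :: "('g \<times> 'x) set \<Rightarrow> ('x \<Rightarrow> 'b::group_add) \<Rightarrow> bool" where
  "flat E lam \<longleftrightarrow> (\<forall>g w. edges g w \<subseteq> E \<longrightarrow> wval \<eta> w = 0 \<longrightarrow> wval lam w = 0)"

text \<open>Pieces may be empty, so every path in the union splits this way; the number of pairs is
  the induction measure in \<open>flat_Un\<close>.\<close>

fun zigzag :: "('g \<times> 'x) set \<Rightarrow> ('g \<times> 'x) set \<Rightarrow> 'g \<Rightarrow> (('x \<times> bool) list \<times> ('x \<times> bool) list) list \<Rightarrow> bool" where
  "zigzag E1 E2 g [] \<longleftrightarrow> True"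
| "zigzag E1 E2 g ((p, q) # zs) \<longleftrightarrow>
     edges g p \<subseteq> E1 \<and> edges (g + wval \<eta> p) q \<subseteq> E2 \<and> zigzag E1 E2 (g + wval \<eta> p + wval \<eta> q) zs"

abbreviation zword :: "(('x \<times> bool) list \<times> ('x \<times> bool) list) list \<Rightarrow> ('x \<times> bool) list" where
  "zword zs \<equiv> concat (map (\<lambda>(p, q). p @ q) zs)"

lemma zigzag_append:
  "zigzag E1 E2 g (zs @ zs') \<longleftrightarrow> zigzag E1 E2 g zs \<and> zigzag E1 E2 (g + wval \<eta> (zword zs)) zs'"
  by (induction zs arbitrary: g) (auto simp: add.assoc)

lemma zigzag_of_word:
  assumes "edges g w \<subseteq> E1 \<union> E2"
  obtains zs where "zigzag E1 E2 g zs" "zword zs = w"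
  using assms
proof (induction w arbitrary: g thesis)
  case Nil
  show ?case by (rule Nil(1)[of "[]"]) auto
next
  case (Cons l w)
  then obtain zs where zs: "zigzag E1 E2 (g + lval \<eta> l) zs" "zword zs = w" by auto
  show ?case
  proof (cases "edge g l \<in> E1")
    case True
    with zs show ?thesis by (intro Cons.prems(1)[of "([l], []) # zs"]) auto
  next
    case False
    with zs Cons.prems show ?thesis by (intro Cons.prems(1)[of "([], [l]) # zs"]) auto
  qed
qed

lemma zigzag_edges: "zigzag E1 E2 g zs \<Longrightarrow> edges g (zword zs) \<subseteq> E1 \<union> E2"
proof (induction zs arbitrary: g)
  case (Cons z zs)
  then show ?case
    using Cons.IH[of "g + wval \<eta> (fst z) + wval \<eta> (snd z)"]
    by (cases z) (auto simp: edges_append add.assoc)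
qed simp

text \<open>
  Mayer--Vietoris for two subgraphs, with non-abelian coefficients. Testing against the cochain
  that is the coboundary, on \<open>E2\<close> only, of a component \<open>C\<close> of \<open>E1 \<inter> E2\<close> shows that a closed zigzag
  leaves and enters \<open>C\<close> equally often, so it can be cut along a path inside \<open>C\<close>.
\<close>

lemma flat_Un:
  fixes lam :: "'x \<Rightarrow> 'b::group_add"
  assumes f1: "flat E1 lam" and f2: "flat E2 lam"
    and hom: "\<And>c g w. (\<And>g w. edges g w \<subseteq> E1 \<Longrightarrow> wval \<eta> w = 0 \<Longrightarrow> wsum c g w = 0) \<Longrightarrow>
      (\<And>g w. edges g w \<subseteq> E2 \<Longrightarrow> wval \<eta> w = 0 \<Longrightarrow> wsum c g w = 0) \<Longrightarrow>
      edges g w \<subseteq> E1 \<union> E2 \<Longrightarrow> wval \<eta> w = 0 \<Longrightarrow> wsum c g w = 0"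
  shows "flat (E1 \<union> E2) lam"
proof -
  have zz: "wval lam (zword zs) = 0" if "zigzag E1 E2 g zs" "wval \<eta> (zword zs) = 0" for g zs
    using that
  proof (induction "length zs" arbitrary: g zs rule: less_induct)
    case less
    show ?case
    proof (cases zs)
      case (Cons pq rest)
      obtain p q where pq: "pq = (p, q)" by (cases pq)
      have Z: "edges g p \<subseteq> E1" "edges (g + wval \<eta> p) q \<subseteq> E2" "zigzag E1 E2 (g + wval \<eta> p + wval \<eta> q) rest"
        and closed: "wval \<eta> p + wval \<eta> q + wval \<eta> (zword rest) = 0"
        using less.prems by (auto simp: Cons pq add.assoc)
      define b where "b = g + wval \<eta> p"
      \<comment> \<open>The component, in the intersection of the two subgraphs, of the point
        \<open>b\<close> where the first \<open>E1\<close> piece hands over to an \<open>E2\<close>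
        piece.\<close>
      define C where "C = {v. \<exists>y. edges b y \<subseteq> E1 \<inter> E2 \<and> b + wval \<eta> y = v}"
      have C_step: "fst e \<in> C \<longleftrightarrow> tgt e \<in> C" if "e \<in> E1 \<inter> E2" for e
      proof
        assume "fst e \<in> C"
        then obtain y where "edges b y \<subseteq> E1 \<inter> E2" "b + wval \<eta> y = fst e" unfolding C_def by auto
        then show "tgt e \<in> C" unfolding C_def using that
          by (intro CollectI exI[of _ "y @ [(snd e, True)]"])
             (auto simp: edges_append edge_def lval_def tgt_def add.assoc[symmetric])
      next
        assume "tgt e \<in> C"
        then obtain y where "edges b y \<subseteq> E1 \<inter> E2" "b + wval \<eta> y = tgt e" unfolding C_def by auto
        moreover from this have "fst e = b + (wval \<eta> y - \<eta> (snd e))"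
          by (simp add: tgt_def add_diff_eq)
        moreover from this have "edge (b + wval \<eta> y) (snd e, False) = e"
          by (simp add: edge_def prod_eq_iff add_diff_eq)
        ultimately show "fst e \<in> C" unfolding C_def using that
          by (intro CollectI exI[of _ "y @ [(snd e, False)]"])
             (auto simp: edges_append lval_def)
      qed
      define k where "k v = (of_bool (v \<in> C) :: int)" for v
      \<comment> \<open>Extension by 0 off \<open>E2\<close> makes \<open>c\<close> vanish on
        \<open>E1\<close> as well, since no edge of the intersection leaves \<open>C\<close>. So
        \<open>c\<close> is 0 on closed paths of either part, and the homological hypothesis applies
        to the whole zigzag.\<close>
      define c where "c e = (if e \<in> E2 then k (tgt e) - k (fst e) else 0)" for e
      have c1: "wsum c h w = 0" if "edges h w \<subseteq> E1" for h w
      proof -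
        have "wsum c h w = wsum (\<lambda>e. 0) h w"
          by (rule wsum_cong) (use that C_step in \<open>auto simp: c_def k_def\<close>)
        then show ?thesis by (simp add: wsum_zero)
      qed
      have c2: "wsum c h w = k (h + wval \<eta> w) - k h" if "edges h w \<subseteq> E2" for h w
        by (rule wsum_coboundary) (use that in \<open>auto simp: c_def\<close>)
      have sum0: "wsum c g (zword zs) = 0"
        by (rule hom) (use c1 c2 less.prems zigzag_edges in auto)
      have "b \<in> C" unfolding C_def by (auto intro: exI[of _ "[]"])
      \<comment> \<open>An \<open>E2\<close> piece ending outside \<open>C\<close> contributes at
        most 0. The first one starts in \<open>C\<close> and would contribute -1, so the total can
        be 0 only if some switching point lies in \<open>C\<close>.\<close>
      have nonpos: "wsum c h (zword zs') \<le> 0"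
        if "zigzag E1 E2 h zs'" "\<And>zs1 zs2. zs' = zs1 @ zs2 \<Longrightarrow> h + wval \<eta> (zword zs1) \<notin> C" for h zs'
        using that
      proof (induction zs' arbitrary: h)
        case (Cons z zs')
        obtain p' q' where z: "z = (p', q')" by (cases z)
        have out: "h + wval \<eta> p' + wval \<eta> q' + wval \<eta> (zword zs1) \<notin> C" if "zs' = zs1 @ zs2" for zs1 zs2
          using Cons.prems(2)[of "z # zs1" zs2] that by (simp add: z add.assoc)
        have "wsum c (h + wval \<eta> p' + wval \<eta> q') (zword zs') \<le> 0"
          using Cons.prems(1) out by (intro Cons.IH) (auto simp: z)
        then show ?case using Cons.prems(1) out[of "[]" zs']
          by (simp add: z wsum_append c1 c2 k_def add.assoc)
      qed simp
      have "\<exists>zs1 zs2. zs = zs1 @ zs2 \<and> g + wval \<eta> (zword zs1) \<in> C"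
      proof (rule ccontr)
        assume no: "\<not> ?thesis"
        have out: "g + wval \<eta> p + wval \<eta> q + wval \<eta> (zword zs1) \<notin> C" if "rest = zs1 @ zs2" for zs1 zs2
        proof -
          have "zs = (pq # zs1) @ zs2" using that by (simp add: Cons)
          then have "g + wval \<eta> (zword (pq # zs1)) \<notin> C" using no by blast
          then show ?thesis by (simp add: pq add.assoc)
        qed
        have "wsum c g (zword zs) = k (b + wval \<eta> q) - k b + wsum c (g + wval \<eta> p + wval \<eta> q) (zword rest)"
          using c1[OF Z(1)] c2[OF Z(2)] by (simp add: Cons pq wsum_append b_def add.assoc)
        moreover have "k (b + wval \<eta> q) = 0" using out[of "[]" rest] by (simp add: k_def b_def)
        moreover have "k b = 1" using \<open>b \<in> C\<close> by (simp add: k_def)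
        moreover have "wsum c (g + wval \<eta> p + wval \<eta> q) (zword rest) \<le> 0"
          by (rule nonpos[OF Z(3)]) (rule out)
        ultimately show False using sum0 by simp
      qed
      then obtain zs1 zs2 where split: "zs = zs1 @ zs2" "g + wval \<eta> (zword zs1) \<in> C" by blast
      \<comment> \<open>The stretch from \<open>b\<close> through \<open>q\<close> and
        \<open>mid\<close> returns to \<open>C\<close> and is compared with \<open>y\<close>. The
        closed path is rotated to start with \<open>mid\<close>, so that \<open>winv y\<close> and
        \<open>q\<close> are absorbed into the last \<open>E2\<close> piece and the number of pairs
        falls.\<close>
      have cut: "wval lam q + wval lam (zword mid) = wval lam y"
        if mid: "zigzag E1 E2 (g + wval \<eta> p + wval \<eta> q) mid" "length mid < length zs"
          and y: "edges b y \<subseteq> E1 \<inter> E2" "wval \<eta> y = wval \<eta> q + wval \<eta> (zword mid)" for mid y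
      proof -
        have y': "edges (b + wval \<eta> q + wval \<eta> (zword mid)) (winv y) \<subseteq> E1 \<inter> E2"
          using edges_winv[of b y] y by (simp add: add.assoc)
        have closed': "wval \<eta> (zword mid) - wval \<eta> y + wval \<eta> q = 0"
          by (simp add: y(2) diff_conv_add_uminus minus_add add.assoc del: add_uminus_conv_diff)
        have "wval lam (zword mid) - wval lam y + wval lam q = 0"
        proof (cases mid rule: rev_cases)
          case Nil
          then have "edges (b + wval \<eta> q) (winv y @ q) \<subseteq> E2"
            using y y' Z(2) by (auto simp: edges_append b_def add.assoc add_add_diff_cancel)
          then show ?thesis using f2 closed' Nil unfolding flat_def by force
        next
          case (snoc ms z)
          obtain p2 q2 where z: "z = (p2, q2)" by (cases z)
          define mid' where "mid' = ms @ [(p2, q2 @ winv y @ q)]"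
          have zw: "zword mid' = zword mid @ winv y @ q" by (simp add: mid'_def snoc z)
          have "zigzag E1 E2 (g + wval \<eta> p + wval \<eta> q) mid'"
            using mid(1) y' Z(2) closed' y(2)
            by (auto simp: mid'_def snoc z zigzag_append edges_append b_def add.assoc add_add_diff_cancel)
          moreover have "length mid' < length zs" using mid(2) by (simp add: mid'_def snoc)
          moreover have "wval \<eta> (zword mid') = 0" unfolding zw using closed' by (simp add: add_uminus_add)
          ultimately have "wval lam (zword mid') = 0" using less.hyps by blast
          then show ?thesis unfolding zw by (simp add: add_uminus_add)
        qed
        then have "wval lam q = - (wval lam (zword mid) - wval lam y)" by (metis minus_unique)
        then show ?thesis by simp
      qed
      show ?thesis
      proof (cases "g \<in> C")
        case True
        then obtain y where y: "edges b y \<subseteq> E1 \<inter> E2" "b + wval \<eta> y = g" unfolding C_def by auto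
        have py: "wval \<eta> p + wval \<eta> y = 0"
          using y(2) add_left_cancel[of g "wval \<eta> p + wval \<eta> y" 0] by (simp add: b_def add.assoc)
        then have "wval \<eta> y = wval \<eta> q + wval \<eta> (zword rest)"
          using closed by (metis add.assoc minus_unique)
        then have "wval lam q + wval lam (zword rest) = wval lam y"
          using cut[OF Z(3) _ y(1)] by (simp add: Cons)
        moreover have "wval lam (p @ y) = 0"
        proof -
          have "edges g (p @ y) \<subseteq> E1" using y Z by (auto simp: edges_append b_def)
          then show ?thesis using f1 py unfolding flat_def by force
        qed
        ultimately show ?thesis by (simp add: Cons pq add.assoc)
      next
        case False
        have "zs2 \<noteq> []"
        proof
          assume "zs2 = []"
          then show False using split False less.prems(2) by simp
        qed
        moreover have "zs1 \<noteq> []" using split False by auto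
        ultimately obtain mid p' q' rest' where zs12: "zs1 = (p, q) # mid" "zs2 = (p', q') # rest'"
          using split(1) unfolding Cons pq by (cases zs1; cases zs2) auto
        have rest: "rest = mid @ (p', q') # rest'" using split(1) zs12 Cons pq by simp
        obtain y where y: "edges b y \<subseteq> E1 \<inter> E2" "b + wval \<eta> y = g + wval \<eta> (zword zs1)"
          using split(2) unfolding C_def by auto
        have y_eq: "wval \<eta> y = wval \<eta> q + wval \<eta> (zword mid)"
          using y(2) add_left_cancel[of b "wval \<eta> y" "wval \<eta> q + wval \<eta> (zword mid)"]
          by (simp add: zs12 b_def add.assoc)
        have A: "wval lam q + wval lam (zword mid) = wval lam y"
          using cut[of mid y] Z(3) y(1) y_eq by (simp add: rest zigzag_append Cons)
        \<comment> \<open>The shortcut \<open>y\<close> is an \<open>E1\<close> path too, so it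
          merges with \<open>p\<close> and \<open>p'\<close> into one piece.\<close>
        define zs' where "zs' = (p @ y @ p', q') # rest'"
        have "zigzag E1 E2 g zs'"
          using Z y(1) unfolding zs'_def rest by (auto simp: zigzag_append edges_append b_def y_eq add.assoc)
        moreover have "wval \<eta> (zword zs') = 0"
          using closed unfolding zs'_def rest by (simp add: y_eq add.assoc)
        moreover have "length zs' < length zs" by (simp add: zs'_def Cons rest)
        ultimately have "wval lam (zword zs') = 0" using less.hyps by blast
        then show ?thesis unfolding zs'_def Cons rest pq by (simp add: add.assoc flip: A)
      qed
    qed simp
  qed
  show ?thesis unfolding flat_def
  proof (intro allI impI)
    fix g w assume "edges g w \<subseteq> E1 \<union> E2" "wval \<eta> w = 0"
    then show "wval lam w = 0" using zz zigzag_of_word by metis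
  qed
qed


section \<open>Orbits of a simple closed path\<close>

lemma flat_mono: "flat E lam \<Longrightarrow> E' \<subseteq> E \<Longrightarrow> flat E' lam"
  unfolding flat_def by blast

lemma edges_subset_orbit_shift:
  assumes "add_subgroup H" "h \<in> H" "edges g w \<subseteq> orbit H R"
  shows "edges (h + g) w \<subseteq> orbit H R"
proof
  fix e assume "e \<in> edges (h + g) w"
  then obtain f where "f \<in> edges g w" "e = shift h f" by (auto simp: edges_shift)
  moreover then obtain k r where "k \<in> H" "r \<in> R" "f = shift k r"
    using assms(3) unfolding orbit_def by blast
  ultimately have "e = shift (h + k) r" "h + k \<in> H" using add_subgroupD(2)[OF assms(1)] assms(2) by auto
  with \<open>r \<in> R\<close> show "e \<in> orbit H R" unfolding orbit_def by blast
qed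

text \<open>Each translate of \<open>w\<close> owns its translate of the first edge
  \<open>e0\<close>. Replacing that edge by the rest of the translate changes no label because
  \<open>lam\<close> vanishes on \<open>w\<close>, so all paths can be pushed off the orbit of
  \<open>e0\<close>. A simple closed path there would have, by the span hypothesis, a nonzero
  coefficient on some translate of \<open>e0\<close>.\<close>

lemma flat_orbit_of_distinct:
  fixes lam :: "'x \<Rightarrow> 'b::group_add"
  assumes H: "add_subgroup H" and s: "scycle d w" and lam: "wval lam w = 0"
    and span: "\<And>g v. edges g v \<subseteq> orbit H (edges d w) \<Longrightarrow> wval \<eta> v = 0 \<Longrightarrow>
      in_span H (chain d w) (chain g v)"
    and dist: "\<And>i j. i < j \<Longrightarrow> j < length w \<Longrightarrow> vtx d w j - vtx d w i \<notin> H"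
  shows "flat (orbit H (edges d w)) lam"
proof -
  note Hs = add_subgroupD[OF H]
  have w: "w \<noteq> []" "wval \<eta> w = 0" using s by (auto simp: scycle_def)
  obtain l v where lv: "w = l # v" using w by (cases w) auto
  define E where "E = orbit H (edges d w)"
  define e0 where "e0 = edge d l"
  have e0: "e0 = cedge d w 0" by (simp add: e0_def cedge_def vtx_def ltr_def lv)
  have free: "k = 0" if k: "k \<in> H" and ke: "shift k e0 \<in> edges d w" for k
  proof -
    obtain i where i: "i < length w" "shift k (cedge d w 0) = cedge d w i"
      using ke unfolding e0 edges_cedge by auto
    have "k + vtx d w 0 = vtx d w i \<or> k + vtx d w 0 = vtx d w (Suc i)"
      using arg_cong[OF i(2), of fst] arg_cong[OF i(2), of tgt]
      by (auto simp: cedge_ends[OF w] split: if_splits)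
    then obtain j where j: "j = i \<or> j = Suc i" "k + vtx d w 0 = vtx d w j" by blast
    then have kj: "k = vtx d w j - vtx d w 0" by (metis add_diff_cancel)
    show ?thesis
    \<comment> \<open>The case \<open>j = Suc i\<close> may reach the length, which is position 0
      again.\<close>
    proof (cases "j = length w")
      case True
      then show ?thesis using kj vtx_mod[of d w j] by simp
    next
      case False
      then show ?thesis using dist[of 0 j] kj k i j by (cases j) auto
    qed
  qed
  have rest: "shift k e0 \<notin> edges (d + lval \<eta> l) v" if k: "k \<in> H" for k
  proof
    assume *: "shift k e0 \<in> edges (d + lval \<eta> l) v"
    then have "k = 0" using free[OF k] by (simp add: lv)
    with * have "e0 \<in> edges (d + lval \<eta> l) v" by simp
    then obtain i where i: "i < length v" "e0 = edge (d + lval \<eta> l + wval \<eta> (take i v)) (v ! i)"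
      unfolding edges_nth by auto
    then have "cedge d w 0 = cedge d w (Suc i)"
      unfolding e0[symmetric] i(2) by (simp add: cedge_def vtx_def ltr_def lv add.assoc)
    then show False using scycle_cedge[OF s, of 0 "Suc i"] i by (simp add: lv)
  qed
  define E1 where "E1 = E - orbit H {e0}"
  have rest_E1: "edges (h + (d + lval \<eta> l)) v \<subseteq> E1" if h: "h \<in> H" for h
  proof
    fix e assume "e \<in> edges (h + (d + lval \<eta> l)) v"
    then obtain f where f: "f \<in> edges (d + lval \<eta> l) v" "e = shift h f" by (auto simp: edges_shift)
    have "f \<in> edges d w" using f by (simp add: lv)
    then have "e \<in> E" unfolding E_def orbit_def using f h by blast
    moreover have "e \<noteq> shift k e0" if "k \<in> H" for k
    proof
      assume "e = shift k e0"
      then have "f = shift (- h + k) e0" using f(2) by (metis shift_eq_iff shift_simps(4))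
      then show False using rest[of "- h + k"] Hs(2,3) h that f(1) by blast
    qed
    ultimately show "e \<in> E1" unfolding E1_def orbit_def by auto
  qed
  have vinv: "wval \<eta> v = - lval \<eta> l" "wval lam v = - lval lam l"
    using w(2) lam unfolding lv by (auto simp: minus_unique)
  have detour: "\<exists>u'. edges g u' \<subseteq> E1 \<and> wval \<eta> u' = wval \<eta> u \<and> wval lam u' = wval lam u"
    if "edges g u \<subseteq> E" for g u
    using that
  proof (induction u arbitrary: g)
    case Nil
    show ?case by (rule exI[of _ "[]"]) simp
  next
    case (Cons k u)
    obtain u' where u': "edges (g + lval \<eta> k) u' \<subseteq> E1" "wval \<eta> u' = wval \<eta> u" "wval lam u' = wval lam u"
      using Cons.IH[of "g + lval \<eta> k"] Cons.prems by auto
    have "\<exists>k'. edges g k' \<subseteq> E1 \<and> wval \<eta> k' = lval \<eta> k \<and> wval lam k' = lval lam k"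
    proof (cases "edge g k \<in> E1")
      case True
      then show ?thesis by (intro exI[of _ "[k]"]) auto
    next
      case False
      then obtain h where h: "h \<in> H" "edge g k = shift h e0"
        using Cons.prems unfolding E1_def orbit_def by auto
      have lab: "fst k = fst l" using arg_cong[OF h(2), of snd] by (simp add: e0_def)
      show ?thesis
      proof (cases "snd k = snd l")
        case True
        then have "k = l" using lab by (simp add: prod_eq_iff)
        have "g = h + d"
          using arg_cong[OF h(2), of fst] arg_cong[OF h(2), of tgt] True
          by (auto simp: e0_def edge_ends split: if_splits)
        then have "edges g (winv v) = edges (h + (d + lval \<eta> l)) v"
          using edges_winv[of "h + (d + lval \<eta> l)" v] by (simp add: vinv add_add_diff_cancel)
        then show ?thesis using rest_E1[OF h(1)] \<open>k = l\<close> by (intro exI[of _ "winv v"]) (simp add: vinv)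
      next
        case False
        then have "k = letter_inv l" using lab by (auto simp: prod_eq_iff letter_inv_def)
        have "g = h + (d + lval \<eta> l)"
          using arg_cong[OF h(2), of fst] arg_cong[OF h(2), of tgt] False
          by (auto simp: e0_def edge_ends split: if_splits)
        then show ?thesis using rest_E1[OF h(1)] \<open>k = letter_inv l\<close> by (intro exI[of _ v]) (simp add: vinv)
      qed
    qed
    then obtain k' where "edges g k' \<subseteq> E1" "wval \<eta> k' = lval \<eta> k" "wval lam k' = lval lam k" by blast
    with u' show ?case by (intro exI[of _ "k' @ u'"]) (auto simp: edges_append)
  qed
  have "wval lam u = 0" if u: "edges g u \<subseteq> E" "wval \<eta> u = 0" for g u
  proof (rule ccontr)
    assume "wval lam u \<noteq> 0"
    moreover obtain u' where "edges g u' \<subseteq> E1" "wval \<eta> u' = wval \<eta> u" "wval lam u' = wval lam u"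
      using detour[OF u(1)] by blast
    ultimately obtain g' c where c: "scycle g' c" "edges g' c \<subseteq> E1"
      using u(2) obtain_scycle[of u' g E1 lam] by metis
    have "in_span H (chain d w) (chain g' c)"
      using span c unfolding E1_def E_def scycle_def by blast
    then obtain S a where S: "finite S" "S \<subseteq> H" "\<forall>h\<in>S. a h \<noteq> 0"
      and ch: "chain g' c = (\<lambda>e. \<Sum>h\<in>S. a h * chain d w (shift (- h) e))"
      unfolding in_span_def by blast
    have "edges g' c \<noteq> {}" using c by (cases c) (auto simp: scycle_def)
    then have "S \<noteq> {}" using chain_scycle_nonzero_iff[OF c(1)] ch by fastforce
    then obtain h where h: "h \<in> S" by auto
    have "chain d w (shift (- h') (shift h e0)) = 0" if "h' \<in> S - {h}" for h'
    proof (rule ccontr)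
      assume "\<not> ?thesis"
      then have "shift (- h' + h) e0 \<in> edges d w" using chain_nonzero_edges by auto
      then have "- h' + h = 0" using free Hs(2,3) S h that by blast
      then have "h = h'" by (metis add.inverse_inverse minus_unique)
      then show False using that by simp
    qed
    then have "chain g' c (shift h e0) = a h * chain d w (shift (- h) (shift h e0))"
      unfolding ch by (subst sum.remove[OF S(1) h]) simp
    moreover have "chain d w e0 \<noteq> 0"
      using chain_scycle_nonzero_iff[OF s] by (simp add: e0_def lv)
    ultimately have "chain g' c (shift h e0) \<noteq> 0" using S h by simp
    then have "shift h e0 \<in> E1" using c(2) chain_nonzero_edges by blast
    then show False using h S unfolding E1_def orbit_def by blast
  qed
  then show ?thesis unfolding flat_def E_def by blast
qed

text \<open>
  Among the highest translates, the top edges cannot all cancel, by unique products.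
\<close>

lemma combination_height_le:
  fixes pot \<phi> :: "'g \<Rightarrow> int" and r :: "'g \<times> 'x \<Rightarrow> int"
  assumes G: "add_subgroup G" "unique_products G" and fin: "finite {e. r e \<noteq> 0}"
    and \<phi>: "\<And>h e. h \<in> G \<Longrightarrow> r e \<noteq> 0 \<Longrightarrow>
       pot (h + fst e) = \<phi> h + pot (fst e) \<and> pot (h + tgt e) = \<phi> h + pot (tgt e)"
    and hi: "\<And>e. r e \<noteq> 0 \<Longrightarrow> pot (fst e) \<le> hi \<and> pot (tgt e) \<le> hi"
    and et: "r et \<noteq> 0" "pot (fst et) = hi \<or> pot (tgt et) = hi"
    and S: "finite S" "S \<subseteq> G" "\<And>h. h \<in> S \<Longrightarrow> a h \<noteq> 0"
    and z: "\<And>e. (\<Sum>h\<in>S. a h * r (shift (- h) e)) \<noteq> 0 \<Longrightarrow> pot (fst e) \<le> b \<and> pot (tgt e) \<le> b"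
    and h: "h \<in> S"
  shows "\<phi> h + hi \<le> b"
proof -
  define M where "M = Max (\<phi> ` S)"
  have M: "\<phi> k \<le> M" if "k \<in> S" for k using S that by (simp add: M_def)
  have "M + hi \<le> b"
  proof (rule ccontr)
    assume gt: "\<not> M + hi \<le> b"
    define S' where "S' = {k \<in> S. \<phi> k = M}"
    define T where "T = {e. r e \<noteq> 0 \<and> (pot (fst e) = hi \<or> pot (tgt e) = hi)}"
    \<comment> \<open>Top edges in the orbit of \<open>et\<close> are encoded by the group elements
      that carry \<open>et\<close> to them; a unique sum from \<open>S'\<close> and
      \<open>T'\<close> then names an edge met by a single translate.\<close>
    define T' where "T' = {k \<in> G. shift k et \<in> T}"
    have "finite T" using fin by (rule finite_subset[rotated]) (auto simp: T_def)
    have "finite ((\<lambda>k. shift k et) ` T')" by (rule finite_subset[OF _ \<open>finite T\<close>]) (auto simp: T'_def)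
    then have "finite T'" by (rule finite_imageD) (auto simp: inj_on_def)
    moreover have "0 \<in> T'" using et add_subgroupD(1)[OF G(1)] by (simp add: T'_def T_def)
    moreover have "M \<in> \<phi> ` S" unfolding M_def using S h by (intro Max_in) auto
    then have "S' \<noteq> {}" by (auto simp: S'_def)
    moreover have "finite S'" "S' \<subseteq> G" "T' \<subseteq> G" using S by (auto simp: S'_def T'_def)
    ultimately have "\<exists>s\<in>S'. \<exists>t\<in>T'. \<forall>s'\<in>S'. \<forall>t'\<in>T'. s' + t' = s + t \<longrightarrow> s' = s"
      using G(2)[unfolded unique_products_def, rule_format, of S' T'] by blast
    then obtain s t where st: "s \<in> S'" "t \<in> T'"
      and uniq: "\<And>s' t'. s' \<in> S' \<Longrightarrow> t' \<in> T' \<Longrightarrow> s' + t' = s + t \<Longrightarrow> s' = s"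
      by blast
    define e where "e = shift (s + t) et"
    have sG: "s \<in> G" "s \<in> S" "\<phi> s = M" and tG: "t \<in> G" "shift t et \<in> T"
      using st S by (auto simp: S'_def T'_def)
    have e_s: "e = shift s (shift t et)" by (simp add: e_def)
    have "pot (s + fst (shift t et)) = M + pot (fst (shift t et))"
      and "pot (s + tgt (shift t et)) = M + pot (tgt (shift t et))"
      using \<phi>[of s "shift t et"] sG tG unfolding T_def by auto
    then have top: "pot (fst e) = M + hi \<or> pot (tgt e) = M + hi"
      using tG(2) unfolding e_s T_def by (auto simp: add.assoc)
    have zero: "r (shift (- k) e) = 0" if k: "k \<in> S - {s}" for k
    proof (rule ccontr)
      define f where "f = shift (- k) e"
      assume "r (shift (- k) e) \<noteq> 0"
      then have f: "r f \<noteq> 0" by (simp add: f_def)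
      have e_k: "e = shift k f" by (simp add: f_def)
      have kG: "k \<in> G" "k \<in> S" using k S by auto
      have pk: "pot (fst e) = \<phi> k + pot (fst f)" "pot (tgt e) = \<phi> k + pot (tgt f)"
        using \<phi>[OF kG(1) f] by (simp_all add: e_k)
      then have "\<phi> k = M" "f \<in> T" using top hi[OF f] M[OF kG(2)] f unfolding T_def by auto
      moreover have "f = shift (- k + (s + t)) et" by (simp add: f_def e_def)
      ultimately have "- k + (s + t) \<in> T'" "k \<in> S'"
        using add_subgroupD(2,3)[OF G(1)] kG sG tG by (auto simp: T'_def S'_def)
      then have "k = s" using uniq[of k "- k + (s + t)"] by simp
      then show False using k by simp
    qed
    have "(\<Sum>k\<in>S. a k * r (shift (- k) e)) = a s * r (shift t et)"
      by (subst sum.remove[OF S(1) sG(2)]) (simp add: zero, simp add: e_s)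
    also have "\<dots> \<noteq> 0" using S(3) sG(2) tG(2) by (simp add: T_def)
    finally show False using z[of e] top gt by auto
  qed
  then show ?thesis using M[OF h] by simp
qed


text \<open>The induction fixes \<open>w\<close> and \<open>lam\<close> and varies the group and the
  base point, since a slab leads to the kernel of the height and to a translate of \<open>w\<close>.
  The span hypothesis is the homological shadow of the conclusion, and it has to be re-established
  at each descent.\<close>

theorem flat_orbit:
  fixes lam :: "'x \<Rightarrow> 'b::group_add"
  assumes "add_subgroup H" "unique_products H" "scycle d w" "wval lam w = 0"
    and "\<And>g v. edges g v \<subseteq> orbit H (edges d w) \<Longrightarrow> wval \<eta> v = 0 \<Longrightarrow>
      in_span H (chain d w) (chain g v)"
  shows "flat (orbit H (edges d w)) lam"
  using assms
proof (induction "card {(i, j). i < length w \<and> j < length w \<and> vtx d w j - vtx d w i \<in> H}"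
    arbitrary: H d rule: less_induct)
  case less
  note H = less.prems(1,2) and s = less.prems(3) and lam = less.prems(4) and span = less.prems(5)
  note Hs = add_subgroupD[OF H(1)]
  have w: "w \<noteq> []" "wval \<eta> w = 0" using s by (auto simp: scycle_def)
  define R E where "R = edges d w" and "E = orbit H R"
  show ?case
  proof (cases "\<forall>i j. i < j \<longrightarrow> j < length w \<longrightarrow> vtx d w j - vtx d w i \<notin> H")
    case True
    then show ?thesis using flat_orbit_of_distinct[OF H(1) s lam span] by blast
  next
    case False
    then obtain p q where pq: "p < q" "q < length w" "vtx d w q - vtx d w p \<in> H" by blast
    obtain c i j where c_inv: "\<And>h e. h \<in> H \<Longrightarrow> c (shift h e) = c e" and c0: "wsum c d w = 0"
      and ij: "i < j" "vtx d w j - vtx d w i \<in> H"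
      and arc: "(\<Sum>k\<in>{i..<j}. lsgn (ltr w k) * c (cedge d w k)) \<noteq> 0"
      by (rule exists_invariant_cochain[OF H s pq]) (rule that)
    have c_shift: "wsum c (h + u) v = wsum c u v" if "h \<in> H" for h u v
      by (simp add: wsum_shift c_inv[OF that])
    have E_shift: "edges (h + u) v \<subseteq> E" if "h \<in> H" "edges u v \<subseteq> E" for h u v
      using edges_subset_orbit_shift[OF H(1) that(1)] that(2) unfolding E_def by blast
    \<comment> \<open>Invariance makes \<open>c\<close> vanish on all translates of
      \<open>w\<close>, and the span hypothesis extends this to closed paths. So \<open>c\<close>
      has a potential on each component of the orbit.\<close>
    have closed_0: "wsum c g v = 0" if gv: "edges g v \<subseteq> E" "wval \<eta> v = 0" for g v
    proof -
      obtain S a where S: "finite S" "S \<subseteq> H" "chain g v = (\<lambda>e. \<Sum>h\<in>S. a h * chain d w (shift (- h) e))"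
        using span[OF gv[unfolded E_def R_def]] unfolding in_span_def by blast
      have "wsum c g v = (\<Sum>h\<in>S. a h * wsum c (h + d) w)"
        by (rule wsum_combination[OF S(1)]) (simp add: S(3))
      also have "\<dots> = (\<Sum>h\<in>S. 0)" by (rule sum.cong) (use S(2) c0 c_shift in auto)
      finally show ?thesis by simp
    qed
    have R_E: "R \<subseteq> E" unfolding E_def orbit_def using Hs(1) by force

    \<comment> \<open>The potential is determined only on the component \<open>V0\<close> of
      \<open>d\<close>, by summing along some path; elsewhere its value is arbitrary.\<close>
    define V0 where "V0 = {v. \<exists>u. edges d u \<subseteq> E \<and> d + wval \<eta> u = v}"
    define pot where "pot v = wsum c d (SOME u. edges d u \<subseteq> E \<and> d + wval \<eta> u = v)" for v
    have pot_eq: "pot (d + wval \<eta> u) = wsum c d u" if u: "edges d u \<subseteq> E" for u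
    proof -
      define u' where "u' = (SOME u'. edges d u' \<subseteq> E \<and> d + wval \<eta> u' = d + wval \<eta> u)"
      have "edges d u' \<subseteq> E \<and> d + wval \<eta> u' = d + wval \<eta> u"
        unfolding u'_def by (rule someI[of _ u]) (simp add: u)
      then have u': "edges d u' \<subseteq> E" "wval \<eta> u' = wval \<eta> u" by auto
      have "wsum c d (u @ winv u') = 0"
        by (rule closed_0) (use u u' edges_winv[of d u'] in \<open>auto simp: edges_append\<close>)
      then show ?thesis
        using wsum_winv[of c d u'] u'(2) by (simp add: wsum_append pot_def u'_def)
    qed
    have V0_path: "u + wval \<eta> v \<in> V0" "pot (u + wval \<eta> v) = pot u + wsum c u v"
      if uv: "u \<in> V0" "edges u v \<subseteq> E" for u v
    proof -
      obtain u' where u': "edges d u' \<subseteq> E" "d + wval \<eta> u' = u" using uv(1) unfolding V0_def by auto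
      have *: "edges d (u' @ v) \<subseteq> E" "d + wval \<eta> (u' @ v) = u + wval \<eta> v"
        using u' uv(2) by (auto simp: edges_append simp flip: add.assoc)
      then show "u + wval \<eta> v \<in> V0" unfolding V0_def by blast
      show "pot (u + wval \<eta> v) = pot u + wsum c u v"
        using pot_eq[OF *(1)] pot_eq[OF u'(1)] *(2) u'(2) by (simp add: wsum_append)
    qed
    have V0_back: "u \<in> V0" if "u + wval \<eta> v \<in> V0" "edges u v \<subseteq> E" for u v
      using V0_path(1)[OF that(1), of "winv v"] that(2) edges_winv[of u v] by (simp add: add.assoc)
    have d_V0: "d \<in> V0" unfolding V0_def by (auto intro: exI[of _ "[]"])
    have pot_d: "pot d = 0" using pot_eq[of "[]"] by simp
    define E0 where "E0 = {e \<in> E. fst e \<in> V0}"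
    have path_E0: "edges u v \<subseteq> E0" if "u \<in> V0" "edges u v \<subseteq> E" for u v
      using that
    proof (induction v arbitrary: u)
      case (Cons l v)
      have "edges u [l] \<subseteq> E" using Cons.prems by auto
      then have "u + lval \<eta> l \<in> V0" using V0_path(1)[OF Cons.prems(1), of "[l]"] by simp
      then show ?case using Cons edge_ends[of u l] by (auto simp: E0_def split: if_splits)
    qed simp

    \<comment> \<open>The stabilizer of the component. Translation by \<open>h\<close> changes every
      height there by \<open>\<phi> h\<close>, so \<open>\<phi>\<close> is a homomorphism from
      \<open>G\<close> to the integers.\<close>
    define G where "G = {h \<in> H. h + d \<in> V0}"
    define \<phi> where "\<phi> h = pot (h + d)" for h
    have G_H: "G \<subseteq> H" by (auto simp: G_def)
    have GI: "h \<in> G" if h: "h \<in> H" and v: "v \<in> V0" "h + v \<in> V0" for h v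
    proof -
      obtain u where u: "edges d u \<subseteq> E" "d + wval \<eta> u = v" using v(1) unfolding V0_def by auto
      have "h + d \<in> V0"
        by (rule V0_back[of _ u]) (use u v(2) E_shift[OF h u(1)] in \<open>auto simp: add.assoc\<close>)
      then show ?thesis by (simp add: G_def h)
    qed
    have G_shift: "h + v \<in> V0" "pot (h + v) = \<phi> h + pot v" if h: "h \<in> G" and v: "v \<in> V0" for h v
    proof -
      obtain u where u: "edges d u \<subseteq> E" "d + wval \<eta> u = v" using v unfolding V0_def by auto
      have *: "h \<in> H" "h + d \<in> V0" using h by (auto simp: G_def)
      have hv: "h + d + wval \<eta> u = h + v" using u(2) by (simp add: add.assoc)
      show "h + v \<in> V0" using V0_path(1)[OF *(2) E_shift[OF *(1) u(1)]] by (simp add: hv)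
      show "pot (h + v) = \<phi> h + pot v"
        using V0_path(2)[OF *(2) E_shift[OF *(1) u(1)]] pot_eq[OF u(1)] u(2)
        by (simp add: hv c_shift[OF *(1)] \<phi>_def)
    qed
    have \<phi>_0: "\<phi> 0 = 0" by (simp add: \<phi>_def pot_d)
    have \<phi>_add: "\<phi> (h + k) = \<phi> h + \<phi> k" if "h \<in> G" "k \<in> G" for h k
      using G_shift(2)[of h "k + d"] that by (simp add: \<phi>_def G_def add.assoc)
    have G_uminus: "- h \<in> G" if "h \<in> G" for h
      using GI[of "- h" "h + d"] that Hs(3) d_V0 by (simp add: G_def)
    have G: "add_subgroup G"
      unfolding add_subgroup_def
    proof (intro conjI ballI)
      show "0 \<in> G" using Hs(1) d_V0 by (simp add: G_def)
      show "h + k \<in> G" if "h \<in> G" "k \<in> G" for h k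
        using that G_shift(1)[of h "k + d"] Hs(2) by (simp add: G_def add.assoc)
    qed (rule G_uminus)
    note Gs = add_subgroupD[OF G]
    have G_up: "unique_products G" by (rule unique_products_mono[OF H(2) G_H])
    have \<phi>_uminus: "\<phi> (- h) = - \<phi> h" if "h \<in> G" for h
      using \<phi>_add[OF that G_uminus[OF that]] by (simp add: \<phi>_0)

    have vtx_V0: "vtx d w k \<in> V0" for k
    proof -
      have "edges d (take (k mod length w) w) \<subseteq> edges d w"
        by (metis Un_upper1 append_take_drop_id edges_append)
      then show ?thesis using V0_path(1)[OF d_V0] R_E unfolding R_def vtx_def by blast
    qed
    have vtx_pot: "pot (vtx d w (Suc k)) = pot (vtx d w k) + lsgn (ltr w k) * c (cedge d w k)" for k
    proof -
      have "cedge d w k \<in> E" using cedge_mem[OF w(1)] R_E unfolding R_def by blast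
      then have "edges (vtx d w k) [ltr w k] \<subseteq> E" by (simp add: cedge_def)
      from V0_path(2)[OF vtx_V0 this] show ?thesis by (simp add: vtx_Suc[OF w] cedge_def)
    qed
    \<comment> \<open>The arc from \<open>i\<close> to \<open>j\<close> closes up in the quotient
      with a nonzero sum of \<open>c\<close>, so this translation changes the height.\<close>
    define g0 where "g0 = vtx d w j - vtx d w i"
    have g0: "g0 + vtx d w i = vtx d w j" "g0 \<in> H" using ij by (simp_all add: g0_def)
    then have g0_G: "g0 \<in> G" using GI[of g0 "vtx d w i"] vtx_V0 by simp
    have g0_\<phi>: "\<phi> g0 \<noteq> 0"
    proof -
      have "pot (vtx d w (i + (j - i))) - pot (vtx d w i) = (\<Sum>k\<in>{i..<i + (j - i)}. lsgn (ltr w k) * c (cedge d w k))"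
        by (rule vtx_diff_arc[OF w vtx_pot])
      then show ?thesis using G_shift(2)[OF g0_G vtx_V0, of i] arc ij(1) by (simp add: g0)
    qed

    define lo hi where "lo = Min ((\<lambda>k. pot (vtx d w k)) ` {..<length w})"
      and "hi = Max ((\<lambda>k. pot (vtx d w k)) ` {..<length w})"
    have ne: "(\<lambda>k. pot (vtx d w k)) ` {..<length w} \<noteq> {}" using w by (simp add: lessThan_empty_iff)
    have lohi: "lo \<le> pot (vtx d w k)" "pot (vtx d w k) \<le> hi" for k
    proof -
      have "pot (vtx d w k) \<in> (\<lambda>k. pot (vtx d w k)) ` {..<length w}"
        using w by (intro image_eqI[of _ _ "k mod length w"]) auto
      then show "lo \<le> pot (vtx d w k)" "pot (vtx d w k) \<le> hi" by (simp_all add: lo_def hi_def)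
    qed
    have R_ends: "lo \<le> pot (fst e) \<and> pot (fst e) \<le> hi \<and> lo \<le> pot (tgt e) \<and> pot (tgt e) \<le> hi \<and>
       fst e \<in> V0 \<and> tgt e \<in> V0" if "e \<in> R" for e
      using that lohi vtx_V0 unfolding R_def edges_cedge by (auto simp: cedge_ends[OF w])
    have vtx_R: "\<exists>e\<in>R. fst e = vtx d w k \<or> tgt e = vtx d w k" for k
      using cedge_mem[OF w(1), of d k] cedge_ends[OF w, of d k] unfolding R_def by metis
    obtain k_lo k_hi where k_lo: "pot (vtx d w k_lo) = lo" and k_hi: "pot (vtx d w k_hi) = hi"
      using Min_in[OF _ ne] Max_in[OF _ ne] unfolding lo_def hi_def by fastforce
    obtain e_lo where e_lo: "e_lo \<in> R" "pot (fst e_lo) = lo \<or> pot (tgt e_lo) = lo"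
      using vtx_R[of k_lo] k_lo by auto
    obtain e_hi where e_hi: "e_hi \<in> R" "pot (fst e_hi) = hi \<or> pot (tgt e_hi) = hi"
      using vtx_R[of k_hi] k_hi by auto
    have R_iff: "chain d w e \<noteq> 0 \<longleftrightarrow> e \<in> R" for e
      unfolding R_def by (rule chain_scycle_nonzero_iff[OF s])

    have E0_dest: "\<exists>h\<in>G. \<exists>f\<in>R. e = shift h f" if e: "e \<in> E0" for e
    proof -
      obtain h f where hf: "h \<in> H" "f \<in> R" "e = shift h f" using e unfolding E0_def E_def orbit_def by auto
      then have "h \<in> G" using GI[of h "fst f"] R_ends[of f] e by (auto simp: E0_def)
      then show ?thesis using hf by blast
    qed
    have shift_E0: "shift h f \<in> E0" if h: "h \<in> G" and f: "f \<in> R" for h f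
      using G_shift(1)[OF h, of "fst f"] R_ends[OF f] h f G_H orbitI[of h H f R]
      by (auto simp: E0_def E_def)
    have shift_pot: "pot (fst (shift h f)) = \<phi> h + pot (fst f)" "pot (tgt (shift h f)) = \<phi> h + pot (tgt f)"
      if h: "h \<in> G" and f: "f \<in> R" for h f
      using G_shift(2)[OF h] R_ends[OF f] by simp_all

    \<comment> \<open>Translates by elements outside \<open>G\<close> lie in other components and do
      not meet \<open>E0\<close>, while those by \<open>G\<close> stay in it. Dropping the former
      leaves the chain unchanged.\<close>
    have span0: "\<exists>S a. finite S \<and> S \<subseteq> G \<and> (\<forall>h\<in>S. a h \<noteq> 0) \<and>
        chain g v = (\<lambda>e. \<Sum>h\<in>S. a h * chain d w (shift (- h) e))"
      if gv: "edges g v \<subseteq> E0" "wval \<eta> v = 0" for g v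
    proof -
      have "edges g v \<subseteq> orbit H (edges d w)" using gv unfolding E0_def E_def R_def by auto
      then have "in_span H (chain d w) (chain g v)" using gv(2) by (rule span)
      then obtain S a where S: "finite S" "S \<subseteq> H" "\<forall>h\<in>S. a h \<noteq> 0"
        and ch: "chain g v = (\<lambda>e. \<Sum>h\<in>S. a h * chain d w (shift (- h) e))"
        unfolding in_span_def by blast
      have "chain g v e = (\<Sum>h\<in>S \<inter> G. a h * chain d w (shift (- h) e))" for e
      proof (cases "e \<in> E0")
        case True
        have "chain d w (shift (- h) e) = 0" if "h \<in> S - S \<inter> G" for h
        proof (rule ccontr)
          assume "\<not> ?thesis"
          then have f: "shift (- h) e \<in> R" using R_iff by blast
          then have "h \<in> G" using GI[of h "fst (shift (- h) e)"] R_ends[OF f] that S True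
            by (auto simp: E0_def simp flip: add.assoc)
          then show False using that by auto
        qed
        then show ?thesis unfolding ch using S by (intro sum.mono_neutral_right) auto
      next
        case False
        then have "chain g v e = 0" using chain_nonzero_edges gv by blast
        moreover have "chain d w (shift (- h) e) = 0" if "h \<in> G" for h
          using shift_E0[OF that, of "shift (- h) e"] R_iff[of "shift (- h) e"] False by auto
        ultimately show ?thesis by simp
      qed
      then show ?thesis using S by (intro exI[of _ "S \<inter> G"] exI[of _ a]) auto
    qed

    define EW where "EW A B = {e \<in> E0. A \<le> pot (fst e) \<and> pot (fst e) \<le> B \<and> A \<le> pot (tgt e) \<and> pot (tgt e) \<le> B}" for A B
    \<comment> \<open>\<open>combination_height_le\<close> is applied to the height and to its
      negative, so a closed path in a slab involves only translates of \<open>w\<close> inside that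
      slab.\<close>
    have spanW: "\<exists>S a. finite S \<and> S \<subseteq> G \<and> (\<forall>h\<in>S. a h \<noteq> 0 \<and> A \<le> \<phi> h + lo \<and> \<phi> h + hi \<le> B) \<and>
        chain g v = (\<lambda>e. \<Sum>h\<in>S. a h * chain d w (shift (- h) e))"
      if gv: "edges g v \<subseteq> EW A B" "wval \<eta> v = 0" for g v A B
    proof -
      have E0: "edges g v \<subseteq> E0" using gv(1) by (auto simp: EW_def)
      obtain S a where S: "finite S" "S \<subseteq> G" "\<forall>h\<in>S. a h \<noteq> 0"
        and ch: "chain g v = (\<lambda>e. \<Sum>h\<in>S. a h * chain d w (shift (- h) e))"
        using span0[OF E0 gv(2)] by blast
      have supp: "e \<in> EW A B" if "(\<Sum>h\<in>S. a h * chain d w (shift (- h) e)) \<noteq> 0" for e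
        using that chain_nonzero_edges[of g v e] gv(1) unfolding ch by blast
      have fin_R: "finite R" by (simp add: R_def)
      have equiv: "pot (h + fst e) = \<phi> h + pot (fst e) \<and> pot (h + tgt e) = \<phi> h + pot (tgt e)"
        if "h \<in> G" "chain d w e \<noteq> 0" for h e
        using shift_pot[of h e] that R_iff by simp
      have "\<phi> h + hi \<le> B" if "h \<in> S" for h
        by (rule combination_height_le[where r = "chain d w" and pot = pot and et = e_hi and S = S and G = G and a = a])
           (use G G_up fin_R equiv R_ends R_iff e_hi S supp that in \<open>auto simp: EW_def\<close>)
      moreover have "- \<phi> h + - lo \<le> - A" if "h \<in> S" for h
        by (rule combination_height_le[where r = "chain d w" and pot = "\<lambda>v. - pot v" and
              \<phi> = "\<lambda>h. - \<phi> h" and et = e_lo and S = S and G = G and a = a])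
           (use G G_up fin_R equiv R_ends R_iff e_lo S supp that in \<open>auto simp: EW_def\<close>)
      ultimately have "\<forall>h\<in>S. a h \<noteq> 0 \<and> A \<le> \<phi> h + lo \<and> \<phi> h + hi \<le> B" using S by force
      with S ch show ?thesis by blast
    qed

    define m where "m = hi - lo"
    have m: "m \<ge> 0" using lohi[of 0] by (simp add: m_def)
    \<comment> \<open>A slab just as high as \<open>w\<close> has room only for translates by
      elements with one value of \<open>\<phi>\<close>, that is, for a coset of the kernel
      \<open>H1\<close>; hence the base point moves by some \<open>k\<close> in it. Such a
      \<open>k\<close> need not exist for every \<open>A\<close>, but a path violating flatness
      supplies one.\<close>
    have window: "flat (EW A (A + m)) lam" for A
    proof (rule ccontr)
      assume "\<not> ?thesis"
      then obtain g v where "edges g v \<subseteq> EW A (A + m)" "wval \<eta> v = 0" "wval lam v \<noteq> 0"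
        unfolding flat_def by blast
      then obtain g' u where gu: "scycle g' u" "edges g' u \<subseteq> EW A (A + m)" "wval lam u \<noteq> 0"
        using obtain_scycle by metis
      then have u: "u \<noteq> []" "wval \<eta> u = 0" by (auto simp: scycle_def)
      obtain S a where S: "finite S" "S \<subseteq> G" "\<forall>h\<in>S. a h \<noteq> 0 \<and> A \<le> \<phi> h + lo \<and> \<phi> h + hi \<le> A + m"
        and ch: "chain g' u = (\<lambda>e. \<Sum>h\<in>S. a h * chain d w (shift (- h) e))"
        using spanW[OF gu(2) u(2)] by blast
      have "edges g' u \<noteq> {}" using u by (cases u) auto
      then have "S \<noteq> {}" using chain_scycle_nonzero_iff[OF gu(1)] ch by fastforce
      then obtain k where k: "k \<in> S" by auto
      have kG: "k \<in> G" and k\<phi>: "\<phi> k + lo = A" using k S by (auto simp: m_def)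
      define H1 where "H1 = {h \<in> G. \<phi> h = 0}"
      have H1: "add_subgroup H1"
        unfolding add_subgroup_def H1_def using Gs \<phi>_0 \<phi>_add \<phi>_uminus by auto
      have H1_diff: "h - k \<in> H1" if "h \<in> G" "\<phi> h = \<phi> k" for h
        using that kG Gs \<phi>_add[of h "- k"] \<phi>_uminus[of k] by (simp add: H1_def)
      have "flat (orbit H1 (edges (k + d) w)) lam"
      proof (rule less.hyps)
        show "unique_products H1" by (rule unique_products_mono[OF G_up]) (auto simp: H1_def)
        show "scycle (k + d) w" using s by (simp add: scycle_shift)
        show "in_span H1 (chain (k + d) w) (chain g v)"
          if gv: "edges g v \<subseteq> orbit H1 (edges (k + d) w)" "wval \<eta> v = 0" for g v
        proof -
          have EWk: "edges g v \<subseteq> EW (\<phi> k + lo) (\<phi> k + hi)"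
          proof
            fix e assume "e \<in> edges g v"
            then obtain h f where hf: "h \<in> H1" "f \<in> R" "e = shift (h + k) f"
              using gv(1) by (auto simp: orbit_def edges_shift R_def)
            then have "h + k \<in> G" "\<phi> (h + k) = \<phi> k" using kG Gs(2) \<phi>_add by (auto simp: H1_def)
            then show "e \<in> EW (\<phi> k + lo) (\<phi> k + hi)"
              using shift_E0 shift_pot R_ends hf unfolding EW_def by auto
          qed
          obtain S' a' where S': "finite S'" "S' \<subseteq> G"
            "\<forall>h\<in>S'. a' h \<noteq> 0 \<and> \<phi> k + lo \<le> \<phi> h + lo \<and> \<phi> h + hi \<le> \<phi> k + hi"
            and ch': "chain g v = (\<lambda>e. \<Sum>h\<in>S'. a' h * chain d w (shift (- h) e))"
            using spanW[OF EWk gv(2)] by blast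
          have "\<phi> h = \<phi> k" if "h \<in> S'" for h using S'(3) that by force
          then have sub: "(\<lambda>h. h - k) ` S' \<subseteq> H1" using H1_diff S'(2) by auto
          have inj: "inj_on (\<lambda>h. h - k) S'" by (auto simp: inj_on_def)
          have "chain g v e = (\<Sum>x\<in>(\<lambda>h. h - k) ` S'. a' (x + k) * chain (k + d) w (shift (- x) e))" for e
            unfolding ch' sum.reindex[OF inj]
            by (simp add: chain_shift minus_diff_eq) (simp add: algebra_simps)
          then show ?thesis unfolding in_span_def
            using sub S' by (intro exI[of _ "(\<lambda>h. h - k) ` S'"] exI[of _ "\<lambda>x. a' (x + k)"]) auto
        qed
        \<comment> \<open>The pair lost is that of \<open>i\<close> and \<open>j\<close>, reduced
          modulo the length because the arc may pass the base point: \<open>\<phi> g0\<close> is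
          nonzero, while \<open>H1\<close> is the kernel.\<close>
        show "card {(p, q). p < length w \<and> q < length w \<and> vtx (k + d) w q - vtx (k + d) w p \<in> H1}
          < card {(p, q). p < length w \<and> q < length w \<and> vtx d w q - vtx d w p \<in> H}"
        proof (rule psubset_card_mono)
          show "finite {(p, q). p < length w \<and> q < length w \<and> vtx d w q - vtx d w p \<in> H}"
            by (rule finite_subset[of _ "{..<length w} \<times> {..<length w}"]) auto
          \<comment> \<open>Moving the base point by \<open>k\<close> conjugates differences of
            vertices by \<open>k\<close>, which does not affect \<open>\<phi>\<close>.\<close>
          have *: "vtx d w q - vtx d w p \<in> G \<and> \<phi> (vtx d w q - vtx d w p) = 0"
            if "vtx (k + d) w q - vtx (k + d) w p \<in> H1" for p q
          proof -
            define x where "x = vtx (k + d) w q - vtx (k + d) w p"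
            have x: "x \<in> G" "\<phi> x = 0" using that by (auto simp: x_def H1_def)
            have eq: "vtx d w q - vtx d w p = - k + (x + k)"
              by (simp add: x_def vtx_shift diff_conv_add_uminus minus_add add.assoc del: add_uminus_conv_diff)
            show ?thesis unfolding eq
              using x kG Gs \<phi>_add[of "- k" "x + k"] \<phi>_add[of x k] \<phi>_uminus[of k] by auto
          qed
          show "{(p, q). p < length w \<and> q < length w \<and> vtx (k + d) w q - vtx (k + d) w p \<in> H1}
            \<subset> {(p, q). p < length w \<and> q < length w \<and> vtx d w q - vtx d w p \<in> H}"
          proof (rule psubsetI)
            show "{(p, q). p < length w \<and> q < length w \<and> vtx (k + d) w q - vtx (k + d) w p \<in> H1}
              \<subseteq> {(p, q). p < length w \<and> q < length w \<and> vtx d w q - vtx d w p \<in> H}"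
              using * G_H by auto
            have "(i mod length w, j mod length w) \<in>
               {(p, q). p < length w \<and> q < length w \<and> vtx d w q - vtx d w p \<in> H}"
              using ij w by simp
            moreover have "(i mod length w, j mod length w) \<notin>
               {(p, q). p < length w \<and> q < length w \<and> vtx (k + d) w q - vtx (k + d) w p \<in> H1}"
              using *[of j i] g0_\<phi> by (auto simp: g0_def)
            ultimately show "{(p, q). p < length w \<and> q < length w \<and> vtx (k + d) w q - vtx (k + d) w p \<in> H1}
              \<noteq> {(p, q). p < length w \<and> q < length w \<and> vtx d w q - vtx d w p \<in> H}" by blast
          qed
        qed
      qed (use H1 lam in auto)
      moreover have "edges g' u \<subseteq> orbit H1 (edges (k + d) w)"
      proof
        fix e assume "e \<in> edges g' u"
        then have "chain g' u e \<noteq> 0" using chain_scycle_nonzero_iff[OF gu(1)] by blast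
        then obtain h where h: "h \<in> S" "chain d w (shift (- h) e) \<noteq> 0"
          unfolding ch by (metis (no_types, lifting) mult_zero_right sum.neutral)
        have "\<phi> h = \<phi> k" using S h k\<phi> by (force simp: m_def)
        then have "h - k \<in> H1" using H1_diff h S by blast
        moreover have "e = shift (h - k) (shift k (shift (- h) e))" by (simp add: add_diff_eq)
        moreover have "shift k (shift (- h) e) \<in> edges (k + d) w"
          using h R_iff unfolding edges_shift R_def by blast
        ultimately show "e \<in> orbit H1 (edges (k + d) w)" unfolding orbit_def by blast
      qed
      ultimately show False using gu u unfolding flat_def by blast
    qed

    \<comment> \<open>Slabs grow by one unit at a time. The new layer at height \<open>B\<close> is
      covered by a window of height \<open>m\<close>, since no edge and no translate of
      \<open>w\<close> spans more than \<open>m\<close>; the same bound provides the homological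
      hypothesis of \<open>flat_Un\<close>.\<close>
    have flatW: "flat (EW A B) lam" if "B - A \<le> int t" for A B t
      using that
    proof (induction t arbitrary: B)
      case 0
      then have "EW A B \<subseteq> EW A (A + m)" using m by (auto simp: EW_def)
      then show ?case using window flat_mono by blast
    next
      case (Suc t)
      have win: "flat (EW (B - m) B) lam" using window[of "B - m"] by simp
      show ?case
      proof (cases "B - A \<le> m")
        case True
        then have "EW A B \<subseteq> EW (B - m) B" by (auto simp: EW_def)
        then show ?thesis using win flat_mono by blast
      next
        case False
        have "EW A B \<subseteq> EW A (B - 1) \<union> EW (B - m) B"
        proof
          fix e assume e: "e \<in> EW A B"
          then have "e \<in> E0" by (simp add: EW_def)
          then obtain h f where hf: "h \<in> G" "f \<in> R" "e = shift h f" using E0_dest by blast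
          show "e \<in> EW A (B - 1) \<union> EW (B - m) B"
            using e shift_pot[OF hf(1,2)] R_ends[OF hf(2)] unfolding EW_def m_def hf(3) by auto
        qed
        moreover have "EW A (B - 1) \<union> EW (B - m) B \<subseteq> EW A B" using False m by (auto simp: EW_def)
        ultimately have EW_Un: "EW A B = EW A (B - 1) \<union> EW (B - m) B" by blast
        show ?thesis
          unfolding EW_Un
        proof (rule flat_Un[OF Suc.IH win])
          show "B - 1 - A \<le> int t" using Suc.prems by simp
          fix c' g v
          assume c1: "\<And>g v. edges g v \<subseteq> EW A (B - 1) \<Longrightarrow> wval \<eta> v = 0 \<Longrightarrow> wsum c' g v = 0"
            and c2: "\<And>g v. edges g v \<subseteq> EW (B - m) B \<Longrightarrow> wval \<eta> v = 0 \<Longrightarrow> wsum c' g v = 0"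
            and gv: "edges g v \<subseteq> EW A (B - 1) \<union> EW (B - m) B" "wval \<eta> v = 0"
          obtain S a where S: "finite S" "S \<subseteq> G" "\<forall>h\<in>S. a h \<noteq> 0 \<and> A \<le> \<phi> h + lo \<and> \<phi> h + hi \<le> B"
            and ch: "chain g v = (\<lambda>e. \<Sum>h\<in>S. a h * chain d w (shift (- h) e))"
            using spanW[OF gv[folded EW_Un]] by blast
          have "wsum c' (h + d) w = 0" if h: "h \<in> S" for h
          proof -
            have hG: "h \<in> G" using h S by auto
            have "edges (h + d) w \<subseteq> EW A (B - 1) \<or> edges (h + d) w \<subseteq> EW (B - m) B"
            proof (cases "\<phi> h + hi \<le> B - 1")
              case True
              then have "edges (h + d) w \<subseteq> EW A (B - 1)"
                using S(3) h shift_E0[OF hG] shift_pot[OF hG] R_ends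
                unfolding edges_shift R_def[symmetric] EW_def by (fastforce simp del: shift_simps tgt_shift)
              then show ?thesis ..
            next
              case False
              then have "\<phi> h + hi = B" using S(3) h by force
              then have "edges (h + d) w \<subseteq> EW (B - m) B"
                using shift_E0[OF hG] shift_pot[OF hG] R_ends
                unfolding edges_shift R_def[symmetric] EW_def m_def by (fastforce simp del: shift_simps tgt_shift)
              then show ?thesis ..
            qed
            then show ?thesis using c1 c2 w(2) by blast
          qed
          then show "wsum c' g v = 0"
            by (subst wsum_combination[OF S(1), of g v a d w]) (simp_all add: ch)
        qed
      qed
    qed

    have "wval lam v = 0" if gv: "edges g v \<subseteq> E" "wval \<eta> v = 0" for g v
    proof (cases v)
      case (Cons l v')
      obtain e where e: "e \<in> edges g v" "g = fst e \<or> g = tgt e" using edges_start[of v g] Cons by auto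
      then obtain h f where hf: "h \<in> H" "f \<in> R" "e = shift h f" using gv unfolding E_def orbit_def by blast
      \<comment> \<open>A path in another component of the orbit is translated into
        \<open>V0\<close>.\<close>
      then have V: "- h + g \<in> V0" using e R_ends[OF hf(2)] by (auto simp: add.assoc)
      have "edges (- h + g) v \<subseteq> E0"
        by (rule path_E0[OF V E_shift]) (use gv hf Hs in auto)
      define X where "X = insert 0 (pot ` (fst ` edges (- h + g) v \<union> tgt ` edges (- h + g) v))"
      have "finite X" by (simp add: X_def)
      then have bd: "Min X \<le> x \<and> x \<le> Max X" if "x \<in> X" for x using that by simp
      have "edges (- h + g) v \<subseteq> EW (Min X) (Max X)"
      proof
        fix e assume e: "e \<in> edges (- h + g) v"
        then have "pot (fst e) \<in> X" "pot (tgt e) \<in> X" by (auto simp: X_def)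
        then show "e \<in> EW (Min X) (Max X)"
          using bd e \<open>edges (- h + g) v \<subseteq> E0\<close> by (auto simp: EW_def)
      qed
      moreover have "flat (EW (Min X) (Max X)) lam" by (rule flatW[of _ _ "nat (Max X - Min X)"]) simp
      ultimately show ?thesis using gv(2) unfolding flat_def by blast
    qed simp
    then show ?thesis unfolding flat_def E_def R_def by blast
  qed
qed

end

section \<open>Right orders and simple generators\<close>

lemma finite_total_has_least:
  assumes "finite S" "S \<noteq> {}"
    and "\<And>x y. x \<in> S \<Longrightarrow> y \<in> S \<Longrightarrow> leq x y \<or> leq y x"
    and "\<And>x y z. x \<in> S \<Longrightarrow> y \<in> S \<Longrightarrow> z \<in> S \<Longrightarrow> leq x y \<Longrightarrow> leq y z \<Longrightarrow> leq x z"
  shows "\<exists>m\<in>S. \<forall>x\<in>S. leq m x"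
  using assms
proof (induction S rule: finite_ne_induct)
  case (insert a S)
  then obtain m where m: "m \<in> S" "\<forall>x\<in>S. leq m x" by blast
  have refl: "leq a a" using insert.prems(1)[of a a] by blast
  show ?case
  proof (cases "leq a m")
    case True
    then have "\<forall>x\<in>S. leq a x" using insert.prems(2)[of a m] m by blast
    with refl show ?thesis by blast
  next
    case False
    then have "leq m a" using insert.prems(1)[of a m] m by blast
    with m show ?thesis by blast
  qed
qed blast

definition right_order_on :: "'g::group_add set \<Rightarrow> ('g \<Rightarrow> 'g \<Rightarrow> bool) \<Rightarrow> bool" where
  "right_order_on H leq \<longleftrightarrow>
     (\<forall>x\<in>H. \<forall>y\<in>H. leq x y \<or> leq y x) \<and>
     (\<forall>x\<in>H. \<forall>y\<in>H. leq x y \<longrightarrow> leq y x \<longrightarrow> x = y) \<and>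
     (\<forall>x\<in>H. \<forall>y\<in>H. \<forall>z\<in>H. leq x y \<longrightarrow> leq y z \<longrightarrow> leq x z) \<and>
     (\<forall>x\<in>H. \<forall>y\<in>H. \<forall>z\<in>H. leq x y \<longrightarrow> leq (x + z) (y + z))"

lemma right_order_onD:
  assumes "right_order_on H leq"
  shows "x \<in> H \<Longrightarrow> y \<in> H \<Longrightarrow> leq x y \<or> leq y x"
    and "x \<in> H \<Longrightarrow> y \<in> H \<Longrightarrow> leq x y \<Longrightarrow> leq y x \<Longrightarrow> x = y"
    and "x \<in> H \<Longrightarrow> y \<in> H \<Longrightarrow> z \<in> H \<Longrightarrow> leq x y \<Longrightarrow> leq y z \<Longrightarrow> leq x z"
    and "x \<in> H \<Longrightarrow> y \<in> H \<Longrightarrow> z \<in> H \<Longrightarrow> leq x y \<Longrightarrow> leq (x + z) (y + z)"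
  by (rule assms[unfolded right_order_on_def, THEN conjunct1, rule_format]
      assms[unfolded right_order_on_def, THEN conjunct2, THEN conjunct1, rule_format]
      assms[unfolded right_order_on_def, THEN conjunct2, THEN conjunct2, THEN conjunct1, rule_format]
      assms[unfolded right_order_on_def, THEN conjunct2, THEN conjunct2, THEN conjunct2, rule_format];
    assumption)+

text \<open>Mirrors extremal arguments: greatest elements come from least ones, and
  \<open>generator_is_scycle\<close> obtains its second bound this way.\<close>

lemma right_order_on_converse:
  assumes "right_order_on H leq"
  shows "right_order_on H (\<lambda>x y. leq y x)"
  unfolding right_order_on_def
proof (intro conjI ballI impI)
  note D = right_order_onD[OF assms]
  show "leq y x \<or> leq x y" if "x \<in> H" "y \<in> H" for x y using D(1)[OF that] by blast
  show "x = y" if "x \<in> H" "y \<in> H" "leq y x" "leq x y" for x y using D(2)[OF that(1,2,4,3)] .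
  show "leq z x" if "x \<in> H" "y \<in> H" "z \<in> H" "leq y x" "leq z y" for x y z
    using D(3)[OF that(3,2,1,5,4)] .
  show "leq (y + z) (x + z)" if "x \<in> H" "y \<in> H" "z \<in> H" "leq y x" for x y z
    using D(4)[OF that(2,1,3,4)] .
qed

lemma right_order_on_least:
  assumes "right_order_on H leq" "finite S" "S \<noteq> {}" "S \<subseteq> H"
  shows "\<exists>m\<in>S. \<forall>x\<in>S. leq m x"
proof (rule finite_total_has_least)
  show "leq x y \<or> leq y x" if "x \<in> S" "y \<in> S" for x y
    using that assms(4) right_order_onD(1)[OF assms(1)] by blast
  show "leq x z" if "x \<in> S" "y \<in> S" "z \<in> S" "leq x y" "leq y z" for x y z
    using that(4,5) assms(4) that(1-3) by (auto intro: right_order_onD(3)[OF assms(1), of x y z])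
qed fact+

lemma right_order_on_greatest:
  assumes "right_order_on H leq" "finite S" "S \<noteq> {}" "S \<subseteq> H"
  shows "\<exists>m\<in>S. \<forall>x\<in>S. leq x m"
  using right_order_on_least[OF right_order_on_converse[OF assms(1)] assms(2-4)] .

lemma right_order_translate:
  assumes "add_subgroup H" "right_order_on H leq" "x \<in> H" "y \<in> H" "z \<in> H" "leq (x + z) (y + z)"
  shows "leq x y"
proof -
  have "leq (x + z + - z) (y + z + - z)"
    by (rule right_order_onD(4)[OF assms(2)]) (use assms add_subgroupD[OF assms(1)] in simp_all)
  then show ?thesis by simp
qed

text \<open>
  Right invariance makes the choice of \<open>s\<close> independent of the set in which \<open>t\<close> is greatest.
\<close>

lemma right_order_unique_product:
  assumes H: "add_subgroup H" "right_order_on H leq"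
    and s: "s \<in> H" "h \<in> H" "leq (- s) (- h)" and t: "t \<in> H" "t' \<in> H" "leq t' t" and eq: "h + t' = s + t"
  shows "h = s"
proof -
  note Hs = add_subgroupD[OF H(1)]
  have "t' = - h + s + t" using eq by (metis add.assoc minus_add_cancel)
  then have "leq (- h + s + t) (0 + t)" using t by simp
  then have "leq (- h + s) 0"
    by (rule right_order_translate[OF H, rotated 3]) (use Hs s t in simp_all)
  then have "leq (- h + s + - s) (0 + - s)"
    by (rule right_order_onD(4)[OF H(2), rotated 3]) (use Hs s in simp_all)
  then have "leq (- h) (- s)" by (simp add: add.assoc)
  then have "- h = - s" using right_order_onD(2)[OF H(2), of "- h" "- s"] s Hs by simp
  then show ?thesis by simp
qed

text \<open>Order and translation agree on the right only, so the left factor is chosen through its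
  inverse: \<open>- s\<close> is least among the negatives of \<open>S\<close>. With
  \<open>t\<close> greatest, \<open>s' + t' = s + t\<close> then bounds \<open>- s' + s\<close> by
  0.\<close>

lemma unique_products_right_order:
  assumes H: "add_subgroup H" "right_order_on H leq"
  shows "unique_products H"
  unfolding unique_products_def
proof (intro allI impI)
  note Hs = add_subgroupD[OF H(1)]
  fix S T :: "'a set"
  assume ST: "finite S" "finite T" "S \<noteq> {}" "T \<noteq> {}" "S \<subseteq> H" "T \<subseteq> H"
  obtain s where s: "s \<in> S" "\<forall>h\<in>S. leq (- s) (- h)"
    using right_order_on_least[OF H(2), of "uminus ` S"] ST Hs(3) by auto
  obtain t where t: "t \<in> T" "\<forall>t'\<in>T. leq t' t"
    using right_order_on_greatest[OF H(2), of T] ST by auto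
  have "\<forall>s'\<in>S. \<forall>t'\<in>T. s' + t' = s + t \<longrightarrow> s' = s"
  proof (intro ballI impI)
    fix s' t' assume "s' \<in> S" "t' \<in> T" "s' + t' = s + t"
    then show "s' = s" using s t ST by (intro right_order_unique_product[OF H, of s s' t t']) auto
  qed
  then show "\<exists>s\<in>S. \<exists>t\<in>T. \<forall>s'\<in>S. \<forall>t'\<in>T. s' + t' = s + t \<longrightarrow> s' = s" using s t by blast
qed

context cayley_graph
begin

section \<open>Closure properties of spans\<close>

lemma in_spanI:
  assumes "finite S" "S \<subseteq> H" "\<And>e. z' e = (\<Sum>h\<in>S. a h * z (shift (- h) e))"
  shows "in_span H z z'"
proof -
  have "z' e = (\<Sum>h\<in>{h \<in> S. a h \<noteq> 0}. a h * z (shift (- h) e))" for e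
    unfolding assms(3) using assms(1) by (intro sum.mono_neutral_right) auto
  then show ?thesis unfolding in_span_def using assms
    by (intro exI[of _ "{h \<in> S. a h \<noteq> 0}"] exI[of _ a]) auto
qed

lemma in_span_zero: "in_span H z (\<lambda>e. 0)"
  by (rule in_spanI[of "{}"]) auto

lemma in_span_self: "0 \<in> H \<Longrightarrow> in_span H z z"
  by (rule in_spanI[of "{0}" _ _ "\<lambda>_. 1"]) auto

lemma in_span_mult: "in_span H z z' \<Longrightarrow> in_span H z (\<lambda>e. k * z' e)"
proof -
  assume "in_span H z z'"
  then obtain S a where "finite S" "S \<subseteq> H" "z' = (\<lambda>e. \<Sum>h\<in>S. a h * z (shift (- h) e))"
    unfolding in_span_def by blast
  then show ?thesis by (intro in_spanI[of S _ _ "\<lambda>h. k * a h"]) (auto simp: sum_distrib_left mult.assoc)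
qed

lemma in_span_uminus: "in_span H z z' \<Longrightarrow> in_span H z (\<lambda>e. - z' e)"
  using in_span_mult[of H z z' "-1"] by simp

lemma in_span_add:
  assumes "in_span H z z1" "in_span H z z2"
  shows "in_span H z (\<lambda>e. z1 e + z2 e)"
proof -
  obtain S a where S: "finite S" "S \<subseteq> H" "z1 = (\<lambda>e. \<Sum>h\<in>S. a h * z (shift (- h) e))"
    using assms(1) unfolding in_span_def by blast
  obtain T b where T: "finite T" "T \<subseteq> H" "z2 = (\<lambda>e. \<Sum>h\<in>T. b h * z (shift (- h) e))"
    using assms(2) unfolding in_span_def by blast
  define a' where "a' h = (if h \<in> S then a h else 0)" for h
  define b' where "b' h = (if h \<in> T then b h else 0)" for h
  have "z1 e = (\<Sum>h\<in>S \<union> T. a' h * z (shift (- h) e))" for e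
    unfolding S(3) by (rule sum.mono_neutral_cong_left) (use S T in \<open>auto simp: a'_def\<close>)
  moreover have "z2 e = (\<Sum>h\<in>S \<union> T. b' h * z (shift (- h) e))" for e
    unfolding T(3) by (rule sum.mono_neutral_cong_left) (use S T in \<open>auto simp: b'_def\<close>)
  ultimately have "z1 e + z2 e = (\<Sum>h\<in>S \<union> T. (a' h + b' h) * z (shift (- h) e))" for e
    by (simp add: sum.distrib distrib_right)
  then show ?thesis using S T by (intro in_spanI[of "S \<union> T"]) auto
qed

lemma in_span_shift:
  assumes "add_subgroup H" "k \<in> H" "in_span H z z'"
  shows "in_span H z (\<lambda>e. z' (shift (- k) e))"
proof -
  obtain S a where S: "finite S" "S \<subseteq> H" "z' = (\<lambda>e. \<Sum>h\<in>S. a h * z (shift (- h) e))"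
    using assms(3) unfolding in_span_def by blast
  have "z' (shift (- k) e) = (\<Sum>h\<in>(+) k ` S. a (- k + h) * z (shift (- h) e))" for e
    unfolding S(3) by (subst sum.reindex) (auto simp: minus_add add.assoc[symmetric])
  then show ?thesis using S assms(2) add_subgroupD(2)[OF assms(1)]
    by (intro in_spanI[of "(+) k ` S"]) auto
qed

text \<open>
  Following the flow \<open>z\<close> along edges in the direction of its sign never gets stuck, so it closes up.
\<close>

lemma exists_scycle_in_support:
  fixes z :: "'g \<times> 'x \<Rightarrow> int"
  assumes fin: "finite {e. z e \<noteq> 0}" and e1: "z e1 \<noteq> 0"
    and cycle: "\<And>v. (\<Sum>e\<in>{e. z e \<noteq> 0}. z e * (of_bool (tgt e = v) - of_bool (fst e = v))) = 0"
  obtains g w where "scycle g w" "edges g w \<subseteq> {e. z e \<noteq> 0}"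
proof -
  \<comment> \<open>The letter \<open>l\<close>, read at \<open>g\<close>, follows an edge of the
    support in the direction of the flow.\<close>
  define Pos where "Pos g l \<longleftrightarrow> z (edge g l) \<noteq> 0 \<and> (snd l \<longleftrightarrow> z (edge g l) > 0)" for g l
  define flow where "flow g w \<longleftrightarrow> (\<forall>i<length w. Pos (g + wval \<eta> (take i w)) (w ! i))" for g w
  have next_step: "\<exists>l'. Pos (g + lval \<eta> l) l'" if l: "Pos g l" for g l
  proof (rule ccontr)
    define v where "v = g + lval \<eta> l"
    assume "\<not> ?thesis"
    then have no: "\<not> Pos v l'" for l' unfolding v_def by blast
    \<comment> \<open>If the flow is stuck at \<open>v\<close>, all support edges at
      \<open>v\<close> point into it, and the net flow into \<open>v\<close> is positive although
      \<open>z\<close> is a cycle.\<close>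
    have out: "z e < 0" if "z e \<noteq> 0" "fst e = v" for e
    proof -
      have "edge v (snd e, True) = e" using that by (simp add: edge_def prod_eq_iff)
      then show ?thesis using no[of "(snd e, True)"] that by (simp add: Pos_def)
    qed
    have "into": "z e > 0" if "z e \<noteq> 0" "tgt e = v" for e
    proof -
      have "edge v (snd e, False) = e" using that by (auto simp: edge_def prod_eq_iff tgt_def)
      then show ?thesis using no[of "(snd e, False)"] that by (simp add: Pos_def)
    qed
    have "(\<Sum>e\<in>{e. z e \<noteq> 0}. z e * (of_bool (tgt e = v) - of_bool (fst e = v))) > 0"
    proof (rule sum_pos2[OF fin, of "edge g l"])
      show "edge g l \<in> {e. z e \<noteq> 0}" using l by (simp add: Pos_def)
      have ne: "z (edge g l) \<noteq> 0" and sgn: "snd l \<longleftrightarrow> z (edge g l) > 0" using l by (simp_all add: Pos_def)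
      show "0 < z (edge g l) * (of_bool (tgt (edge g l) = v) - of_bool (fst (edge g l) = v))"
      proof (cases "snd l")
        case True
        then have "tgt (edge g l) = v" "fst (edge g l) \<noteq> v"
          using edge_ends(2)[of g l] out[OF ne] sgn by (auto simp: v_def)
        then show ?thesis using sgn True by simp
      next
        case False
        then have "fst (edge g l) = v" "tgt (edge g l) \<noteq> v"
          using edge_ends(1)[of g l] "into"[OF ne] sgn by (auto simp: v_def)
        then show ?thesis using sgn False ne by simp
      qed
      show "0 \<le> z e * (of_bool (tgt e = v) - of_bool (fst e = v))" if "e \<in> {e. z e \<noteq> 0}" for e
        using out[of e] "into"[of e] that by (auto simp: of_bool_def)
    qed
    then show False using cycle by simp
  qed
  have flow_snoc: "flow g (w @ [l]) \<longleftrightarrow> flow g w \<and> Pos (g + wval \<eta> w) l" for g w l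
    unfolding flow_def by (auto simp: less_Suc_eq nth_append)
  have flow_edges: "edges g w \<subseteq> {e. z e \<noteq> 0}" if "flow g w" for g w
    using that unfolding edges_nth flow_def Pos_def by auto
  obtain g0 l0 where l0: "Pos g0 l0"
  proof (cases "z e1 > 0")
    case True
    then show thesis using that[of "fst e1" "(snd e1, True)"] by (simp add: Pos_def edge_def)
  next
    case False
    have "edge (tgt e1) (snd e1, False) = e1" by (simp add: edge_def prod_eq_iff tgt_def)
    then show thesis using that[of "tgt e1" "(snd e1, False)"] False e1 by (simp add: Pos_def)
  qed
  have long: "\<exists>w. length w = Suc n \<and> flow g0 w" for n
  proof (induction n)
    case 0
    show ?case using l0 by (intro exI[of _ "[l0]"]) (simp add: flow_def)
  next
    case (Suc n)
    then obtain w where w: "length w = Suc n" "flow g0 w" by blast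
    obtain u l where ul: "w = u @ [l]" using w by (cases w rule: rev_cases) auto
    then obtain l' where "Pos (g0 + wval \<eta> u + lval \<eta> l) l'" using w(2) flow_snoc next_step by blast
    then have "flow g0 (w @ [l'])" using w(2) unfolding flow_snoc by (simp add: ul add.assoc)
    then show ?case using w(1) by (intro exI[of _ "w @ [l']"]) simp
  qed
  define Vs where "Vs = fst ` {e. z e \<noteq> 0}  \<union> tgt ` {e. z e \<noteq> 0}"
  have fin_V: "finite Vs" using fin by (simp add: Vs_def)
  obtain w where w: "length w = Suc (card Vs)" "flow g0 w" using long by blast
  define v where "v i = g0 + wval \<eta> (take i w)" for i
  have "v i \<in> Vs" if "i < length w" for i
  proof -
    have "z (edge (v i) (w ! i)) \<noteq> 0" using w(2) that unfolding flow_def Pos_def v_def by blast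
    then show ?thesis using edge_ends[of "v i" "w ! i"] unfolding Vs_def
      by (cases "snd (w ! i)") (force intro: image_eqI[of _ _ "edge (v i) (w ! i)"])+
  qed
  then have "v ` {..<length w} \<subseteq> Vs" by auto
  then have "card (v ` {..<length w}) < card {..<length w}"
    using card_mono[OF fin_V] w(1) by (metis card_lessThan le_imp_less_Suc)
  then have "\<not> inj_on v {..<length w}" by (rule pigeonhole)
  then obtain i j where ij: "i < j" "j < length w" "v i = v j"
    unfolding inj_on_def by (metis lessThan_iff nat_neq_iff)
  \<comment> \<open>Minimality is taken among closed flows rather than all closed paths: a backtrack
    would follow its edge against the sign of \<open>z\<close>, so it cannot occur.\<close>
  define P where "P n \<longleftrightarrow> (\<exists>g u. length u = n \<and> u \<noteq> [] \<and> wval \<eta> u = 0 \<and> flow g u)" for n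
  have flow_sub: "flow (g + wval \<eta> (take i u)) (take k (drop i u))" if f: "flow g u" for g u i k
    unfolding flow_def
  proof (intro allI impI)
    fix m assume m: "m < length (take k (drop i u))"
    then have im: "i + m < length u" by auto
    then have "Pos (g + wval \<eta> (take (i + m) u)) (u ! (i + m))"
      using f[unfolded flow_def, rule_format, of "i + m"] by simp
    moreover have "take (i + m) u = take i u @ take m (take k (drop i u))"
      using m by (simp add: take_add min_absorb1)
    ultimately show "Pos (g + wval \<eta> (take i u) + wval \<eta> (take m (take k (drop i u)))) (take k (drop i u) ! m)"
      using m im by (simp add: add.assoc)
  qed
  have closed_sub: "wval \<eta> (take (j - i) (drop i u)) = 0"
    if "i < j" "wval \<eta> (take i u) = wval \<eta> (take j u)" for u i j
  proof -
    have "take j u = take i u @ take (j - i) (drop i u)" using that(1) by (simp flip: take_add)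
    then have "wval \<eta> (take i u) + wval \<eta> (take (j - i) (drop i u)) = wval \<eta> (take i u) + 0"
      using that(2) by simp
    then show ?thesis by (simp only: add_left_cancel)
  qed
  have "P (j - i)"
    unfolding P_def using ij flow_sub[OF w(2), of i "j - i"] closed_sub[of i j w]
    by (intro exI[of _ "v i"] exI[of _ "take (j - i) (drop i w)"]) (auto simp: v_def)
  define n where "n = (LEAST n. P n)"
  have "P n" unfolding n_def using \<open>P (j - i)\<close> by (rule LeastI)
  then obtain g u where u: "length u = n" "u \<noteq> []" "wval \<eta> u = 0" "flow g u" unfolding P_def by blast
  have "wval \<eta> (take p u) \<noteq> wval \<eta> (take q u)" if pq: "p < q" "q < length u" for p q
  proof
    assume "wval \<eta> (take p u) = wval \<eta> (take q u)"
    then have "P (q - p)" unfolding P_def using pq flow_sub[OF u(4), of p "q - p"] closed_sub[of p q u]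
      by (intro exI[of _ "g + wval \<eta> (take p u)"] exI[of _ "take (q - p) (drop p u)"]) auto
    then show False using not_less_Least[of "q - p" P, folded n_def] pq u(1) by simp
  qed
  moreover have "u \<noteq> [l, letter_inv l]" for l
  proof
    assume ul: "u = [l, letter_inv l]"
    then have "Pos g l" "Pos (g + lval \<eta> l) (letter_inv l)"
      using u(4) unfolding flow_def by (auto dest: spec[of _ 0] spec[of _ 1])
    then show False unfolding Pos_def edge_inv by (auto simp: letter_inv_def)
  qed
  ultimately have "scycle g u" using u unfolding scycle_def by blast
  then show thesis using that flow_edges[OF u(4)] by blast
qed

text \<open>The sum is the integral over the path of the coboundary of the indicator of
  \<open>v\<close>, which telescopes.\<close>

lemma chain_is_cycle:
  assumes "wval \<eta> w = 0"
  shows "(\<Sum>e\<in>{e. chain g w e \<noteq> 0}. chain g w e * (of_bool (tgt e = v) - of_bool (fst e = v))) = 0"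
proof -
  have "(\<Sum>e\<in>{e. chain g w e \<noteq> 0}. chain g w e * (of_bool (tgt e = v) - of_bool (fst e = v))) =
    (\<Sum>e\<in>edges g w. chain g w e * (of_bool (tgt e = v) - of_bool (fst e = v)))"
    by (rule sum.mono_neutral_left) (auto dest: chain_nonzero_edges)
  also have "\<dots> = wsum (\<lambda>e. of_bool (tgt e = v) - of_bool (fst e = v)) g w"
    by (rule wsum_eq_sum_chain[symmetric]) auto
  also have "\<dots> = of_bool (g + wval \<eta> w = v) - of_bool (g = v)"
    by (rule wsum_coboundary[where k = "\<lambda>u. of_bool (u = v)"]) simp
  finally show ?thesis using assms by simp
qed

text \<open>
  The translate with smallest \<open>- h\<close> exposes its greatest edge in every orbit at once; if the
  combination stays within the support of \<open>z\<close>, this bounds all translates.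
\<close>

lemma span_support_bound:
  fixes z :: "'g \<times> 'x \<Rightarrow> int"
  assumes H: "add_subgroup H" "right_order_on H leq"
    and fin: "finite {e. z e \<noteq> 0}" and sub: "\<And>e. z e \<noteq> 0 \<Longrightarrow> fst e \<in> H" and e1: "z e1 \<noteq> 0"
    and S: "finite S" "S \<subseteq> H" "\<And>h. h \<in> S \<Longrightarrow> a h \<noteq> 0"
    and supp: "\<And>e. (\<Sum>h\<in>S. a h * z (shift (- h) e)) \<noteq> 0 \<Longrightarrow> z e \<noteq> 0"
    and h: "h \<in> S"
  shows "leq 0 (- h)"
proof -
  note Hs = add_subgroupD[OF H(1)]
  \<comment> \<open>Within the orbit of \<open>e1\<close>, edges are identified with the group
    elements at which the label \<open>snd e1\<close> occurs in the support.\<close>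
  define T where "T = {k. z (k, snd e1) \<noteq> 0}"
  have "T \<subseteq> fst ` {e. z e \<noteq> 0}" unfolding T_def by force
  then have T: "finite T" "T \<subseteq> H" using fin sub by (auto intro: finite_subset)
  have "fst e1 \<in> T" using e1 by (simp add: T_def)
  then obtain t where t: "t \<in> T" "\<forall>k\<in>T. leq k t" using right_order_on_greatest[OF H(2) T(1) _ T(2)] by auto
  obtain s where s: "s \<in> S" "\<forall>k\<in>S. leq (- s) (- k)"
    using right_order_on_least[OF H(2), of "uminus ` S"] S h Hs(3) by auto
  define e where "e = (s + t, snd e1)"
  have zero: "z (shift (- k) e) = 0" if k: "k \<in> S - {s}" for k
  proof (rule ccontr)
    assume "z (shift (- k) e) \<noteq> 0"
    then have "- k + (s + t) \<in> T" by (simp add: T_def e_def shift_def)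
    moreover have "s \<in> H" "k \<in> H" "t \<in> H" using s t S T k by auto
    ultimately have "k = s"
      using right_order_unique_product[OF H, of s k t "- k + (s + t)"] s t T k by auto
    then show False using k by simp
  qed
  have "(\<Sum>k\<in>S. a k * z (shift (- k) e)) = a s * z (shift (- s) e)"
    by (subst sum.remove[OF S(1) s(1)]) (simp add: zero)
  also have "\<dots> \<noteq> 0" using S(3) s(1) t(1) by (simp add: T_def e_def shift_def)
  finally have "z e \<noteq> 0" by (rule supp)
  then have "s + t \<in> T" by (simp add: T_def e_def)
  \<comment> \<open>The exposed edge lies in the support, so it is at most the greatest edge
    \<open>t\<close> of its orbit; cancelling \<open>t\<close> on the right compares
    \<open>s\<close> with 0.\<close>
  then have "leq (s + t) (0 + t)" using t by simp
  then have "leq s 0"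
    by (rule right_order_translate[OF H, rotated 3]) (use Hs s S t T in auto)
  then have "leq (s + - s) (0 + - s)"
    by (rule right_order_onD(4)[OF H(2), rotated 3]) (use Hs s(1) S(2) in auto)
  then have "leq 0 (- s)" by simp
  moreover have "0 \<in> H" "- s \<in> H" "- h \<in> H" "leq (- s) (- h)" using s h S(2) Hs by auto
  ultimately show ?thesis using right_order_onD(3)[OF H(2), of 0 "- s" "- h"] by blast
qed

text \<open>A simple cycle inside the support is a combination of translates of \<open>z\<close>.
  \<open>span_support_bound\<close>, for the order and for its converse, leaves only the translate
  by 0, and the coefficients 1 and -1 of the cycle force the remaining factor to be a unit.\<close>

theorem generator_is_scycle:
  assumes H: "add_subgroup H" "right_order_on H leq"
    and z: "z = chain 0 r" "wval \<eta> r = 0" "z e1 \<noteq> 0"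
    and sub: "\<And>e. z e \<noteq> 0 \<Longrightarrow> fst e \<in> H"
    and span: "\<And>g w. edges g w \<subseteq> {e. z e \<noteq> 0} \<Longrightarrow> wval \<eta> w = 0 \<Longrightarrow> in_span H z (chain g w)"
  obtains g w k where "scycle g w" "edges g w \<subseteq> {e. z e \<noteq> 0}" "\<And>e. chain g w e = k * z e" "k = 1 \<or> k = -1"
proof -
  have fin: "finite {e. z e \<noteq> 0}" unfolding z by (rule finite_chain)
  obtain g w where w: "scycle g w" "edges g w \<subseteq> {e. z e \<noteq> 0}"
    using exists_scycle_in_support[OF fin z(3)] chain_is_cycle[OF z(2)] unfolding z(1) by metis
  then have w': "w \<noteq> []" "wval \<eta> w = 0" by (auto simp: scycle_def)
  have "in_span H z (chain g w)" by (rule span[OF w(2) w'(2)])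
  then obtain S a where S: "finite S" "S \<subseteq> H" "\<forall>h\<in>S. a h \<noteq> 0"
    and ch: "chain g w = (\<lambda>e. \<Sum>h\<in>S. a h * z (shift (- h) e))"
    unfolding in_span_def by blast
  have supp: "z e \<noteq> 0" if "(\<Sum>h\<in>S. a h * z (shift (- h) e)) \<noteq> 0" for e
    using that w(2) chain_nonzero_edges[of g w e] unfolding ch by blast
  have "h = 0" if h: "h \<in> S" for h
  proof -
    have "leq 0 (- h)"
      by (rule span_support_bound[OF H fin sub z(3) S(1,2) _ supp h]) (use S in auto)
    moreover have "leq (- h) 0"
      by (rule span_support_bound[OF H(1) right_order_on_converse[OF H(2)] fin sub z(3) S(1,2) _ supp h])
         (use S in auto)
    ultimately have "- h = 0"
      using right_order_onD(2)[OF H(2), of "- h" 0] add_subgroupD[OF H(1)] h S(2) by blast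
    then show ?thesis by simp
  qed
  then have "S \<subseteq> {0}" by blast
  then have "S = {} \<or> S = {0}" by (rule subset_singletonD)
  have "edges g w \<noteq> {}" using w' by (cases w) auto
  then obtain e where e: "e \<in> edges g w" by blast
  then have "S \<noteq> {}" using chain_scycle_nonzero_iff[OF w(1), of e] ch by auto
  then have "S = {0}" using \<open>S = {} \<or> S = {0}\<close> by blast
  then have k: "chain g w e = a 0 * z e" for e unfolding ch by simp
  have "\<bar>a 0\<bar> * \<bar>z e\<bar> = 1" using chain_scycle_abs[OF w(1) e] by (simp add: k abs_mult)
  then have "\<bar>a 0\<bar> = 1" by (metis abs_1 abs_abs abs_eq_iff zmult_eq_1_iff)
  then have "a 0 = 1 \<or> a 0 = -1" by linarith
  with w k that show thesis by blast
qed

end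

section \<open>Relation modules and chains\<close>

lemma eq_add_self_iff: "a = a + a \<longleftrightarrow> a = (0 :: 'a::group_add)"
  using add_left_cancel[of a 0 a] by simp

section \<open>Permutation groups and regular representations\<close>

typedef 'b bijection = "{f :: 'b \<Rightarrow> 'b. bij f}"
  morphisms app_bij Abs_bij
  by (rule exI[of _ id]) simp

instantiation bijection :: (type) group_add
begin

definition "0 = Abs_bij id"
definition "f + g = Abs_bij (app_bij f \<circ> app_bij g)"
definition "- f = Abs_bij (inv_into UNIV (app_bij f))"
definition "f - g = f + - (g :: 'a bijection)"

lemma bij_app_bij: "bij (app_bij f)"
  using app_bij by blast

lemma app_bij_simps:
  "app_bij 0 = id" "app_bij (f + g) = app_bij f \<circ> app_bij g" "app_bij (- f) = inv_into UNIV (app_bij f)"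
  by (simp_all add: zero_bijection_def plus_bijection_def uminus_bijection_def Abs_bij_inverse
      bij_app_bij bij_comp bij_imp_bij_inv)

instance
proof
  fix a b c :: "'a bijection"
  show "a + b + c = a + (b + c)" "0 + a = a" "a + 0 = a"
    by (simp_all add: app_bij_inject[symmetric] app_bij_simps o_assoc)
  show "- a + a = 0"
    by (simp add: app_bij_inject[symmetric] app_bij_simps bij_app_bij bij_is_inj)
  show "a + - b = a - b" by (simp add: minus_bijection_def)
qed

end

text \<open>
  The regular representation: it turns groups with an explicit carrier into subgroups of a type of
  class \<^class>\<open>group_add\<close>.
\<close>

definition regular_rep :: "('b, 'm) monoid_scheme \<Rightarrow> 'b \<Rightarrow> 'b bijection" where
  "regular_rep G g = Abs_bij (\<lambda>y. if y \<in> carrier G then g \<otimes>\<^bsub>G\<^esub> y else y)"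

context group
begin

text \<open>Fixing the elements outside the carrier makes the translation a bijection of the whole
  type, inverted by translation with \<open>inv g\<close>.\<close>

lemma app_regular_rep:
  assumes "g \<in> carrier G"
  shows "app_bij (regular_rep G g) = (\<lambda>y. if y \<in> carrier G then g \<otimes> y else y)"
proof -
  have "bij (\<lambda>y. if y \<in> carrier G then g \<otimes> y else y)"
  proof (rule o_bij[of "\<lambda>y. if y \<in> carrier G then inv g \<otimes> y else y"])
    show "(\<lambda>y. if y \<in> carrier G then inv g \<otimes> y else y) \<circ> (\<lambda>y. if y \<in> carrier G then g \<otimes> y else y) = id"
      using assms by (auto simp: fun_eq_iff m_assoc[symmetric])
    show "(\<lambda>y. if y \<in> carrier G then g \<otimes> y else y) \<circ> (\<lambda>y. if y \<in> carrier G then inv g \<otimes> y else y) = id"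
      using assms by (auto simp: fun_eq_iff m_assoc[symmetric])
  qed
  then show ?thesis by (simp add: regular_rep_def Abs_bij_inverse)
qed

lemma regular_rep_mult:
  assumes "g \<in> carrier G" "h \<in> carrier G"
  shows "regular_rep G (g \<otimes> h) = regular_rep G g + regular_rep G h"
  using assms
  by (auto simp: app_bij_inject[symmetric] app_bij_simps app_regular_rep fun_eq_iff m_assoc)

lemma regular_rep_inj: "inj_on (regular_rep G) (carrier G)"
proof (rule inj_onI)
  fix g h assume gh: "g \<in> carrier G" "h \<in> carrier G" "regular_rep G g = regular_rep G h"
  then have "app_bij (regular_rep G g) \<one> = app_bij (regular_rep G h) \<one>" by simp
  then show "g = h" using gh(1,2) by (simp add: app_regular_rep)
qed

end

text \<open>For normal \<open>N\<close>, a homomorphism on \<open>F\<close> with kernel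
  \<open>N\<close> and values in a type of class \<open>group_add\<close>. It is used for
  \<open>N\<close> itself, giving the vertices of the graph, and for the normal closure of the
  relator, giving the labels.\<close>

definition quot_rep :: "('b, 'm) monoid_scheme \<Rightarrow> 'b set \<Rightarrow> 'b \<Rightarrow> 'b set bijection" where
  "quot_rep F N f = regular_rep (F Mod N) (N #>\<^bsub>F\<^esub> f)"

context normal
begin

lemma coset_carrier: "f \<in> carrier G \<Longrightarrow> H #> f \<in> carrier (G Mod H)"
  by (auto simp: FactGroup_def RCOSETS_def)

lemma quot_rep_mult:
  assumes "f \<in> carrier G" "f' \<in> carrier G"
  shows "quot_rep G H (f \<otimes> f') = quot_rep G H f + quot_rep G H f'"
proof -
  interpret Q: group "G Mod H" by (rule factorgroup_is_group)
  have *: "H #> (f \<otimes> f') = (H #> f) \<otimes>\<^bsub>G Mod H\<^esub> (H #> f')"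
    using assms by (simp add: FactGroup_def rcos_sum)
  show ?thesis unfolding quot_rep_def *
    using assms by (intro Q.regular_rep_mult coset_carrier)
qed

lemma quot_rep_eq_iff:
  assumes "f \<in> carrier G" "f' \<in> carrier G"
  shows "quot_rep G H f = quot_rep G H f' \<longleftrightarrow> H #> f = H #> f'"
proof -
  interpret Q: group "G Mod H" by (rule factorgroup_is_group)
  show ?thesis
    using inj_on_eq_iff[OF Q.regular_rep_inj] assms by (simp add: quot_rep_def coset_carrier)
qed

lemma quot_rep_one: "quot_rep G H \<one> = 0"
  using quot_rep_mult[of \<one> \<one>] by (simp add: eq_add_self_iff)

lemma quot_rep_eq_0_iff:
  assumes "f \<in> carrier G"
  shows "quot_rep G H f = 0 \<longleftrightarrow> f \<in> H"
proof -
  have "quot_rep G H f = 0 \<longleftrightarrow> H #> f = H"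
    using quot_rep_eq_iff[OF assms one_closed] subset by (simp add: quot_rep_one)
  also have "\<dots> \<longleftrightarrow> f \<in> H" using coset_join1 coset_join2 assms subgroup_axioms by blast
  finally show ?thesis .
qed

lemma quot_rep_inv:
  assumes "f \<in> carrier G"
  shows "quot_rep G H (inv f) = - quot_rep G H f"
  using quot_rep_mult[of "inv f" f] assms by (simp add: quot_rep_one eq_neg_iff_add_eq_0)

end

section \<open>Invariance under free reduction\<close>

lemma wval_prepend: "wval f (prepend l w) = lval f l + wval f w"
  by (cases w) (auto simp flip: add.assoc)

lemma wval_foldr_prepend: "wval f (foldr prepend u v) = wval f u + wval f v"
  by (induction u) (simp_all add: wval_prepend add.assoc)

lemma (in cayley_graph) wsum_prepend: "wsum c g (prepend l w) = wsum c g (l # w)"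
proof (cases w)
  case (Cons k v)
  then show ?thesis
    by (auto simp: edge_inv add.assoc)
qed simp

lemma (in cayley_graph) wsum_foldr_prepend: "wsum c g (foldr prepend u v) = wsum c g (u @ v)"
  by (induction u arbitrary: g) (simp_all add: wsum_prepend)

lemma (in cayley_graph) chain_foldr_prepend: "chain g (foldr prepend u v) e = chain g (u @ v) e"
  by (simp add: chain_def wsum_foldr_prepend)

lemma reduced_Nil [simp]: "reduced []"
  by (simp add: reduced_def)

lemma free_group_simps:
  "w \<in> carrier (free_group X) \<longleftrightarrow> set w \<subseteq> X \<times> UNIV \<and> reduced w"
  "u \<otimes>\<^bsub>free_group X\<^esub> v = foldr prepend u v" "\<one>\<^bsub>free_group X\<^esub> = []"
  by (simp_all add: free_group_def)

lemma reduce_closed: "set w \<subseteq> X \<times> UNIV \<Longrightarrow> foldr prepend w [] \<in> carrier (free_group X)"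
  using set_foldr_prepend[of w "[]"] reduced_foldr_prepend[of "[]" w]
  by (auto simp: free_group_simps reduced_def)

locale relation_setup = normal N F for N and F :: "('a, 'm) monoid_scheme" (structure) +
  fixes X :: "'a set" and \<phi> :: "'a \<Rightarrow> ('a \<times> bool) list"
  assumes iso: "\<phi> \<in> iso F (free_group X)"
begin

definition \<psi> where "\<psi> = inv_into (carrier F) \<phi>"

definition \<pi> where "\<pi> = quot_rep F N"

definition \<eta> where "\<eta> x = \<pi> (\<psi> [(x, True)])"

text \<open>Words spelled by paths need not be reduced, so they are reduced before
  \<open>\<psi>\<close> applies.\<close>

definition ev where "ev w = \<psi> (foldr prepend w [])"

sublocale cayley_graph \<eta> .

lemma \<psi>_iso: "\<psi> \<in> iso (free_group X) F"
  unfolding \<psi>_def by (rule iso_set_sym[OF iso])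

lemma \<phi>_closed: "f \<in> carrier F \<Longrightarrow> \<phi> f \<in> carrier (free_group X)"
  and \<psi>_closed: "w \<in> carrier (free_group X) \<Longrightarrow> \<psi> w \<in> carrier F"
  using iso \<psi>_iso by (auto simp: iso_def hom_def)

lemma \<phi>_mult: "f \<in> carrier F \<Longrightarrow> f' \<in> carrier F \<Longrightarrow> \<phi> (f \<otimes> f') = foldr prepend (\<phi> f) (\<phi> f')"
  using iso by (auto simp: iso_def hom_def free_group_simps)

lemma \<psi>_mult: "u \<in> carrier (free_group X) \<Longrightarrow> v \<in> carrier (free_group X) \<Longrightarrow>
    \<psi> (foldr prepend u v) = \<psi> u \<otimes> \<psi> v"
  using \<psi>_iso hom_mult[of \<psi> "free_group X" F u v] by (simp add: iso_def free_group_simps)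

lemma \<psi>_\<phi> [simp]: "f \<in> carrier F \<Longrightarrow> \<psi> (\<phi> f) = f"
  using iso unfolding \<psi>_def by (intro inv_into_f_f) (auto simp: iso_def bij_betw_def)

lemma \<phi>_\<psi> [simp]: "w \<in> carrier (free_group X) \<Longrightarrow> \<phi> (\<psi> w) = w"
  using iso unfolding \<psi>_def by (intro f_inv_into_f) (auto simp: iso_def bij_betw_def)

lemma ev_closed: "set w \<subseteq> X \<times> UNIV \<Longrightarrow> ev w \<in> carrier F"
  by (simp add: ev_def \<psi>_closed reduce_closed)

lemma \<phi>_ev: "set w \<subseteq> X \<times> UNIV \<Longrightarrow> \<phi> (ev w) = foldr prepend w []"
  by (simp add: ev_def reduce_closed)

lemma set_\<phi>: "f \<in> carrier F \<Longrightarrow> set (\<phi> f) \<subseteq> X \<times> UNIV"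
  using \<phi>_closed free_group_simps(1) by blast

text \<open>The universal property of the free group: a homomorphism is evaluated letter by letter.
  The target is left open because the lemma serves both the vertex map \<open>\<pi>\<close> and the
  labels.\<close>

lemma wval_hom:
  fixes q :: "'a \<Rightarrow> 'g::group_add"
  assumes q: "\<And>f f'. f \<in> carrier F \<Longrightarrow> f' \<in> carrier F \<Longrightarrow> q (f \<otimes> f') = q f + q f'"
    and f: "f \<in> carrier F"
  shows "wval (\<lambda>x. q (\<psi> [(x, True)])) (\<phi> f) = q f"
proof -
  have "wval (\<lambda>x. q (\<psi> [(x, True)])) w = q (\<psi> w)" if "w \<in> carrier (free_group X)" for w
    using that
  proof (induction w)
    case Nil
    have "q (\<psi> []) = q (\<psi> []) + q (\<psi> [])"
      using q[of "\<psi> []" "\<psi> []"] \<psi>_mult[OF Nil Nil] \<psi>_closed[OF Nil] by simp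
    then show ?case by (simp add: eq_add_self_iff)
  next
    case (Cons l w)
    have w: "w \<in> carrier (free_group X)" and l: "[l] \<in> carrier (free_group X)"
      and lT: "[(fst l, True)] \<in> carrier (free_group X)"
      using Cons.prems by (auto simp: free_group_simps reduced_Cons)
    have "l # w = foldr prepend [l] w"
      using Cons.prems by (cases w) (auto simp: free_group_simps reduced_Cons)
    then have "q (\<psi> (l # w)) = q (\<psi> [l]) + q (\<psi> w)"
      using \<psi>_mult[OF l w] q \<psi>_closed l w by simp
    moreover have "q (\<psi> [l]) = lval (\<lambda>x. q (\<psi> [(x, True)])) l"
    proof (cases "snd l")
      case True
      then have "l = (fst l, True)" by (simp add: prod_eq_iff)
      then show ?thesis by (metis lval_def snd_conv)
    next
      case False
      then have l': "l = (fst l, False)" by (simp add: prod_eq_iff)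
      have "foldr prepend [l] [(fst l, True)] = []"
        by (subst l') (simp add: letter_inv_def)
      moreover have "q (\<psi> []) = 0"
      proof -
        have n: "[] \<in> carrier (free_group X)" by (simp add: free_group_simps reduced_def)
        have "q (\<psi> []) = q (\<psi> []) + q (\<psi> [])"
          using q[of "\<psi> []" "\<psi> []"] \<psi>_mult[OF n n] \<psi>_closed[OF n] by simp
        then show ?thesis by (simp add: eq_add_self_iff)
      qed
      ultimately have "q (\<psi> [l]) + q (\<psi> [(fst l, True)]) = 0"
        using \<psi>_mult[OF l lT] q \<psi>_closed l lT by metis
      then show ?thesis using False by (simp add: lval_def eq_neg_iff_add_eq_0)
    qed
    ultimately show ?case using Cons.IH[OF w] by simp
  qed
  from this[OF \<phi>_closed[OF f]] show ?thesis using f by simp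
qed

lemma wval_ev:
  fixes q :: "'a \<Rightarrow> 'g::group_add"
  assumes q: "\<And>f f'. f \<in> carrier F \<Longrightarrow> f' \<in> carrier F \<Longrightarrow> q (f \<otimes> f') = q f + q f'"
    and w: "set w \<subseteq> X \<times> UNIV"
  shows "wval (\<lambda>x. q (\<psi> [(x, True)])) w = q (ev w)"
  using wval_hom[of q "ev w"] q ev_closed[OF w] \<phi>_ev[OF w] by (simp add: wval_foldr_prepend)

lemma \<pi>_mult: "f \<in> carrier F \<Longrightarrow> f' \<in> carrier F \<Longrightarrow> \<pi> (f \<otimes> f') = \<pi> f + \<pi> f'"
  and \<pi>_one: "\<pi> \<one> = 0"
  and \<pi>_inv: "f \<in> carrier F \<Longrightarrow> \<pi> (inv f) = - \<pi> f"
  and \<pi>_eq_0_iff: "f \<in> carrier F \<Longrightarrow> \<pi> f = 0 \<longleftrightarrow> f \<in> N"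
  and \<pi>_eq_iff: "f \<in> carrier F \<Longrightarrow> f' \<in> carrier F \<Longrightarrow> \<pi> f = \<pi> f' \<longleftrightarrow> N #> f = N #> f'"
  by (simp_all add: \<pi>_def quot_rep_mult quot_rep_one quot_rep_inv quot_rep_eq_0_iff quot_rep_eq_iff)

lemma wval_\<eta>: "set w \<subseteq> X \<times> UNIV \<Longrightarrow> wval \<eta> w = \<pi> (ev w)"
  using wval_ev[of \<pi> w] \<pi>_mult unfolding \<eta>_def by simp

lemma wval_\<eta>_\<phi>: "f \<in> carrier F \<Longrightarrow> wval \<eta> (\<phi> f) = \<pi> f"
  using wval_hom[of \<pi> f] \<pi>_mult unfolding \<eta>_def by simp

text \<open>The coefficients are those of the Fox derivatives of \<open>f\<close> in the integral
  group ring of the quotient, and \<open>Z_mult\<close> is their product rule. On \<open>N\<close>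
  this induces the Magnus embedding of the relation module.\<close>

definition Z where "Z f = chain 0 (\<phi> f)"

lemma Z_mult:
  assumes "f \<in> carrier F" "f' \<in> carrier F"
  shows "Z (f \<otimes> f') e = Z f e + Z f' (shift (- \<pi> f) e)"
  using assms chain_shift[of "\<pi> f" 0]
  by (simp add: Z_def \<phi>_mult chain_foldr_prepend chain_append wval_\<eta>_\<phi>)

lemma Z_one: "Z \<one> e = 0"
  using Z_mult[of \<one> \<one> e] by (simp add: \<pi>_one)

lemma Z_inv: "f \<in> carrier F \<Longrightarrow> Z (inv f) e = - Z f (shift (\<pi> f) e)"
  using Z_mult[of "inv f" f e] by (simp add: \<pi>_inv Z_one)

lemma Z_mult_N: "n \<in> N \<Longrightarrow> f \<in> carrier F \<Longrightarrow> Z (n \<otimes> f) e = Z n e + Z f e"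
  using Z_mult[of n f e] \<pi>_eq_0_iff[of n] by simp

lemma Z_inv_N: "n \<in> N \<Longrightarrow> Z (inv n) e = - Z n e"
  using Z_inv[of n e] \<pi>_eq_0_iff[of n] by simp

text \<open>Equivariance: the conjugation action becomes translation of chains.\<close>

lemma Z_conj:
  assumes f: "f \<in> carrier F" and n: "n \<in> N"
  shows "Z (f \<otimes> n \<otimes> inv f) e = Z n (shift (- \<pi> f) e)"
  using assms \<pi>_eq_0_iff[of n] by (simp add: Z_mult Z_inv \<pi>_mult)

lemma Z_ev: "set w \<subseteq> X \<times> UNIV \<Longrightarrow> Z (ev w) e = chain 0 w e"
  by (simp add: Z_def \<phi>_ev chain_foldr_prepend)

text \<open>\<open>Z\<close> is additive on \<open>N\<close>, so commutators go to 0. Membership in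
  \<open>N\<close> is carried along because the additivity is available only there.\<close>

lemma Z_derived:
  assumes "d \<in> derived F N"
  shows "d \<in> N \<and> (\<forall>e. Z d e = 0)"
  using assms unfolding derived_def
proof (induction rule: generate.induct)
  case (incl h)
  then obtain a b where "a \<in> N" "b \<in> N" "h = a \<otimes> b \<otimes> inv a \<otimes> inv b" by auto
  then show ?case by (simp add: Z_mult_N Z_inv_N m_assoc)
next
  case (inv h)
  then obtain a b where ab: "a \<in> N" "b \<in> N" "h = a \<otimes> b \<otimes> inv a \<otimes> inv b" by auto
  then have "h \<in> N" "Z h e = 0" for e by (simp_all add: Z_mult_N Z_inv_N m_assoc)
  then show ?case by (simp add: Z_inv_N)
qed (auto simp: Z_one Z_mult_N)

end

section \<open>Normal closures and the abelianized subgroup\<close>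

lemma (in group) normal_closure_normal:
  assumes "S \<subseteq> carrier G"
  shows "normal_closure G S \<lhd> G"
proof -
  define \<H> where "\<H> = {H. H \<lhd> G \<and> S \<subseteq> H}"
  have ne: "\<H> \<noteq> {}" using normal_self assms unfolding \<H>_def by blast
  have "subgroup (\<Inter>\<H>) G"
    by (rule subgroups_Inter) (use ne in \<open>auto simp: \<H>_def normal_imp_subgroup\<close>)
  moreover have "x \<otimes> h \<otimes> inv x \<in> \<Inter>\<H>" if "x \<in> carrier G" "h \<in> \<Inter>\<H>" for x h
  proof (rule InterI)
    fix H assume H: "H \<in> \<H>"
    then have "H \<lhd> G" by (simp add: \<H>_def)
    moreover have "h \<in> H" using that(2) H by (rule InterD)
    ultimately show "x \<otimes> h \<otimes> inv x \<in> H" using normal.inv_op_closed2[of H G x h] that(1) by simp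
  qed
  ultimately have "\<Inter>\<H> \<lhd> G" by (rule normal_invI)
  then show ?thesis unfolding normal_closure_def \<H>_def .
qed

lemma normal_closure_incl: "S \<subseteq> normal_closure G S"
  unfolding normal_closure_def by blast

lemma normal_closure_least: "H \<lhd> G \<Longrightarrow> S \<subseteq> H \<Longrightarrow> normal_closure G S \<subseteq> H"
  unfolding normal_closure_def by blast

lemma (in comm_group) finprod_subgroup:
  assumes "subgroup H G" "\<And>x. x \<in> S \<Longrightarrow> f x \<in> H"
  shows "finprod G f S \<in> H"
  using assms(2)
proof (induction S rule: infinite_finite_induct)
  case (insert x S)
  have "f \<in> insert x S \<rightarrow> carrier G" using insert.prems subgroup.subset[OF assms(1)] by blast
  then show ?case using insert by (simp add: subgroup.m_closed[OF assms(1)])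
qed (simp_all add: subgroup.one_closed[OF assms(1)])

context relation_setup
begin

abbreviation "D \<equiv> derived F N"
abbreviation "A \<equiv> abelianized_subgroup F N"

lemma normal_D: "D \<lhd> F"
  using derived_is_normal normal_axioms by blast

lemma A_mult: "f \<in> carrier F \<Longrightarrow> f' \<in> carrier F \<Longrightarrow> (D #> f) \<otimes>\<^bsub>A\<^esub> (D #> f') = D #> (f \<otimes> f')"
  using normal.rcos_sum[OF normal_D] by (simp add: abelianized_subgroup_def FactGroup_def set_mult_def)

lemma A_one: "\<one>\<^bsub>A\<^esub> = D"
  by (simp add: abelianized_subgroup_def FactGroup_def)

lemma D_one: "D #> \<one> = D"
  using subgroup.subset[OF normal_imp_subgroup[OF normal_D]] by simp

lemma A_closed: "n \<in> N \<Longrightarrow> D #> n \<in> carrier A"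
  unfolding carrier_abelianized_subgroup by blast

lemma comm_group_A: "comm_group A"
  by (rule comm_group_abelianized_subgroup) (rule normal_axioms)

lemma A_inv: "n \<in> N \<Longrightarrow> inv\<^bsub>A\<^esub> (D #> n) = D #> inv n"
proof -
  interpret A: comm_group A by (rule comm_group_A)
  assume n: "n \<in> N"
  show ?thesis
    by (rule A.inv_equality) (use n in \<open>simp_all add: A_mult A_one D_one A_closed\<close>)
qed

lemma D_coset_eq_iff:
  assumes "f \<in> carrier F" "f' \<in> carrier F"
  shows "D #> f = D #> f' \<longleftrightarrow> f \<otimes> inv f' \<in> D"
proof -
  have s: "subgroup D F" by (rule normal_imp_subgroup[OF normal_D])
  have "D #> f = D #> f' \<longleftrightarrow> f \<in> D #> f'"
    using repr_independence[OF _ assms(2) s, of f] rcos_self[OF assms(1) s] by auto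
  then show ?thesis using subgroup.rcos_module[OF s group_axioms assms(2,1)] by simp
qed

text \<open>The copy of \<open>F Mod N\<close> among the permutations; \<open>H0 \<times> X\<close>
  is the set of edges of the Cayley graph proper inside the graph on the whole type.\<close>

definition H0 where "H0 = \<pi> ` carrier F"

lemma H0_subgroup: "add_subgroup H0"
  unfolding add_subgroup_def H0_def
proof (intro conjI ballI)
  show "0 \<in> \<pi> ` carrier F" using \<pi>_one by (metis image_eqI one_closed)
  show "x + y \<in> \<pi> ` carrier F" if "x \<in> \<pi> ` carrier F" "y \<in> \<pi> ` carrier F" for x y
    using that by (auto simp: \<pi>_mult[symmetric])
  show "- x \<in> \<pi> ` carrier F" if "x \<in> \<pi> ` carrier F" for x
    using that by (auto simp: \<pi>_inv[symmetric])
qed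

lemma letter_closed: "x \<in> X \<Longrightarrow> [(x, b)] \<in> carrier (free_group X)"
  by (auto simp: free_group_simps reduced_Cons)

lemma \<eta>_H0: "x \<in> X \<Longrightarrow> \<eta> x \<in> H0"
  unfolding \<eta>_def H0_def using \<psi>_closed letter_closed by blast

lemma lval_H0: "fst l \<in> X \<Longrightarrow> lval \<eta> l \<in> H0"
  using \<eta>_H0 add_subgroupD[OF H0_subgroup] by (simp add: lval_def)

lemma edges_H0: "g \<in> H0 \<Longrightarrow> set w \<subseteq> X \<times> UNIV \<Longrightarrow> edges g w \<subseteq> H0 \<times> X"
proof (induction w arbitrary: g)
  case (Cons l w)
  have l: "fst l \<in> X" using Cons.prems by auto
  have "edge g l \<in> H0 \<times> X"
    using l Cons.prems(1) \<eta>_H0 add_subgroupD[OF H0_subgroup] by (auto simp: edge_def)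
  then show ?case
    using Cons lval_H0[OF l] add_subgroupD(2)[OF H0_subgroup] by auto
qed simp

lemma edges_letters: "edges g w \<subseteq> E \<times> X \<Longrightarrow> set w \<subseteq> X \<times> UNIV"
proof (induction w arbitrary: g)
  case (Cons l w)
  have "edge g l \<in> E \<times> X" using Cons.prems by auto
  then have "fst l \<in> X" by (auto simp: edge_def)
  moreover have "set w \<subseteq> X \<times> UNIV" by (rule Cons.IH) (use Cons.prems in auto)
  ultimately show ?case by (cases l) auto
qed simp

lemma edges_start_H0:
  assumes "w \<noteq> []" "edges g w \<subseteq> H0 \<times> X"
  shows "g \<in> H0"
proof -
  obtain e where e: "e \<in> edges g w" "g = fst e \<or> g = tgt e" using edges_start[OF assms(1)] by blast
  then have "fst e \<in> H0" "snd e \<in> X" using assms(2) by auto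
  then show ?thesis using e(2) \<eta>_H0 add_subgroupD(2)[OF H0_subgroup] by (auto simp: tgt_def)
qed

lemma ev_append:
  assumes "set u \<subseteq> X \<times> UNIV" "set v \<subseteq> X \<times> UNIV"
  shows "ev (u @ v) = ev u \<otimes> ev v"
proof -
  have "reduced (foldr prepend v [])" by (rule reduced_foldr_prepend) simp
  then have "foldr prepend (u @ v) [] = foldr prepend (foldr prepend u []) (foldr prepend v [])"
    by (simp add: foldr_prepend_assoc)
  then show ?thesis using assms by (simp add: ev_def \<psi>_mult reduce_closed)
qed

lemma ev_Nil: "ev [] = \<one>"
  using ev_append[of "[]" "[]"] ev_closed[of "[]"] by simp

lemma ev_\<phi>: "f \<in> carrier F \<Longrightarrow> ev (\<phi> f) = f"
proof -
  assume f: "f \<in> carrier F"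
  have "\<phi> \<one> = []" using iso hom_one[of \<phi> F "free_group X"] group_free_group[of X]
    by (simp add: iso_def free_group_simps is_group)
  then have "\<phi> f = foldr prepend (\<phi> f) []" using \<phi>_mult[OF f one_closed] f by simp
  then show ?thesis using f by (metis ev_def \<psi>_\<phi>)
qed

lemma ev_inv_letter:
  assumes "fst l \<in> X"
  shows "ev [letter_inv l] = inv (ev [l])"
proof -
  have s: "set [l] \<subseteq> X \<times> UNIV" "set [letter_inv l] \<subseteq> X \<times> UNIV"
    using assms by (simp_all add: letter_inv_def mem_Times_iff)
  have "ev ([letter_inv l] @ [l]) = \<one>" using ev_Nil by (simp add: ev_def)
  then have "ev [letter_inv l] \<otimes> ev [l] = \<one>" using ev_append[OF s(2,1)] by simp
  then show ?thesis using ev_closed s inv_equality by metis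
qed

text \<open>
  A closed path determines an element of \<open>N\<close>, and its class in \<open>N/[N,N]\<close> is a product over the
  edges of the path; so this class only depends on the chain of the path.
\<close>

definition \<sigma> where "\<sigma> g = (if g = 0 then \<one> else SOME f. f \<in> carrier F \<and> \<pi> f = g)"

definition edge_class where
  "edge_class e = D #> (\<sigma> (fst e) \<otimes> ev [(snd e, True)] \<otimes> inv (\<sigma> (tgt e)))"

lemma \<sigma>: "g \<in> H0 \<Longrightarrow> \<sigma> g \<in> carrier F" "g \<in> H0 \<Longrightarrow> \<pi> (\<sigma> g) = g"
proof -
  have "\<sigma> g \<in> carrier F \<and> \<pi> (\<sigma> g) = g" if "g \<in> H0"
  proof (cases "g = 0")
    case True
    then show ?thesis by (simp add: \<sigma>_def \<pi>_one)
  next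
    case False
    have "\<exists>f. f \<in> carrier F \<and> \<pi> f = g" using that by (auto simp: H0_def)
    from someI_ex[OF this] show ?thesis using False by (simp add: \<sigma>_def)
  qed
  then show "g \<in> H0 \<Longrightarrow> \<sigma> g \<in> carrier F" "g \<in> H0 \<Longrightarrow> \<pi> (\<sigma> g) = g" by blast+
qed

lemma path_in_N:
  assumes "g \<in> H0" "set w \<subseteq> X \<times> UNIV"
  shows "g + wval \<eta> w \<in> H0" "\<sigma> g \<otimes> ev w \<otimes> inv (\<sigma> (g + wval \<eta> w)) \<in> N"
proof -
  have w: "ev w \<in> carrier F" "wval \<eta> w = \<pi> (ev w)" using ev_closed wval_\<eta> assms(2) by auto
  then have "wval \<eta> w \<in> H0" by (simp add: H0_def)
  then show g': "g + wval \<eta> w \<in> H0" using add_subgroupD(2)[OF H0_subgroup] assms(1) by blast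
  have "\<pi> (\<sigma> g \<otimes> ev w \<otimes> inv (\<sigma> (g + wval \<eta> w))) = 0"
    using \<sigma> assms(1) g' w by (simp add: \<pi>_mult \<pi>_inv)
  then show "\<sigma> g \<otimes> ev w \<otimes> inv (\<sigma> (g + wval \<eta> w)) \<in> N"
    using \<pi>_eq_0_iff \<sigma>(1) assms(1) g' w(1) by (metis inv_closed m_closed)
qed

lemma edge_class_closed:
  assumes "e \<in> H0 \<times> X"
  shows "edge_class e \<in> carrier A"
proof -
  have "\<sigma> (fst e) \<otimes> ev [(snd e, True)] \<otimes> inv (\<sigma> (fst e + wval \<eta> [(snd e, True)])) \<in> N"
    by (rule path_in_N) (use assms in auto)
  then show ?thesis unfolding edge_class_def by (intro A_closed) (simp add: tgt_def lval_def)
qed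

lemma edge_class_pow:
  assumes "g \<in> H0" "fst l \<in> X"
  shows "edge_class (edge g l) [^]\<^bsub>A\<^esub> lsgn l = D #> (\<sigma> g \<otimes> ev [l] \<otimes> inv (\<sigma> (g + lval \<eta> l)))"
proof -
  interpret A: comm_group A by (rule comm_group_A)
  have l: "set [l] \<subseteq> X \<times> UNIV" using assms(2) by (simp add: mem_Times_iff)
  have "edge g l \<in> H0 \<times> X" using edges_H0[OF assms(1) l] by simp
  then have c: "edge_class (edge g l) \<in> carrier A" by (rule edge_class_closed)
  show ?thesis
  proof (cases "snd l")
    case True
    then have "l = (fst l, True)" by (simp add: prod_eq_iff)
    moreover have "edge_class (edge g l) = D #> (\<sigma> g \<otimes> ev [(fst l, True)] \<otimes> inv (\<sigma> (g + lval \<eta> l)))"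
      using True by (simp add: edge_class_def edge_ends)
    ultimately show ?thesis using True c by (simp add: lsgn_def A.int_pow_1)
  next
    case False
    define k where "k = letter_inv l"
    have k: "k = (fst l, True)" "l = letter_inv k" using False by (simp_all add: k_def letter_inv_def prod_eq_iff)
    have g': "g + lval \<eta> l \<in> H0" using path_in_N(1)[OF assms(1) l] by simp
    have kX: "set [k] \<subseteq> X \<times> UNIV" "fst k \<in> X" using assms(2) k(1) by auto
    have N: "\<sigma> (g + lval \<eta> l) \<otimes> ev [k] \<otimes> inv (\<sigma> g) \<in> N"
      using path_in_N(2)[OF g' kX(1)] by (simp add: k_def add.assoc)
    have "edge_class (edge g l) = D #> (\<sigma> (g + lval \<eta> l) \<otimes> ev [k] \<otimes> inv (\<sigma> g))"
      using False by (simp add: edge_class_def edge_ends k(1))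
    then have "edge_class (edge g l) [^]\<^bsub>A\<^esub> lsgn l = inv\<^bsub>A\<^esub> (D #> (\<sigma> (g + lval \<eta> l) \<otimes> ev [k] \<otimes> inv (\<sigma> g)))"
      using False c by (simp add: lsgn_def A.int_pow_neg)
    also have "\<dots> = D #> inv (\<sigma> (g + lval \<eta> l) \<otimes> ev [k] \<otimes> inv (\<sigma> g))" by (rule A_inv[OF N])
    also have "inv (\<sigma> (g + lval \<eta> l) \<otimes> ev [k] \<otimes> inv (\<sigma> g)) = \<sigma> g \<otimes> ev [l] \<otimes> inv (\<sigma> (g + lval \<eta> l))"
      using \<sigma>(1)[OF assms(1)] \<sigma>(1)[OF g'] ev_closed[OF kX(1)] ev_inv_letter[OF kX(2)]
      by (simp add: inv_mult_group m_assoc k(2)[symmetric])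
    finally show ?thesis .
  qed
qed

text \<open>Abelianized Reidemeister-Schreier rewriting: the representatives \<open>\<sigma>\<close>
  inserted at the vertices cancel between consecutive letters, and commutativity of \<open>A\<close>
  collects the factors of each edge. The set \<open>B\<close> stays fixed while the path
  shortens.\<close>

lemma path_class:
  assumes "finite B" "B \<subseteq> H0 \<times> X" "g \<in> H0" "set w \<subseteq> X \<times> UNIV" "edges g w \<subseteq> B"
  shows "D #> (\<sigma> g \<otimes> ev w \<otimes> inv (\<sigma> (g + wval \<eta> w))) =
    finprod A (\<lambda>e. edge_class e [^]\<^bsub>A\<^esub> chain g w e) B"
  using assms(3-5)
proof (induction w arbitrary: g)
  interpret A: comm_group A by (rule comm_group_A)
  case Nil
  then show ?case using \<sigma>(1) by (simp add: ev_Nil D_one) (simp add: A_one)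
next
  interpret A: comm_group A by (rule comm_group_A)
  case (Cons l w)
  define g' where "g' = g + lval \<eta> l"
  have l: "set [l] \<subseteq> X \<times> UNIV" "fst l \<in> X" and w: "set w \<subseteq> X \<times> UNIV"
    using Cons.prems(2) by auto
  have g': "g' \<in> H0" using path_in_N(1)[OF Cons.prems(1) l(1)] by (simp add: g'_def)
  have end_H0: "g' + wval \<eta> w \<in> H0" by (rule path_in_N(1)[OF g' w])
  have IH: "D #> (\<sigma> g' \<otimes> ev w \<otimes> inv (\<sigma> (g' + wval \<eta> w))) =
     finprod A (\<lambda>e. edge_class e [^]\<^bsub>A\<^esub> chain g' w e) B"
    using Cons.IH[OF g' w] Cons.prems(3) by (simp add: g'_def)
  have B: "edge_class e \<in> carrier A" if "e \<in> B" for e using that assms(2) edge_class_closed by blast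
  have eB: "edge g l \<in> B" using Cons.prems(3) by simp
  have "finprod A (\<lambda>e. edge_class e [^]\<^bsub>A\<^esub> chain g (l # w) e) B =
    finprod A (\<lambda>e. edge_class e [^]\<^bsub>A\<^esub> (lsgn l * of_bool (edge g l = e)) \<otimes>\<^bsub>A\<^esub> edge_class e [^]\<^bsub>A\<^esub> chain g' w e) B"
    by (rule A.finprod_cong') (use B in \<open>auto simp: chain_def g'_def A.int_pow_mult\<close>)
  also have "\<dots> = finprod A (\<lambda>e. edge_class e [^]\<^bsub>A\<^esub> (lsgn l * of_bool (edge g l = e))) B \<otimes>\<^bsub>A\<^esub>
      finprod A (\<lambda>e. edge_class e [^]\<^bsub>A\<^esub> chain g' w e) B"
    by (rule A.finprod_multf) (use B in auto)
  also have "finprod A (\<lambda>e. edge_class e [^]\<^bsub>A\<^esub> (lsgn l * of_bool (edge g l = e))) B =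
      finprod A (\<lambda>e. if edge g l = e then edge_class e [^]\<^bsub>A\<^esub> lsgn l else \<one>\<^bsub>A\<^esub>) B"
    by (rule A.finprod_cong') (use B in auto)
  also have "\<dots> = edge_class (edge g l) [^]\<^bsub>A\<^esub> lsgn l"
    by (rule A.finprod_singleton[OF eB assms(1)]) (use B in auto)
  also have "\<dots> = D #> (\<sigma> g \<otimes> ev [l] \<otimes> inv (\<sigma> g'))"
    using edge_class_pow[OF Cons.prems(1) l(2)] by (simp add: g'_def)
  also have "\<dots> \<otimes>\<^bsub>A\<^esub> finprod A (\<lambda>e. edge_class e [^]\<^bsub>A\<^esub> chain g' w e) B =
      D #> (\<sigma> g \<otimes> ev [l] \<otimes> inv (\<sigma> g') \<otimes> (\<sigma> g' \<otimes> ev w \<otimes> inv (\<sigma> (g' + wval \<eta> w))))"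
    unfolding IH[symmetric] using \<sigma>(1) Cons.prems(1) g' end_H0 ev_closed l(1) w
    by (intro A_mult) simp_all
  also have "\<sigma> g \<otimes> ev [l] \<otimes> inv (\<sigma> g') \<otimes> (\<sigma> g' \<otimes> ev w \<otimes> inv (\<sigma> (g' + wval \<eta> w))) =
      \<sigma> g \<otimes> ev (l # w) \<otimes> inv (\<sigma> (g + wval \<eta> (l # w)))"
  proof -
    have "inv (\<sigma> g') \<otimes> (\<sigma> g' \<otimes> z) = z" if "z \<in> carrier F" for z
      using that \<sigma>(1)[OF g'] by (simp flip: m_assoc)
    then show ?thesis
      using \<sigma>(1)[OF Cons.prems(1)] \<sigma>(1)[OF g'] \<sigma>(1)[OF end_H0] ev_closed[OF l(1)] ev_closed[OF w]
        ev_append[OF l(1) w]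
      by (simp add: m_assoc g'_def add.assoc)
  qed
  finally show ?case by simp
qed

text \<open>Injectivity of the Magnus embedding: all exponents in \<open>path_class\<close> are
  0.\<close>

lemma Z_kernel:
  assumes "n \<in> N" "\<And>e. Z n e = 0"
  shows "n \<in> D"
proof -
  interpret A: comm_group A by (rule comm_group_A)
  have n: "n \<in> carrier F" using assms(1) by simp
  have 0: "0 \<in> H0" by (rule add_subgroupD(1)[OF H0_subgroup])
  have "D #> (\<sigma> 0 \<otimes> ev (\<phi> n) \<otimes> inv (\<sigma> (0 + wval \<eta> (\<phi> n)))) =
    finprod A (\<lambda>e. edge_class e [^]\<^bsub>A\<^esub> chain 0 (\<phi> n) e) (edges 0 (\<phi> n))"
    by (rule path_class) (use 0 edges_H0 set_\<phi>[OF n] in auto)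
  also have "\<dots> = \<one>\<^bsub>A\<^esub>" using assms(2) by (simp add: Z_def)
  \<comment> \<open>The path of \<open>n\<close> is closed at 0, so both representatives are
    \<open>\<sigma> 0\<close>, which was set to \<open>\<one>\<close> for this purpose.\<close>
  finally have "D #> n = D"
    using n \<pi>_eq_0_iff[OF n] assms(1) by (simp add: \<sigma>_def ev_\<phi> wval_\<eta>_\<phi> A_one)
  then show ?thesis using coset_join1 n normal_imp_subgroup[OF normal_D] by blast
qed

text \<open>The elements of \<open>N\<close> whose chain lies in the span map onto a submodule that
  contains the generator, hence onto the whole module.\<close>

lemma in_span_of_generator:
  assumes r0: "r0 \<in> N" and gen: "submodule_generated (group_ring (F Mod N)) (relation_module F N) {D #> r0} =
      carrier (relation_module F N)"
    and n: "n \<in> N"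
  shows "in_span H0 (Z r0) (Z n)"
proof -
  interpret A: comm_group A by (rule comm_group_A)
  define K where "K = {n \<in> N. in_span H0 (Z r0) (Z n)}"
  define M where "M = {D #> n | n. n \<in> K}"
  have K_N: "K \<subseteq> N" by (auto simp: K_def)
  have "subgroup M A"
  proof
    show "M \<subseteq> carrier A" using K_N A_closed by (auto simp: M_def)
    show "x \<otimes>\<^bsub>A\<^esub> y \<in> M" if xy: "x \<in> M" "y \<in> M" for x y
    proof -
      obtain a b where ab: "a \<in> K" "b \<in> K" "x = D #> a" "y = D #> b" using xy by (auto simp: M_def)
      have abN: "a \<in> N" "b \<in> N" using ab K_N by auto
      then have "Z (a \<otimes> b) = (\<lambda>e. Z a e + Z b e)"
        by (intro ext) (simp add: Z_mult_N)
      then have "a \<otimes> b \<in> K"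
        using ab abN in_span_add[of H0 "Z r0" "Z a" "Z b"] by (simp add: K_def)
      moreover have "x \<otimes>\<^bsub>A\<^esub> y = D #> (a \<otimes> b)" using abN unfolding ab(3,4) by (intro A_mult) simp_all
      ultimately show ?thesis by (auto simp: M_def)
    qed
    have "Z \<one> = (\<lambda>e. 0)" by (rule ext) (rule Z_one)
    then have "\<one> \<in> K" using in_span_zero by (simp add: K_def)
    then show "\<one>\<^bsub>A\<^esub> \<in> M" unfolding M_def using D_one A_one by force
    show "inv\<^bsub>A\<^esub> x \<in> M" if x: "x \<in> M" for x
    proof -
      obtain a where a: "a \<in> K" "x = D #> a" using x by (auto simp: M_def)
      have aN: "a \<in> N" using a K_N by auto
      then have "Z (inv a) = (\<lambda>e. - Z a e)"
        by (intro ext) (simp add: Z_inv_N)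
      then have "inv a \<in> K" using a aN in_span_uminus[of H0 "Z r0" "Z a"] by (simp add: K_def)
      moreover have "inv\<^bsub>A\<^esub> x = D #> inv a" using A_inv[OF aN] a(2) by simp
      ultimately show ?thesis by (auto simp: M_def)
    qed
  qed
  have conj: "conj_action F g x \<in> M" if g: "g \<in> carrier (F Mod N)" and x: "x \<in> M" for g x
  proof -
    obtain f where f: "f \<in> carrier F" "g = N #> f" using g by (auto simp: FactGroup_def RCOSETS_def)
    obtain a where a: "a \<in> K" "x = D #> a" using x by (auto simp: M_def)
    have aN: "a \<in> N" using a K_N by auto
    then have "Z (f \<otimes> a \<otimes> inv f) = (\<lambda>e. Z a (shift (- \<pi> f) e))"
      by (intro ext) (simp add: Z_conj f)
    then have "f \<otimes> a \<otimes> inv f \<in> K"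
      using f a inv_op_closed2[OF f(1) aN] in_span_shift[OF H0_subgroup, of "\<pi> f" "Z r0" "Z a"]
      by (simp add: K_def H0_def)
    then show ?thesis
      using conj_action_coset[OF normal_axioms f(1) aN] a f by (auto simp: M_def)
  qed
  have m_inv: "inv\<^bsub>add_monoid (relation_module F N)\<^esub> x = inv\<^bsub>A\<^esub> x" for x
    by (simp add: relation_module_def m_inv_def)
  have "subgroup M (add_monoid (relation_module F N))"
  proof
    fix x assume "x \<in> M"
    then show "inv\<^bsub>add_monoid (relation_module F N)\<^esub> x \<in> M"
      unfolding m_inv by (rule subgroup.m_inv_closed[OF \<open>subgroup M A\<close>])
  qed (use \<open>subgroup M A\<close> in \<open>auto simp: relation_module_def subgroup_def\<close>)
  moreover have "a \<odot>\<^bsub>relation_module F N\<^esub> x \<in> M" if "x \<in> M" for a x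
    unfolding relation_module_def
    using that by (auto intro!: A.finprod_subgroup[OF \<open>subgroup M A\<close>] conj
        A.subgroup_int_pow_closed[OF \<open>subgroup M A\<close>])
  ultimately have "submodule M (group_ring (F Mod N)) (relation_module F N)"
    unfolding submodule_def submodule_axioms_def by simp
  moreover have "D #> r0 \<in> M"
    using r0 in_span_self add_subgroupD(1)[OF H0_subgroup] by (auto simp: M_def K_def)
  ultimately have "carrier (relation_module F N) \<subseteq> M"
    unfolding gen[symmetric] submodule_generated_def by blast
  moreover have "D #> n \<in> carrier (relation_module F N)"
    using A_closed[OF n] by (simp add: relation_module_def)
  ultimately obtain k where k: "k \<in> K" "D #> n = D #> k" by (auto simp: M_def)
  have kN: "k \<in> N" using k K_N by blast
  \<comment> \<open>The submodule determines \<open>n\<close> only up to \<open>D\<close>, and there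
    \<open>Z\<close> vanishes.\<close>
  then have "n \<otimes> inv k \<in> D" using D_coset_eq_iff k(2) n by simp
  then have "Z (n \<otimes> inv k) e = 0" for e using Z_derived by blast
  then have "Z n e = Z k e" for e using n kN by (auto simp: Z_mult_N Z_inv_N)
  then have "Z n = Z k" by (rule ext)
  then show ?thesis using k(1) by (simp add: K_def)
qed


section \<open>Transport of the order and choice of the relator\<close>

lemma right_order_H0:
  assumes "right_orderable (F Mod N)"
  obtains leq where "right_order_on H0 leq"
proof -
  obtain R where R: "linear_order_on (carrier (F Mod N)) R"
    and mono: "\<And>a b g. a \<in> carrier (F Mod N) \<Longrightarrow> b \<in> carrier (F Mod N) \<Longrightarrow> g \<in> carrier (F Mod N) \<Longrightarrow>
      (a, b) \<in> R - Id \<Longrightarrow> (a \<otimes>\<^bsub>F Mod N\<^esub> g, b \<otimes>\<^bsub>F Mod N\<^esub> g) \<in> R - Id"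
    using assms unfolding right_orderable_def by blast
  have refl: "refl_on (carrier (F Mod N)) R" and tr: "\<And>a b c. (a, b) \<in> R \<Longrightarrow> (b, c) \<in> R \<Longrightarrow> (a, c) \<in> R"
    and anti: "\<And>a b. (a, b) \<in> R \<Longrightarrow> (b, a) \<in> R \<Longrightarrow> a = b"
    and tot: "total_on (carrier (F Mod N)) R"
    using R unfolding linear_order_on_def partial_order_on_def preorder_on_def trans_def antisym_def
    by blast+
  define leq where "leq x y \<longleftrightarrow>
    (\<exists>f\<in>carrier F. \<exists>f'\<in>carrier F. x = \<pi> f \<and> y = \<pi> f' \<and> (N #> f, N #> f') \<in> R)" for x y
  have leq_iff: "leq (\<pi> f) (\<pi> f') \<longleftrightarrow> (N #> f, N #> f') \<in> R"
    if "f \<in> carrier F" "f' \<in> carrier F" for f f'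
    unfolding leq_def using that \<pi>_eq_iff by metis
  have "right_order_on H0 leq"
    unfolding right_order_on_def H0_def
  proof (intro conjI ballI impI; elim imageE; hypsubst)
    fix f f' assume f: "f \<in> carrier F" "f' \<in> carrier F"
    show "leq (\<pi> f) (\<pi> f') \<or> leq (\<pi> f') (\<pi> f)"
    proof (cases "N #> f = N #> f'")
      case True
      then show ?thesis using f refl coset_carrier unfolding leq_iff[OF f] refl_on_def by metis
    next
      case False
      then show ?thesis using f tot coset_carrier by (simp add: leq_iff total_on_def)
    qed
    assume "leq (\<pi> f) (\<pi> f')" "leq (\<pi> f') (\<pi> f)"
    then show "\<pi> f = \<pi> f'" using f anti by (simp add: leq_iff \<pi>_eq_iff)
  next
    fix f f' k assume f: "f \<in> carrier F" "f' \<in> carrier F" "k \<in> carrier F"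
    assume "leq (\<pi> f) (\<pi> f')" "leq (\<pi> f') (\<pi> k)"
    then show "leq (\<pi> f) (\<pi> k)" using f tr[of "N #> f" "N #> f'" "N #> k"] by (simp add: leq_iff)
  next
    fix f f' k assume f: "f \<in> carrier F" "f' \<in> carrier F" "k \<in> carrier F"
    assume le: "leq (\<pi> f) (\<pi> f')"
    have mult: "N #> (f \<otimes> k) = (N #> f) \<otimes>\<^bsub>F Mod N\<^esub> (N #> k)" if "f \<in> carrier F" for f
      using that f by (simp add: FactGroup_def rcos_sum)
    show "leq (\<pi> f + \<pi> k) (\<pi> f' + \<pi> k)"
    \<comment> \<open>\<open>right_orderable\<close> concerns the strict order, so equal cosets are
      treated apart.\<close>
    proof (cases "N #> f = N #> f'")
      case True
      then have "\<pi> f + \<pi> k = \<pi> (f' \<otimes> k)" "\<pi> f' + \<pi> k = \<pi> (f' \<otimes> k)"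
        using f \<pi>_eq_iff \<pi>_mult by metis+
      moreover have "leq (\<pi> (f' \<otimes> k)) (\<pi> (f' \<otimes> k))"
        using f refl coset_carrier[of "f' \<otimes> k"] by (simp add: leq_iff refl_on_def)
      ultimately show ?thesis by simp
    next
      case False
      then have "(N #> f, N #> f') \<in> R - Id" using le f by (simp add: leq_iff)
      then have "(N #> (f \<otimes> k), N #> (f' \<otimes> k)) \<in> R"
        using mono[of "N #> f" "N #> f'" "N #> k"] f coset_carrier by (simp add: mult)
      then show ?thesis using f by (simp add: leq_iff \<pi>_mult[symmetric])
    qed
  qed
  then show thesis by (rule that)
qed

text \<open>The relator is the simple cycle spelled from the right base point. Injectivity of the
  Magnus embedding identifies its class with \<open>r\<close>, and flatness of the labels modulo its
  normal closure gives all of \<open>N\<close>.\<close>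

theorem exists_normal_generator:
  assumes ord: "right_orderable (F Mod N)"
    and r: "r \<in> carrier (relation_module F N)"
    and gen: "submodule_generated (group_ring (F Mod N)) (relation_module F N) {r} =
      carrier (relation_module F N)"
  shows "\<exists>w\<in>N. derived F N #> w = r \<and> normal_closure F {w} = N"
proof -
  note Hs = add_subgroupD[OF H0_subgroup]
  obtain leq where leq: "right_order_on H0 leq" using right_order_H0[OF ord] .
  obtain r0 where r0: "r0 \<in> N" "r = D #> r0"
    using r unfolding relation_module_def carrier_abelianized_subgroup by auto
  have spanN: "in_span H0 (Z r0) (Z n)" if "n \<in> N" for n
    using in_span_of_generator[OF r0(1) gen[unfolded r0(2)] that] .
  have span: "in_span H0 (Z r0) (chain g v)" if gv: "edges g v \<subseteq> H0 \<times> X" "wval \<eta> v = 0" for g v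
  proof (cases "v = []")
    case True
    then have "chain g v = (\<lambda>e. 0)" by (auto simp: chain_def)
    then show ?thesis using in_span_zero by simp
  next
    case False
    have v: "set v \<subseteq> X \<times> UNIV" by (rule edges_letters[OF gv(1)])
    have "ev v \<in> N" using gv(2) \<pi>_eq_0_iff[OF ev_closed[OF v]] by (simp add: wval_\<eta>[OF v])
    moreover have "chain g v = (\<lambda>e. Z (ev v) (shift (- g) e))"
      using chain_shift[of g 0 v] by (auto simp: Z_ev[OF v])
    ultimately show ?thesis
      using in_span_shift[OF H0_subgroup edges_start_H0[OF False gv(1)]] spanN by simp
  qed
  have conclusion: "normal_closure F {w} = N"
    if w: "w \<in> N" and flat: "flat (H0 \<times> X) (\<lambda>x. quot_rep F (normal_closure F {w}) (\<psi> [(x, True)]))" for w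
  proof
    define M where "M = normal_closure F {w}"
    interpret M: normal M F unfolding M_def by (rule normal_closure_normal) (use w in simp)
    show "normal_closure F {w} \<subseteq> N" by (rule normal_closure_least[OF normal_axioms]) (use w in simp)
    show "N \<subseteq> normal_closure F {w}"
    proof
      fix n assume n: "n \<in> N"
      then have "edges 0 (\<phi> n) \<subseteq> H0 \<times> X" "wval \<eta> (\<phi> n) = 0"
        using edges_H0 Hs(1) set_\<phi> \<pi>_eq_0_iff by (simp_all add: wval_\<eta>_\<phi>)
      then have "wval (\<lambda>x. quot_rep F M (\<psi> [(x, True)])) (\<phi> n) = 0"
        using flat unfolding flat_def M_def by blast
      then have "quot_rep F M n = 0" using wval_hom[of "quot_rep F M" n] M.quot_rep_mult n by simp
      then show "n \<in> normal_closure F {w}" using M.quot_rep_eq_0_iff n by (simp add: M_def)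
    qed
  qed
  show ?thesis
  proof (cases "\<forall>e. Z r0 e = 0")
    \<comment> \<open>All closed paths then have zero chain, so there is no simple closed path at
      all and every label is flat.\<close>
    case True
    define lam where "lam = (\<lambda>x. quot_rep F (normal_closure F {r0}) (\<psi> [(x, True)]))"
    have "flat (H0 \<times> X) lam"
    proof (rule ccontr)
      assume "\<not> ?thesis"
      then obtain g v where "edges g v \<subseteq> H0 \<times> X" "wval \<eta> v = 0" "wval lam v \<noteq> 0"
        unfolding flat_def by blast
      then obtain g' u where u: "scycle g' u" "edges g' u \<subseteq> H0 \<times> X" by (metis obtain_scycle)
      then have "u \<noteq> []" "wval \<eta> u = 0" by (auto simp: scycle_def)
      then have "edges g' u \<noteq> {}" by (cases u) auto
      moreover have "chain g' u e = 0" for e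
        using span[OF u(2) \<open>wval \<eta> u = 0\<close>] True unfolding in_span_def by auto
      ultimately show False using chain_scycle_nonzero_iff[OF u(1)] by blast
    qed
    then have "normal_closure F {r0} = N" using conclusion[OF r0(1)] by (simp add: lam_def)
    then show ?thesis using r0 by blast
  next
    case False
    then obtain e1 where e1: "Z r0 e1 \<noteq> 0" by blast
    have r0F: "r0 \<in> carrier F" using r0 by simp
    have supp: "{e. Z r0 e \<noteq> 0} \<subseteq> H0 \<times> X"
      using edges_H0[OF Hs(1) set_\<phi>[OF r0F]] chain_nonzero_edges[of 0 "\<phi> r0"] unfolding Z_def by blast
    obtain g c k where c: "scycle g c" "edges g c \<subseteq> {e. Z r0 e \<noteq> 0}"
      and k: "\<And>e. chain g c e = k * Z r0 e" "k = 1 \<or> k = -1"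
    proof (rule generator_is_scycle[OF H0_subgroup leq, of "Z r0" "\<phi> r0" e1])
      show "Z r0 = chain 0 (\<phi> r0)" by (simp add: Z_def)
      show "wval \<eta> (\<phi> r0) = 0" using r0 r0F \<pi>_eq_0_iff by (simp add: wval_\<eta>_\<phi>)
      show "fst e \<in> H0" if "Z r0 e \<noteq> 0" for e using that supp by auto
      show "in_span H0 (Z r0) (chain g w)" if "edges g w \<subseteq> {e. Z r0 e \<noteq> 0}" "wval \<eta> w = 0" for g w
        using span that supp by blast
    qed (use e1 that in auto)
    have c': "c \<noteq> []" "wval \<eta> c = 0" using c by (auto simp: scycle_def)
    have edges_c: "edges g c \<subseteq> H0 \<times> X" using c(2) supp by blast
    have gH0: "g \<in> H0" by (rule edges_start_H0[OF c'(1) edges_c])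
    \<comment> \<open>Traversing the cycle backwards repairs the sign, so that its class becomes
      \<open>r\<close> and not the inverse.\<close>
    define b where "b = (if k = 1 then c else winv c)"
    have chain_b: "chain g b e = Z r0 e" for e
      using k chain_winv[of g c e] c'(2) by (auto simp: b_def)
    have "edges g b \<subseteq> H0 \<times> X"
      using edges_c edges_winv[of g c] c'(2) by (auto simp: b_def)
    then have b: "set b \<subseteq> X \<times> UNIV" by (rule edges_letters)
    have "wval \<eta> b = 0" using c'(2) by (simp add: b_def)
    then have evb: "ev b \<in> N" using \<pi>_eq_0_iff[OF ev_closed[OF b]] by (simp add: wval_\<eta>[OF b])
    \<comment> \<open>The word \<open>b\<close> by itself spells the cycle translated to the base
      point 0; conjugation by a lift of \<open>g\<close> moves it back.\<close>
    obtain f where f: "f \<in> carrier F" "\<pi> f = g" using gH0 by (auto simp: H0_def)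
    define w where "w = f \<otimes> ev b \<otimes> inv f"
    have w: "w \<in> N" unfolding w_def by (rule inv_op_closed2[OF f(1) evb])
    have Z_w: "Z w e = Z r0 e" for e
      using chain_shift[of g 0 b e] chain_b[of e] by (simp add: w_def Z_conj[OF f(1) evb] f(2) Z_ev[OF b])
    have "w \<otimes> inv r0 \<in> D"
      by (rule Z_kernel) (use w r0 Z_w in \<open>simp_all add: Z_mult_N Z_inv_N\<close>)
    then have "D #> w = r" using D_coset_eq_iff w r0 by simp
    define M where "M = normal_closure F {w}"
    interpret M: normal M F unfolding M_def by (rule normal_closure_normal) (use w in simp)
    define lam where "lam = (\<lambda>x. quot_rep F M (\<psi> [(x, True)]))"
    have lam_ev: "wval lam v = quot_rep F M (ev v)" if "set v \<subseteq> X \<times> UNIV" for v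
      unfolding lam_def using wval_ev[of "quot_rep F M" v] M.quot_rep_mult that by simp
    have "w \<in> M" using normal_closure_incl[of "{w}" F] by (simp add: M_def)
    then have "quot_rep F M w = 0" using M.quot_rep_eq_0_iff w by simp
    then have "quot_rep F M f + quot_rep F M (ev b) - quot_rep F M f = 0"
      using f evb by (simp add: w_def M.quot_rep_mult M.quot_rep_inv)
    then have "quot_rep F M f + quot_rep F M (ev b) = quot_rep F M f + 0" by simp
    then have "quot_rep F M (ev b) = 0" by (simp only: add_left_cancel)
    then have "wval lam b = 0" using lam_ev[OF b] by simp
    then have lam_c: "wval lam c = 0" by (simp add: b_def split: if_splits)
    have orbit_sub: "orbit H0 (edges g c) \<subseteq> H0 \<times> X"
      using edges_c Hs(2) unfolding orbit_def by (auto simp: shift_def)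
    have span_c: "in_span H0 (chain g c) (chain g' v)"
      if gv: "edges g' v \<subseteq> H0 \<times> X" "wval \<eta> v = 0" for g' v
    proof -
      have kk: "k * (k * x) = x" for x using k(2) by auto
      obtain S a where S: "finite S" "S \<subseteq> H0" "chain g' v = (\<lambda>e. \<Sum>h\<in>S. a h * Z r0 (shift (- h) e))"
        using span[OF gv] unfolding in_span_def by blast
      show ?thesis
      proof (rule in_spanI[OF S(1,2), of _ "\<lambda>h. k * a h"])
        fix e
        have "k * a h * chain g c (shift (- h) e) = a h * Z r0 (shift (- h) e)" for h
          using kk[of "a h * Z r0 (shift (- h) e)"] by (simp only: k(1) ac_simps)
        then show "chain g' v e = (\<Sum>h\<in>S. k * a h * chain g c (shift (- h) e))" unfolding S(3) by (simp only:)
      qed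
    qed
    have "flat (orbit H0 (edges g c)) lam"
      by (rule flat_orbit[OF H0_subgroup unique_products_right_order[OF H0_subgroup leq] c(1) lam_c])
         (use span_c orbit_sub in blast)
    \<comment> \<open>The chain of a simple closed path is nonzero on each of its edges and is
      spanned by translates of the cycle, so the path runs inside their orbit.\<close>
    moreover have "flat (H0 \<times> X) lam"
    proof (rule ccontr)
      assume "\<not> ?thesis"
      then obtain g1 v where "edges g1 v \<subseteq> H0 \<times> X" "wval \<eta> v = 0" "wval lam v \<noteq> 0"
        unfolding flat_def by blast
      then obtain g' u where u: "scycle g' u" "edges g' u \<subseteq> H0 \<times> X" "wval lam u \<noteq> 0" by (metis obtain_scycle)
      then have u0: "wval \<eta> u = 0" by (auto simp: scycle_def)
      obtain S a where S: "finite S" "S \<subseteq> H0" "chain g' u = (\<lambda>e. \<Sum>h\<in>S. a h * chain g c (shift (- h) e))"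
        using span_c[OF u(2) u0] unfolding in_span_def by blast
      have "edges g' u \<subseteq> orbit H0 (edges g c)"
      proof
        fix e assume "e \<in> edges g' u"
        then have "chain g' u e \<noteq> 0" using chain_scycle_nonzero_iff[OF u(1)] by blast
        then obtain h where h: "h \<in> S" "chain g c (shift (- h) e) \<noteq> 0"
          unfolding S(3) by (metis (no_types, lifting) mult_zero_right sum.neutral)
        then have "shift h (shift (- h) e) \<in> orbit H0 (edges g c)"
          using S(2) chain_nonzero_edges by (intro orbitI) auto
        then show "e \<in> orbit H0 (edges g c)" by simp
      qed
      then show False using \<open>flat (orbit H0 (edges g c)) lam\<close> u0 u(3) unfolding flat_def by blast
    qed
    then have "normal_closure F {w} = N" using conclusion[OF w] by (simp add: lam_def M_def)
    then show ?thesis using w \<open>D #> w = r\<close> by blast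
  qed
qed

end

text \<open>\<open>one_relator_group\<close> asks for a standard free group, so the relator is moved
  along \<open>\<phi>\<close>. An isomorphism carries normal closures to normal closures, which
  identifies the kernel of the composite with the projection; the first isomorphism theorem
  concludes.\<close>

lemma one_relator_group_of_normal_closure:
  fixes F :: "('a, 'm) monoid_scheme" and X :: "'a set"
  assumes F: "group F" and iso: "\<phi> \<in> iso F (free_group X)" and w: "w \<in> carrier F"
  shows "one_relator_group TYPE('a) (F Mod normal_closure F {w})"
proof -
  define K where "K = free_group X"
  define M where "M = normal_closure K {\<phi> w}"
  interpret K: group K unfolding K_def by (rule group_free_group)
  interpret F: group F by (rule F)
  have \<phi>: "\<phi> \<in> hom F K" "bij_betw \<phi> (carrier F) (carrier K)" using iso by (auto simp: iso_def K_def)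
  have \<phi>w: "\<phi> w \<in> carrier K" using \<phi>(1) w by (auto simp: hom_def)
  interpret M: normal M K unfolding M_def by (rule K.normal_closure_normal) (use \<phi>w in simp)
  have hom: "(\<lambda>f. M #>\<^bsub>K\<^esub> \<phi> f) \<in> hom F (K Mod M)"
    using hom_compose[OF \<phi>(1) M.r_coset_hom_Mod] by (simp add: comp_def)
  interpret h: group_hom F "K Mod M" "\<lambda>f. M #>\<^bsub>K\<^esub> \<phi> f"
    by (intro group_hom.intro F M.factorgroup_is_group) (simp add: group_hom_axioms_def hom)
  have "kernel F (K Mod M) (\<lambda>f. M #>\<^bsub>K\<^esub> \<phi> f) = normal_closure F {w}"
  proof
    have ker: "f \<in> kernel F (K Mod M) (\<lambda>f. M #>\<^bsub>K\<^esub> \<phi> f) \<longleftrightarrow> f \<in> carrier F \<and> \<phi> f \<in> M" for f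
    proof (cases "f \<in> carrier F")
      case True
      then have "\<phi> f \<in> carrier K" using \<phi>(1) by (auto simp: hom_def)
      then have "M #>\<^bsub>K\<^esub> \<phi> f = M \<longleftrightarrow> \<phi> f \<in> M"
        using K.coset_join1 K.coset_join2 M.subgroup_axioms by blast
      then show ?thesis using True by (simp add: kernel_def FactGroup_def)
    qed (simp add: kernel_def)
    show "normal_closure F {w} \<subseteq> kernel F (K Mod M) (\<lambda>f. M #>\<^bsub>K\<^esub> \<phi> f)"
      using normal_closure_incl[of "{\<phi> w}" K] w ker
      by (intro normal_closure_least h.normal_kernel) (simp add: M_def)
    have "\<phi> ` normal_closure F {w} \<lhd> K"
      using iso_normal_subgroup[OF iso F group_free_group] F.normal_closure_normal[of "{w}"] w
      by (simp add: K_def)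
    moreover have "\<phi> w \<in> \<phi> ` normal_closure F {w}" using normal_closure_incl[of "{w}" F] by simp
    ultimately have M_sub: "M \<subseteq> \<phi> ` normal_closure F {w}" unfolding M_def by (intro normal_closure_least) auto
    have sub: "normal_closure F {w} \<subseteq> carrier F"
      using normal_imp_subgroup[OF F.normal_closure_normal[of "{w}"]] w subgroup.subset by blast
    show "kernel F (K Mod M) (\<lambda>f. M #>\<^bsub>K\<^esub> \<phi> f) \<subseteq> normal_closure F {w}"
    proof
      fix f assume "f \<in> kernel F (K Mod M) (\<lambda>f. M #>\<^bsub>K\<^esub> \<phi> f)"
      then have f: "f \<in> carrier F" "\<phi> f \<in> M" using ker by auto
      then obtain f' where "f' \<in> normal_closure F {w}" "\<phi> f = \<phi> f'" using M_sub by blast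
      then show "f \<in> normal_closure F {w}"
        using f(1) sub \<phi>(2) unfolding bij_betw_def by (metis inj_on_eq_iff subsetD)
    qed
  qed
  moreover have "(\<lambda>f. M #>\<^bsub>K\<^esub> \<phi> f) ` carrier F = carrier (K Mod M)"
  proof -
    have "(\<lambda>f. M #>\<^bsub>K\<^esub> \<phi> f) ` carrier F = (\<lambda>k. M #>\<^bsub>K\<^esub> k) ` carrier K"
      using \<phi>(2) unfolding bij_betw_def by (metis image_image)
    then show ?thesis by (auto simp: FactGroup_def RCOSETS_def)
  qed
  ultimately have "F Mod normal_closure F {w} \<cong> K Mod M" using h.FactGroup_iso by simp
  then show ?thesis unfolding one_relator_group_def using \<phi>w by (auto simp: K_def M_def)
qed

theorem corollary1p7:
  fixes F :: "('a, 'm) monoid_scheme" and N r :: "'a set"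
  assumes "is_free_group F"
    and "N \<lhd> F"
    and "right_orderable (F Mod N)"
    and "r \<in> carrier (relation_module F N)"
    and "submodule_generated (group_ring (F Mod N)) (relation_module F N) {r} =
         carrier (relation_module F N)"
  shows "(\<exists>w\<in>N. derived F N #>\<^bsub>F\<^esub> w = r \<and> normal_closure F {w} = N) \<and>
         one_relator_group TYPE('a) (F Mod N)"
proof -
  obtain X :: "'a set" and \<phi> where iso: "\<phi> \<in> iso F (free_group X)"
    using assms(1) unfolding is_free_group_def is_iso_def by blast
  interpret normal N F by fact
  interpret relation_setup N F X \<phi> by unfold_locales (rule iso)
  obtain w where w: "w \<in> N" "derived F N #>\<^bsub>F\<^esub> w = r" "normal_closure F {w} = N"
    using exists_normal_generator[OF assms(3-5)] by blast
  moreover have "one_relator_group TYPE('a) (F Mod N)"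
    using one_relator_group_of_normal_closure[OF is_group iso, of w] w by simp
  ultimately show ?thesis by blast
qed

end
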